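(* Let $X$ be a symmetrically regular complex Banach space such that $X^{**}$ has the metric approximation property. Then the operator $T_\Theta:\mathcal G_0(B_{X^{**}})\to\mathcal G_0(B_X)^{**}$ (defined in the context) embeds $\mathcal G_0(B_{X^{**}})$ as a $1$-locally complemented subspace of $\mathcal G_0(B_X)^{**}$. In particular, $T_\Theta$ is an isometry (onto its image).
   Context: $X$ is symmetrically regular if every bounded symmetric linear operator $T:X\to X^*$ (i.e. $T(x)(y)=T(y)(x)$ for all $x,y\in X$) is weakly compact. A Banach space $E$ has the metric approximation property if the identity of $E$ is a pointwise limit of a net of finite-rank operators on $E$ of norm at most $1$. A subspace $E$ of a Banach space $F$ is $1$-locally complemented in $F$ if for every $\varepsilon>0$ and every finite dimensional subspace $G$ of $F$ there is a linear map $T:G\to E$ with $\|T\|\le1+\varepsilon$ and $T(x)=x$ for all $x\in G\cap E$. $B_X$ is the open unit ball of $X$. $\mathcal HL_0(B_X,Y)$ is the Banach space of holomorphic Lipschitz maps $f:B_X\to Y$ with $f(0)=0$, normed by the Lipschitz constant $L(f)$; $\mathcal HL_0(B_X)=\mathcal HL_0(B_X,\mathbb C)$. With $\tau_0$ the compact-open topology (uniform convergence on compact subsets of $B_X$), $\mathcal G_0(B_X)=\{\varphi\in\mathcal HL_0(B_X)^*: \varphi \text{ restricted to } \{f:L(f)\le1\}\text{ is }\tau_0\text{-continuous}\}$, with the norm of $\mathcal HL_0(B_X)^*$. One has $\mathcal G_0(B_X)^*=\mathcal HL_0(B_X)$ isometrically, via $\langle f,\varphi\rangle=\varphi(f)$,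 so $\mathcal G_0(B_X)^{**}=\mathcal HL_0(B_X)^*$. For $x\in B_X$, $\delta_X(x)\in\mathcal G_0(B_X)$ is evaluation at $x$, and for every complex Banach space $Y$ and every $f\in\mathcal HL_0(B_X,Y)$ there is a unique bounded operator $T_f:\mathcal G_0(B_X)\to Y$ with $T_f\circ\delta_X=f$. The same applies with $X^{**}$ in place of $X$. AB (Aron-Berner) extension: for a bounded symmetric $n$-linear form $A$ on $X$, put $\widetilde A(x_1^{**},\dots,x_n^{**})=\lim_{\alpha_1}\cdots\lim_{\alpha_n}A(x_{\alpha_1},\dots,x_{\alpha_n})$, where $(x_{\alpha_i})\subset X$ is a net weak-star convergent to $x_i^{**}$; for the $n$-homogeneous polynomial $P(x)=A(x,\dots,x)$ put $\widetilde P(x^{**})=\widetilde A(x^{**},\dots,x^{**})$. For a bounded holomorphic $f:B_X\to\mathbb C$ with Taylor series $\sum_k P_k$ at $0$, $\widetilde f=\sum_k\widetilde P_k$ on $B_{X^{**}}$. For $X$ symmetrically regular, $\Theta:B_{X^{**}}\to\mathcal G_0(B_X)^{**}=\mathcal HL_0(B_X)^*$ is defined by $\Theta(x^{**})(f)=\widetilde f(x^{**})$; it belongs to $\mathcal HL_0(B_{X^{**}},\mathcal G_0(B_X)^{**})$. $T_\Theta$ is the unique bounded operator with $T_\Theta(\delta_{X^{**}}(x^{**}))=\Theta(x^{**})$ for all $x^{**}\in B_{X^{**}}$. *)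

theory Defs
  imports "HOL-Analysis.Analysis"
begin

section \<open>Complex normed spaces\<close>

class complex_normed_vector = real_normed_vector +
  fixes scaleC :: "complex \<Rightarrow> 'a \<Rightarrow> 'a" (infixr "*\<^sub>C" 75)
  assumes scaleC_of_real: "complex_of_real r *\<^sub>C x = r *\<^sub>R x"
    and scaleC_add_right: "c *\<^sub>C (x + y) = c *\<^sub>C x + c *\<^sub>C y"
    and scaleC_add_left: "(c + d) *\<^sub>C x = c *\<^sub>C x + d *\<^sub>C x"
    and scaleC_scaleC: "c *\<^sub>C d *\<^sub>C x = (c * d) *\<^sub>C x"
    and norm_scaleC: "norm (c *\<^sub>C x) = cmod c * norm x"

class complex_banach = complex_normed_vector + banach

lemma scaleC_one [simp]: "1 *\<^sub>C x = (x :: 'a::complex_normed_vector)"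
  using scaleC_of_real[of 1 x] by simp

global_interpretation complex_vector:
  vector_space "scaleC :: complex \<Rightarrow> 'a \<Rightarrow> 'a::complex_normed_vector"
  by unfold_locales
    (simp_all add: scaleC_add_right scaleC_add_left scaleC_scaleC)

instantiation complex :: complex_normed_vector
begin

definition scaleC_complex :: "complex \<Rightarrow> complex \<Rightarrow> complex"
  where "scaleC_complex c z = c * z"

instance
  by standard
    (simp_all add: scaleC_complex_def scaleR_conv_of_real algebra_simps norm_mult)

end

instance complex :: complex_banach ..


section \<open>Bounded complex-linear operators and duals\<close>

typedef (overloaded) ('a, 'b) cblinfun =
  "{f :: 'a::complex_normed_vector \<Rightarrow> 'b::complex_normed_vector.
      bounded_linear f \<and> (\<forall>c x. f (c *\<^sub>C x) = c *\<^sub>C f x)}"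
  morphisms cblinfun_apply CBlinfun
  by (rule exI[of _ "\<lambda>x. 0"]) simp

setup_lifting type_definition_cblinfun

lemma cblinfun_eqI: "(\<And>x. cblinfun_apply S x = cblinfun_apply T x) \<Longrightarrow> S = T"
  by transfer auto

lemma bounded_linear_scaleC: "bounded_linear (\<lambda>x :: 'a::complex_normed_vector. c *\<^sub>C x)"
proof (rule bounded_linear_intro[where K = "cmod c"])
  fix r :: real and x :: 'a
  show "c *\<^sub>C (r *\<^sub>R x) = r *\<^sub>R (c *\<^sub>C x)"
    by (simp add: scaleC_of_real[symmetric] scaleC_scaleC mult.commute)
qed (simp_all add: scaleC_add_right norm_scaleC mult.commute)

lemma onorm_scaleC:
  fixes f :: "'a::real_normed_vector \<Rightarrow> 'b::complex_normed_vector"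
  assumes "bounded_linear f"
  shows "onorm (\<lambda>x. c *\<^sub>C f x) = cmod c * onorm f"
proof -
  have "onorm (\<lambda>x. c *\<^sub>C f x) = onorm (\<lambda>x. cmod c *\<^sub>R f x)"
    unfolding onorm_def by (simp add: norm_scaleC)
  then show ?thesis
    using onorm_scaleR[OF assms, of "cmod c"] by simp
qed

instantiation cblinfun :: (complex_normed_vector, complex_normed_vector) complex_normed_vector
begin

lift_definition zero_cblinfun :: "('a, 'b) cblinfun" is "\<lambda>x. 0"
  by simp

lift_definition plus_cblinfun ::
  "('a, 'b) cblinfun \<Rightarrow> ('a, 'b) cblinfun \<Rightarrow> ('a, 'b) cblinfun" is "\<lambda>f g x. f x + g x"
  by (simp add: bounded_linear_add scaleC_add_right)

lift_definition minus_cblinfun ::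
  "('a, 'b) cblinfun \<Rightarrow> ('a, 'b) cblinfun \<Rightarrow> ('a, 'b) cblinfun" is "\<lambda>f g x. f x - g x"
  by (simp add: bounded_linear_sub complex_vector.scale_right_diff_distrib)

lift_definition uminus_cblinfun :: "('a, 'b) cblinfun \<Rightarrow> ('a, 'b) cblinfun" is "\<lambda>f x. - f x"
  by (simp add: bounded_linear_minus)

lift_definition scaleC_cblinfun ::
  "complex \<Rightarrow> ('a, 'b) cblinfun \<Rightarrow> ('a, 'b) cblinfun" is "\<lambda>c f x. c *\<^sub>C f x"
  by (auto simp: scaleC_scaleC mult.commute intro: bounded_linear_compose[OF bounded_linear_scaleC])

definition scaleR_cblinfun :: "real \<Rightarrow> ('a, 'b) cblinfun \<Rightarrow> ('a, 'b) cblinfun"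
  where "scaleR_cblinfun r f = complex_of_real r *\<^sub>C f"

lift_definition norm_cblinfun :: "('a, 'b) cblinfun \<Rightarrow> real" is onorm .

definition dist_cblinfun :: "('a, 'b) cblinfun \<Rightarrow> ('a, 'b) cblinfun \<Rightarrow> real"
  where "dist_cblinfun f g = norm (f - g)"

definition sgn_cblinfun :: "('a, 'b) cblinfun \<Rightarrow> ('a, 'b) cblinfun"
  where "sgn_cblinfun f = inverse (norm f) *\<^sub>R f"

definition uniformity_cblinfun :: "(('a, 'b) cblinfun \<times> ('a, 'b) cblinfun) filter"
  where "uniformity_cblinfun = (INF e\<in>{0<..}. principal {(x, y). dist x y < e})"

definition open_cblinfun :: "('a, 'b) cblinfun set \<Rightarrow> bool"
  where "open_cblinfun S = (\<forall>x\<in>S. \<forall>\<^sub>F (x', y) in uniformity. x' = x \<longrightarrow> y \<in> S)"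

instance
proof
  fix f g h :: "('a, 'b) cblinfun" and r s :: real and c d :: complex
  show "(norm f = 0) = (f = 0)"
    by transfer (auto simp: onorm_eq_0)
  show "norm (f + g) \<le> norm f + norm g"
    by transfer (auto intro: onorm_triangle)
  show nC: "norm (c *\<^sub>C f) = cmod c * norm f" for c
    by transfer (auto simp: onorm_scaleC)
  show "norm (r *\<^sub>R f) = \<bar>r\<bar> * norm f"
    by (simp add: scaleR_cblinfun_def nC)
  show "f + g + h = f + (g + h)" "f + g = g + f" "0 + f = f" "- f + f = 0" "f - g = f + - g"
    by (transfer; simp add: add.assoc add.commute fun_eq_iff)+
  show "r *\<^sub>R (f + g) = r *\<^sub>R f + r *\<^sub>R g" "(r + s) *\<^sub>R f = r *\<^sub>R f + s *\<^sub>R f"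
    "r *\<^sub>R s *\<^sub>R f = (r * s) *\<^sub>R f" "1 *\<^sub>R f = f"
    unfolding scaleR_cblinfun_def
    by (transfer; simp add: scaleC_add_right scaleC_add_left scaleC_scaleC)+
  show "complex_of_real r *\<^sub>C f = r *\<^sub>R f"
    by (simp add: scaleR_cblinfun_def)
  show "c *\<^sub>C (f + g) = c *\<^sub>C f + c *\<^sub>C g" "(c + d) *\<^sub>C f = c *\<^sub>C f + d *\<^sub>C f"
    "c *\<^sub>C d *\<^sub>C f = (c * d) *\<^sub>C f"
    by (transfer; simp add: scaleC_add_right scaleC_add_left scaleC_scaleC)+
qed (simp_all add: dist_cblinfun_def sgn_cblinfun_def uniformity_cblinfun_def open_cblinfun_def)

end

type_synonym 'a dual = "('a, complex) cblinfun"
type_synonym 'a bidual = "'a dual dual"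


section \<open>Weak compactness, approximation, local complementation\<close>

definition weak_topology :: "'a::complex_normed_vector topology"
  where "weak_topology = topology_generated_by {cblinfun_apply \<phi> -` U | (\<phi> :: 'a dual) U. open U}"

definition weakly_compact_operator ::
  "('a::complex_normed_vector, 'b::complex_normed_vector) cblinfun \<Rightarrow> bool"
  where "weakly_compact_operator T \<longleftrightarrow>
    compactin weak_topology (weak_topology closure_of (cblinfun_apply T ` ball 0 1))"

definition symmetrically_regular :: "'a::complex_normed_vector itself \<Rightarrow> bool"
  where "symmetrically_regular _ \<longleftrightarrow>
    (\<forall>T :: ('a, 'a dual) cblinfun.
       (\<forall>x y. cblinfun_apply (cblinfun_apply T x) y = cblinfun_apply (cblinfun_apply T y) x) \<longrightarrow>
       weakly_compact_operator T)"

definition finite_rank ::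
  "('a::complex_normed_vector, 'b::complex_normed_vector) cblinfun \<Rightarrow> bool"
  where "finite_rank T \<longleftrightarrow> (\<exists>B. finite B \<and> range (cblinfun_apply T) \<subseteq> complex_vector.span B)"

text \<open>Nets of operators are encoded by proper filters on the space of operators: a net gives
  its eventuality filter, and every proper filter is the eventuality filter of some net.\<close>

definition metric_approximation_property :: "'a::complex_normed_vector itself \<Rightarrow> bool"
  where "metric_approximation_property _ \<longleftrightarrow>
    (\<exists>F :: ('a, 'a) cblinfun filter. F \<noteq> bot \<and>
       (\<forall>\<^sub>F T in F. finite_rank T \<and> norm T \<le> 1) \<and>
       (\<forall>x. ((\<lambda>T. cblinfun_apply T x) \<longlongrightarrow> x) F))"

text \<open>The linear map on \<open>G\<close> is represented by a function on the whole space of which only the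
  values on \<open>G\<close> matter.\<close>

definition one_locally_complemented :: "'a::complex_normed_vector set \<Rightarrow> bool"
  where "one_locally_complemented E \<longleftrightarrow> complex_vector.subspace E \<and>
    (\<forall>\<epsilon>>0. \<forall>G. (\<exists>B. finite B \<and> G = complex_vector.span B) \<longrightarrow>
       (\<exists>T :: 'a \<Rightarrow> 'a.
          T ` G \<subseteq> E \<and>
          (\<forall>x\<in>G. \<forall>y\<in>G. T (x + y) = T x + T y) \<and>
          (\<forall>c. \<forall>x\<in>G. T (c *\<^sub>C x) = c *\<^sub>C T x) \<and>
          (\<forall>x\<in>G. norm (T x) \<le> (1 + \<epsilon>) * norm x) \<and>
          (\<forall>x\<in>G \<inter> E. T x = x)))"


section \<open>Holomorphic Lipschitz maps on the unit ball\<close>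

definition holomorphic_ball :: "('a::complex_normed_vector \<Rightarrow> 'b::complex_normed_vector) \<Rightarrow> bool"
  where "holomorphic_ball f \<longleftrightarrow>
    (\<forall>x\<in>ball 0 1. \<exists>D :: ('a, 'b) cblinfun. (f has_derivative cblinfun_apply D) (at x))"

lemma holomorphic_ball_zero: "holomorphic_ball (\<lambda>x. 0)"
  unfolding holomorphic_ball_def
  by (auto intro!: exI[of _ 0] simp: zero_cblinfun.rep_eq)

lemma holomorphic_ball_add:
  "holomorphic_ball f \<Longrightarrow> holomorphic_ball g \<Longrightarrow> holomorphic_ball (\<lambda>x. f x + g x)"
  unfolding holomorphic_ball_def
proof
  fix x :: 'a assume x: "x \<in> ball 0 1"
    and f: "\<forall>x\<in>ball 0 1. \<exists>D :: ('a, 'b) cblinfun. (f has_derivative cblinfun_apply D) (at x)"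
    and g: "\<forall>x\<in>ball 0 1. \<exists>D :: ('a, 'b) cblinfun. (g has_derivative cblinfun_apply D) (at x)"
  obtain D E :: "('a, 'b) cblinfun" where
    "(f has_derivative cblinfun_apply D) (at x)" "(g has_derivative cblinfun_apply E) (at x)"
    using f g x by blast
  then have "((\<lambda>x. f x + g x) has_derivative cblinfun_apply (D + E)) (at x)"
    by (auto simp: plus_cblinfun.rep_eq intro: has_derivative_add)
  then show "\<exists>D :: ('a, 'b) cblinfun. ((\<lambda>x. f x + g x) has_derivative cblinfun_apply D) (at x)"
    by blast
qed

lemma holomorphic_ball_scaleC:
  "holomorphic_ball f \<Longrightarrow> holomorphic_ball (\<lambda>x. c *\<^sub>C f x)"
  unfolding holomorphic_ball_def
proof
  fix x :: 'a assume x: "x \<in> ball 0 1"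
    and f: "\<forall>x\<in>ball 0 1. \<exists>D :: ('a, 'b) cblinfun. (f has_derivative cblinfun_apply D) (at x)"
  obtain D :: "('a, 'b) cblinfun" where "(f has_derivative cblinfun_apply D) (at x)"
    using f x by blast
  then have "((\<lambda>x. c *\<^sub>C f x) has_derivative cblinfun_apply (c *\<^sub>C D)) (at x)"
    unfolding scaleC_cblinfun.rep_eq
    by (rule bounded_linear.has_derivative[OF bounded_linear_scaleC])
  then show "\<exists>D :: ('a, 'b) cblinfun. ((\<lambda>x. c *\<^sub>C f x) has_derivative cblinfun_apply D) (at x)"
    by blast
qed

lemma lipschitz_on_scaleC:
  fixes f :: "'a::metric_space \<Rightarrow> 'b::complex_normed_vector"
  assumes "C-lipschitz_on U f"
  shows "(cmod c * C)-lipschitz_on U (\<lambda>x. c *\<^sub>C f x)"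
proof (rule lipschitz_onI)
  fix x y assume "x \<in> U" "y \<in> U"
  then have "norm (f x - f y) \<le> C * dist x y"
    using lipschitz_onD[OF assms] by (simp add: dist_norm)
  then have "cmod c * norm (f x - f y) \<le> cmod c * (C * dist x y)"
    by (rule mult_left_mono) simp
  then show "dist (c *\<^sub>C f x) (c *\<^sub>C f y) \<le> cmod c * C * dist x y"
    by (simp add: dist_norm norm_scaleC mult.assoc flip: complex_vector.scale_right_diff_distrib)
qed (use lipschitz_on_nonneg[OF assms] in simp)

text \<open>Maps on the open unit ball are represented by functions vanishing outside of it, so that
  equality of representatives is equality on the ball.\<close>

typedef (overloaded) ('a, 'b) HL0 =
  "{f :: 'a::complex_normed_vector \<Rightarrow> 'b::complex_normed_vector.
      holomorphic_ball f \<and> (\<exists>C. C-lipschitz_on (ball 0 1) f) \<and> f 0 = 0 \<and>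
      (\<forall>x. x \<notin> ball 0 1 \<longrightarrow> f x = 0)}"
  morphisms HL0_apply Abs_HL0
  by (rule exI[of _ "\<lambda>x. 0"]) (auto simp: holomorphic_ball_zero intro: lipschitz_on_constant)

setup_lifting type_definition_HL0

lemma HL0_eqI: "(\<And>x. HL0_apply f x = HL0_apply g x) \<Longrightarrow> f = g"
  by transfer auto

definition lipschitz_const :: "('a::real_normed_vector \<Rightarrow> 'b::real_normed_vector) \<Rightarrow> real"
  where "lipschitz_const f = Inf {C. C-lipschitz_on (ball 0 1) f}"

lemma lipschitz_const_le: "C-lipschitz_on (ball 0 1) f \<Longrightarrow> lipschitz_const f \<le> C"
  unfolding lipschitz_const_def
  by (rule cInf_lower) (auto intro: bdd_belowI lipschitz_on_nonneg)

lemma lipschitz_on_lipschitz_const: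
  fixes f :: "'a::real_normed_vector \<Rightarrow> 'b::real_normed_vector"
  assumes "C-lipschitz_on (ball 0 1) f"
  shows "(lipschitz_const f)-lipschitz_on (ball 0 1) f"
proof (rule lipschitz_onI)
  have ne: "{C. C-lipschitz_on (ball 0 1) f} \<noteq> {}"
    using assms by auto
  show "0 \<le> lipschitz_const f"
    unfolding lipschitz_const_def
    by (rule cInf_greatest[OF ne]) (auto intro: lipschitz_on_nonneg)
  fix x y :: 'a assume xy: "x \<in> ball 0 1" "y \<in> ball 0 1"
  show "dist (f x) (f y) \<le> lipschitz_const f * dist x y"
  proof (cases "x = y")
    case False
    have "dist (f x) (f y) / dist x y \<le> lipschitz_const f"
      unfolding lipschitz_const_def
    proof (rule cInf_greatest[OF ne])
      fix C assume "C \<in> {C. C-lipschitz_on (ball 0 1) f}"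
      then have "dist (f x) (f y) \<le> C * dist x y"
        using lipschitz_onD xy by blast
      with False show "dist (f x) (f y) / dist x y \<le> C"
        by (simp add: pos_divide_le_eq)
    qed
    with False show ?thesis
      by (simp add: pos_divide_le_eq)
  qed simp
qed

lemma lipschitz_const_scaleC:
  fixes f :: "'a::real_normed_vector \<Rightarrow> 'b::complex_normed_vector"
  assumes "C-lipschitz_on (ball 0 1) f"
  shows "lipschitz_const (\<lambda>x. c *\<^sub>C f x) = cmod c * lipschitz_const f"
proof (rule antisym)
  note * = lipschitz_on_scaleC[OF lipschitz_on_lipschitz_const[OF assms], of c]
  show "lipschitz_const (\<lambda>x. c *\<^sub>C f x) \<le> cmod c * lipschitz_const f"
    by (rule lipschitz_const_le[OF *])
  show "cmod c * lipschitz_const f \<le> lipschitz_const (\<lambda>x. c *\<^sub>C f x)"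
  proof (cases "c = 0")
    case True
    then show ?thesis
      using lipschitz_on_nonneg[OF lipschitz_on_lipschitz_const[OF *]] by simp
  next
    case False
    have "lipschitz_const (\<lambda>x. inverse c *\<^sub>C c *\<^sub>C f x)
        \<le> cmod (inverse c) * lipschitz_const (\<lambda>x. c *\<^sub>C f x)"
      by (intro lipschitz_const_le lipschitz_on_scaleC lipschitz_on_lipschitz_const[OF *])
    then have "lipschitz_const f \<le> lipschitz_const (\<lambda>x. c *\<^sub>C f x) / cmod c"
      using False by (simp add: scaleC_scaleC norm_inverse divide_inverse mult.commute)
    with False show ?thesis
      by (simp add: pos_le_divide_eq mult.commute)
  qed
qed

lemma HL0_lipschitz: "(lipschitz_const (HL0_apply f))-lipschitz_on (ball 0 1) (HL0_apply f)"
  using HL0_apply[of f] lipschitz_on_lipschitz_const by auto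

lemma HL0_zero [simp]: "HL0_apply f 0 = 0"
  using HL0_apply[of f] by auto

lemma HL0_outside: "x \<notin> ball 0 1 \<Longrightarrow> HL0_apply f x = 0"
  using HL0_apply[of f] by auto

instantiation HL0 :: (complex_normed_vector, complex_normed_vector) complex_normed_vector
begin

lift_definition zero_HL0 :: "('a, 'b) HL0" is "\<lambda>x. 0"
  by (auto simp: holomorphic_ball_zero intro: lipschitz_on_constant)

lift_definition plus_HL0 :: "('a, 'b) HL0 \<Rightarrow> ('a, 'b) HL0 \<Rightarrow> ('a, 'b) HL0"
  is "\<lambda>f g x. f x + g x"
  by (auto intro: holomorphic_ball_add lipschitz_on_add)

lift_definition scaleC_HL0 :: "complex \<Rightarrow> ('a, 'b) HL0 \<Rightarrow> ('a, 'b) HL0"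
  is "\<lambda>c f x. c *\<^sub>C f x"
  by (auto intro: holomorphic_ball_scaleC lipschitz_on_scaleC)

definition uminus_HL0 :: "('a, 'b) HL0 \<Rightarrow> ('a, 'b) HL0"
  where "uminus_HL0 f = (- 1) *\<^sub>C f"

definition minus_HL0 :: "('a, 'b) HL0 \<Rightarrow> ('a, 'b) HL0 \<Rightarrow> ('a, 'b) HL0"
  where "minus_HL0 f g = f + (- 1) *\<^sub>C g"

definition scaleR_HL0 :: "real \<Rightarrow> ('a, 'b) HL0 \<Rightarrow> ('a, 'b) HL0"
  where "scaleR_HL0 r f = complex_of_real r *\<^sub>C f"

lift_definition norm_HL0 :: "('a, 'b) HL0 \<Rightarrow> real" is lipschitz_const .

definition dist_HL0 :: "('a, 'b) HL0 \<Rightarrow> ('a, 'b) HL0 \<Rightarrow> real"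
  where "dist_HL0 f g = norm (f - g)"

definition sgn_HL0 :: "('a, 'b) HL0 \<Rightarrow> ('a, 'b) HL0"
  where "sgn_HL0 f = inverse (norm f) *\<^sub>R f"

definition uniformity_HL0 :: "(('a, 'b) HL0 \<times> ('a, 'b) HL0) filter"
  where "uniformity_HL0 = (INF e\<in>{0<..}. principal {(x, y). dist x y < e})"

definition open_HL0 :: "('a, 'b) HL0 set \<Rightarrow> bool"
  where "open_HL0 S = (\<forall>x\<in>S. \<forall>\<^sub>F (x', y) in uniformity. x' = x \<longrightarrow> y \<in> S)"

instance
proof
  fix f g h :: "('a, 'b) HL0" and r s :: real and c d :: complex
  show "(norm f = 0) = (f = 0)"
  proof
    assume n: "norm f = 0"
    show "f = 0"
    proof (rule HL0_eqI)
      fix x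
      have "HL0_apply f x = 0"
      proof (cases "x \<in> ball 0 1")
        case True
        with lipschitz_onD[OF HL0_lipschitz, of x 0 f] n show ?thesis
          by (simp add: norm_HL0.rep_eq)
      qed (rule HL0_outside)
      then show "HL0_apply f x = HL0_apply 0 x"
        by (simp add: zero_HL0.rep_eq)
    qed
  next
    assume "f = 0"
    moreover have "norm (0 :: ('a, 'b) HL0) = 0"
      using lipschitz_const_scaleC[of 0 "\<lambda>x :: 'a. 0 :: 'b" 0]
      by (simp add: norm_HL0.rep_eq zero_HL0.rep_eq lipschitz_on_constant)
    ultimately show "norm f = 0" by simp
  qed
  show "norm (f + g) \<le> norm f + norm g"
    unfolding norm_HL0.rep_eq plus_HL0.rep_eq
    by (intro lipschitz_const_le lipschitz_on_add HL0_lipschitz)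
  show nC: "norm (c *\<^sub>C f) = cmod c * norm f" for c
    unfolding norm_HL0.rep_eq scaleC_HL0.rep_eq
    by (rule lipschitz_const_scaleC[OF HL0_lipschitz])
  show "norm (r *\<^sub>R f) = \<bar>r\<bar> * norm f"
    by (simp add: scaleR_HL0_def nC)
  show "f + g + h = f + (g + h)" "f + g = g + f" "0 + f = f"
    by (transfer; simp add: add.assoc add.commute fun_eq_iff)+
  show "- f + f = 0" "f - g = f + - g"
    unfolding uminus_HL0_def minus_HL0_def by (transfer; simp)+
  show "r *\<^sub>R (f + g) = r *\<^sub>R f + r *\<^sub>R g" "(r + s) *\<^sub>R f = r *\<^sub>R f + s *\<^sub>R f"
    "r *\<^sub>R s *\<^sub>R f = (r * s) *\<^sub>R f" "1 *\<^sub>R f = f"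
    unfolding scaleR_HL0_def
    by (transfer; simp add: scaleC_add_right scaleC_add_left scaleC_scaleC)+
  show "complex_of_real r *\<^sub>C f = r *\<^sub>R f"
    by (simp add: scaleR_HL0_def)
  show "c *\<^sub>C (f + g) = c *\<^sub>C f + c *\<^sub>C g" "(c + d) *\<^sub>C f = c *\<^sub>C f + d *\<^sub>C f"
    "c *\<^sub>C d *\<^sub>C f = (c * d) *\<^sub>C f"
    by (transfer; simp add: scaleC_add_right scaleC_add_left scaleC_scaleC)+
qed (simp_all add: dist_HL0_def sgn_HL0_def uniformity_HL0_def open_HL0_def)

end


section \<open>The predual \<open>G0\<close>\<close>

text \<open>The compact-open topology, generated by the sets of functions that are uniformly close to
  a given one on a given compact subset of the ball.\<close>

definition tau0 :: "('a::complex_normed_vector, complex) HL0 topology"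
  where "tau0 = topology_generated_by
    {{g. \<forall>x\<in>K. dist (HL0_apply g x) (HL0_apply f x) < e} | f K e.
       compact K \<and> K \<subseteq> ball 0 1 \<and> 0 < e}"

typedef (overloaded) 'a G0 =
  "{\<phi> :: ('a::complex_normed_vector, complex) HL0 dual.
      continuous_map (subtopology tau0 {f. norm f \<le> 1}) euclidean (cblinfun_apply \<phi>)}"
  morphisms G0_functional Abs_G0
  by (rule exI[of _ 0]) (simp add: zero_cblinfun.rep_eq)

setup_lifting type_definition_G0

lemma continuous_map_scaleC:
  fixes f :: "'a \<Rightarrow> 'b::complex_normed_vector"
  assumes "continuous_map X euclidean f"
  shows "continuous_map X euclidean (\<lambda>x. c *\<^sub>C f x)"
proof -
  have "continuous_map euclidean euclidean (\<lambda>y :: 'b. c *\<^sub>C y)"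
    by (simp add: bounded_linear.linear linear_continuous_on bounded_linear_scaleC)
  from continuous_map_compose[OF assms this] show ?thesis
    by (simp add: o_def)
qed

instantiation G0 :: (complex_normed_vector) complex_normed_vector
begin

lift_definition zero_G0 :: "'a G0" is 0
  by (simp add: zero_cblinfun.rep_eq)

lift_definition plus_G0 :: "'a G0 \<Rightarrow> 'a G0 \<Rightarrow> 'a G0" is "(+)"
  by (simp add: plus_cblinfun.rep_eq continuous_map_add)

lift_definition minus_G0 :: "'a G0 \<Rightarrow> 'a G0 \<Rightarrow> 'a G0" is "(-)"
  by (simp add: minus_cblinfun.rep_eq continuous_map_diff)

lift_definition uminus_G0 :: "'a G0 \<Rightarrow> 'a G0" is uminus
  by (simp add: uminus_cblinfun.rep_eq)

lift_definition scaleC_G0 :: "complex \<Rightarrow> 'a G0 \<Rightarrow> 'a G0" is scaleC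
  by (simp add: scaleC_cblinfun.rep_eq continuous_map_scaleC)

lift_definition scaleR_G0 :: "real \<Rightarrow> 'a G0 \<Rightarrow> 'a G0" is scaleR
  by (simp add: scaleR_cblinfun_def scaleC_cblinfun.rep_eq continuous_map_scaleC)

lift_definition norm_G0 :: "'a G0 \<Rightarrow> real" is norm .

definition dist_G0 :: "'a G0 \<Rightarrow> 'a G0 \<Rightarrow> real"
  where "dist_G0 f g = norm (f - g)"

definition sgn_G0 :: "'a G0 \<Rightarrow> 'a G0"
  where "sgn_G0 f = inverse (norm f) *\<^sub>R f"

definition uniformity_G0 :: "('a G0 \<times> 'a G0) filter"
  where "uniformity_G0 = (INF e\<in>{0<..}. principal {(x, y). dist x y < e})"

definition open_G0 :: "'a G0 set \<Rightarrow> bool"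
  where "open_G0 S = (\<forall>x\<in>S. \<forall>\<^sub>F (x', y) in uniformity. x' = x \<longrightarrow> y \<in> S)"

instance
proof
  fix f g h :: "'a G0" and r s :: real and c d :: complex
  show "(norm f = 0) = (f = 0)"
    by transfer simp
  show "norm (f + g) \<le> norm f + norm g"
    by transfer (rule norm_triangle_ineq)
  show "norm (c *\<^sub>C f) = cmod c * norm f" "norm (r *\<^sub>R f) = \<bar>r\<bar> * norm f"
    by (transfer; simp add: norm_scaleC)+
  show "f + g + h = f + (g + h)" "f + g = g + f" "0 + f = f" "- f + f = 0" "f - g = f + - g"
    by (transfer; simp add: add.assoc add.commute)+
  show "r *\<^sub>R (f + g) = r *\<^sub>R f + r *\<^sub>R g" "(r + s) *\<^sub>R f = r *\<^sub>R f + s *\<^sub>R f"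
    "r *\<^sub>R s *\<^sub>R f = (r * s) *\<^sub>R f" "1 *\<^sub>R f = f"
    by (transfer; simp add: scaleR_add_right scaleR_add_left)+
  show "complex_of_real r *\<^sub>C f = r *\<^sub>R f"
    by (transfer; simp add: scaleC_of_real)
  show "c *\<^sub>C (f + g) = c *\<^sub>C f + c *\<^sub>C g" "(c + d) *\<^sub>C f = c *\<^sub>C f + d *\<^sub>C f"
    "c *\<^sub>C d *\<^sub>C f = (c * d) *\<^sub>C f"
    by (transfer; simp add: scaleC_add_right scaleC_add_left scaleC_scaleC)+
qed (simp_all add: dist_G0_def sgn_G0_def uniformity_G0_def open_G0_def)

end

lemma scaleR_HL0_apply: "HL0_apply (r *\<^sub>R f) x = r *\<^sub>R HL0_apply f x"
  unfolding scaleR_HL0_def scaleC_HL0.rep_eq by (rule scaleC_of_real)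

lemma scaleR_cblinfun_apply: "cblinfun_apply (r *\<^sub>R f) x = r *\<^sub>R cblinfun_apply f x"
  unfolding scaleR_cblinfun_def scaleC_cblinfun.rep_eq by (rule scaleC_of_real)

lemma HL0_apply_bound: "norm (HL0_apply f x) \<le> norm f"
proof (cases "x \<in> ball 0 1")
  case True
  with lipschitz_onD[OF HL0_lipschitz, of x 0 f] have "norm (HL0_apply f x) \<le> norm f * norm x"
    by (simp add: norm_HL0.rep_eq)
  also have "\<dots> \<le> norm f * 1"
    using True by (intro mult_left_mono) auto
  finally show ?thesis by simp
qed (simp add: HL0_outside)

lift_definition HL0_eval :: "'a::complex_normed_vector \<Rightarrow> ('a, complex) HL0 dual"
  is "\<lambda>x f. HL0_apply f x"
proof (intro conjI allI)
  fix x :: 'a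
  show "bounded_linear (\<lambda>f. HL0_apply f x :: complex)"
    by (rule bounded_linear_intro[where K = 1])
      (simp_all add: plus_HL0.rep_eq scaleR_HL0_apply HL0_apply_bound)
qed (simp add: scaleC_HL0.rep_eq)

lemma HL0_eval_continuous: "continuous_map (subtopology tau0 S) euclidean (cblinfun_apply (HL0_eval x))"
proof (rule continuous_map_from_subtopology)
  have top: "openin tau0 {g. \<forall>x\<in>K. dist (HL0_apply g x) (HL0_apply f x) < e}"
    if "compact K" "K \<subseteq> ball 0 1" "0 < e" for f K and e :: real
    unfolding tau0_def using that by (intro topology_generated_by_Basis) blast
  show "continuous_map tau0 euclidean (cblinfun_apply (HL0_eval x))"
  proof (cases "x \<in> ball 0 1")
    case True
    show ?thesis
      unfolding continuous_map_def
    proof (intro conjI allI impI)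
      fix U :: "complex set" assume "openin euclidean U"
      then have U: "open U" by simp
      show "openin tau0 {f \<in> topspace tau0. cblinfun_apply (HL0_eval x) f \<in> U}"
      proof (subst openin_subopen, clarify)
        fix f assume "cblinfun_apply (HL0_eval x) f \<in> U"
        then obtain e where e: "e > 0" "ball (HL0_apply f x) e \<subseteq> U"
          using U by (auto simp: HL0_eval.rep_eq open_contains_ball)
        let ?T = "{g. \<forall>y\<in>{x}. dist (HL0_apply g y) (HL0_apply f y) < e}"
        have o: "openin tau0 ?T"
          using top[of "{x}" e f] True e by auto
        moreover have "f \<in> ?T" using e by simp
        moreover have "?T \<subseteq> {f \<in> topspace tau0. cblinfun_apply (HL0_eval x) f \<in> U}"
        proof
          fix g assume g: "g \<in> ?T"
          then have "HL0_apply g x \<in> ball (HL0_apply f x) e" by (simp add: dist_commute)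
          then show "g \<in> {f \<in> topspace tau0. cblinfun_apply (HL0_eval x) f \<in> U}"
            using e openin_subset[OF o] g by (auto simp: HL0_eval.rep_eq)
        qed
        ultimately show "\<exists>T. openin tau0 T \<and> f \<in> T \<and>
            T \<subseteq> {f \<in> topspace tau0. cblinfun_apply (HL0_eval x) f \<in> U}"
          by blast
      qed
    qed simp
  next
    case False
    then have "cblinfun_apply (HL0_eval x) = (\<lambda>f. 0)"
      by (auto simp: HL0_eval.rep_eq fun_eq_iff) (transfer, auto)
    then show ?thesis by simp
  qed
qed

lift_definition delta :: "'a::complex_normed_vector \<Rightarrow> 'a G0" is HL0_eval
  by (rule HL0_eval_continuous)

text \<open>The canonical map \<open>\<langle>f, \<phi>\<rangle> = \<phi>(f)\<close>, through which the dual of \<open>G0\<close> is identified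
  with \<open>HL0\<close>.\<close>

lift_definition HL0_pairing :: "('a::complex_normed_vector, complex) HL0 \<Rightarrow> 'a G0 dual"
  is "\<lambda>f \<phi>. cblinfun_apply (G0_functional \<phi>) f"
proof (intro conjI allI)
  fix f :: "('a, complex) HL0"
  show "bounded_linear (\<lambda>\<phi>. cblinfun_apply (G0_functional \<phi>) f)"
  proof (rule bounded_linear_intro[where K = "norm f"])
    fix \<phi> :: "'a G0"
    have "bounded_linear (cblinfun_apply (G0_functional \<phi>))"
      using cblinfun_apply by auto
    from onorm[OF this, of f] show "norm (cblinfun_apply (G0_functional \<phi>) f) \<le> norm \<phi> * norm f"
      by (simp add: norm_G0.rep_eq norm_cblinfun.rep_eq)
  qed (simp_all add: plus_G0.rep_eq plus_cblinfun.rep_eq scaleR_G0.rep_eq scaleR_cblinfun_apply)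
qed (simp add: scaleC_G0.rep_eq scaleC_cblinfun.rep_eq)

text \<open>The linearization \<open>T\<^sub>f\<close> of \<open>f\<close>.\<close>

definition linearization ::
  "('a::complex_normed_vector \<Rightarrow> 'b::complex_normed_vector) \<Rightarrow> ('a G0, 'b) cblinfun"
  where "linearization f = (THE T. \<forall>x\<in>ball 0 1. cblinfun_apply T (delta x) = f x)"


section \<open>The Aron--Berner extension\<close>

text \<open>An \<open>n\<close>-linear form is a function on lists of length \<open>n\<close>, extended by 0 to lists of other
  lengths.\<close>

definition symmetric_form :: "nat \<Rightarrow> ('a::complex_normed_vector list \<Rightarrow> complex) \<Rightarrow> bool"
  where "symmetric_form n A \<longleftrightarrow>
    (\<forall>us vs x y. length us + 1 + length vs = n \<longrightarrow>
       A (us @ (x + y) # vs) = A (us @ x # vs) + A (us @ y # vs)) \<and>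
    (\<forall>us vs c x. length us + 1 + length vs = n \<longrightarrow>
       A (us @ (c *\<^sub>C x) # vs) = c * A (us @ x # vs)) \<and>
    (\<exists>C. \<forall>xs. length xs = n \<longrightarrow> cmod (A xs) \<le> C * prod_list (map norm xs)) \<and>
    (\<forall>xs ys. length xs = n \<and> mset xs = mset ys \<longrightarrow> A xs = A ys) \<and>
    (\<forall>xs. length xs \<noteq> n \<longrightarrow> A xs = 0)"

text \<open>The trace on the space of the weak-star neighbourhoods of a point \<open>z\<close> of the bidual. A net
  in the space is weak-star convergent to \<open>z\<close> iff its eventuality filter is finer than this one.
  For a bounded multilinear form the limits below exist along this filter, and so agree with the
  iterated limits along any choice of weak-star convergent nets.\<close>

definition weak_star_trace :: "'a::complex_normed_vector bidual \<Rightarrow> 'a filter"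
  where "weak_star_trace z =
    (INF \<phi> :: 'a dual. filtercomap (cblinfun_apply \<phi>) (nhds (cblinfun_apply z \<phi>)))"

text \<open>The first argument gives the outermost limit.\<close>

fun AB_form :: "('a::complex_normed_vector list \<Rightarrow> complex) \<Rightarrow> 'a bidual list \<Rightarrow> complex"
  where
    "AB_form A [] = A []"
  | "AB_form A (z # zs) = Lim (weak_star_trace z) (\<lambda>x. AB_form (\<lambda>xs. A (x # xs)) zs)"

text \<open>The Taylor series at 0, as the sequence of symmetric \<open>k\<close>-linear forms \<open>A k\<close> such that the
  polynomials \<open>P k x = A k (x, \<dots>, x)\<close> sum up to the function uniformly near 0.\<close>

definition has_taylor_forms ::
  "('a::complex_normed_vector \<Rightarrow> complex) \<Rightarrow> (nat \<Rightarrow> 'a list \<Rightarrow> complex) \<Rightarrow> bool"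
  where "has_taylor_forms f A \<longleftrightarrow>
    (\<forall>k. symmetric_form k (A k)) \<and>
    (\<exists>r>0. uniform_limit (ball 0 r) (\<lambda>n x. \<Sum>k<n. A k (replicate k x)) f sequentially)"

definition taylor_form :: "('a::complex_normed_vector \<Rightarrow> complex) \<Rightarrow> nat \<Rightarrow> 'a list \<Rightarrow> complex"
  where "taylor_form f = (THE A. has_taylor_forms f A)"

definition AB_extension :: "('a::complex_normed_vector \<Rightarrow> complex) \<Rightarrow> 'a bidual \<Rightarrow> complex"
  where "AB_extension f z = (\<Sum>k. AB_form (taylor_form f k) (replicate k z))"


section \<open>The operator \<open>T\<^sub>\<Theta>\<close>\<close>

text \<open>\<open>\<Theta>(z)\<close> as an element of the bidual of \<open>G0\<close>: its value at the functional on \<open>G0\<close> given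
  by \<open>f\<close> is the Aron--Berner extension of \<open>f\<close> evaluated at \<open>z\<close>.\<close>

definition Theta :: "'a::complex_normed_vector bidual \<Rightarrow> 'a G0 bidual"
  where "Theta z = (THE \<Psi>. \<forall>f. cblinfun_apply \<Psi> (HL0_pairing f) = AB_extension (HL0_apply f) z)"

definition T_Theta :: "('a::complex_normed_vector bidual G0, 'a G0 bidual) cblinfun"
  where "T_Theta = linearization Theta"

end

theory Submission
  imports Defs "HOL-Library.Function_Algebras" "HOL-Complex_Analysis.Complex_Analysis"
begin

text \<open>
  The Aron--Berner extension defines an operator \<open>HL0_extension\<close> of norm at most 1 from
  \<open>HL0(B\<^sub>X)\<close> to \<open>HL0(B\<^sub>X\<^sub>*\<^sub>*)\<close>. As \<open>HL0(B\<^sub>X)\<close> is the dual of \<open>G0(B\<^sub>X)\<close>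
  (\<open>HL0_pairing_surj\<close>), the operator \<open>T\<^sub>\<Theta>\<close> is the restriction to the predual
  \<open>G0(B\<^sub>X\<^sub>*\<^sub>*)\<close> of the adjoint of this extension operator (\<open>T_Theta_eq\<close>); in particular it has
  norm at most 1. What has to be found are operators \<open>R\<close> of norm at most 1 in the opposite
  direction, from \<open>G0(B\<^sub>X)\<^sup>*\<^sup>*\<close> to \<open>G0(B\<^sub>X\<^sub>*\<^sub>*)\<close>, such that \<open>R T\<^sub>\<Theta>\<close> is close to the
  identity on any given finite set (\<open>ex_predual_map\<close>). They make \<open>T\<^sub>\<Theta>\<close> isometric. Moreover
  \<open>T\<^sub>\<Theta> R\<close> maps into the range of \<open>T\<^sub>\<Theta>\<close> with norm at most 1, and correcting it by its small error on
  the finite-dimensional intersection of \<open>G\<close> with this range, extended to \<open>G\<close> by a bounded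
  projection, gives the map required for local complementation.

  An operator \<open>R\<close> arises from an operator \<open>S = \<Sum>i. \<phi>\<^sub>i \<otimes> m\<^sub>i\<close> of finite rank from \<open>X\<close> to
  \<open>X\<^sup>*\<^sup>*\<close> with norm less than 1: it sends \<open>\<Psi>\<close> to the functional that takes \<open>g\<close> to
  \<open>\<Psi>(g \<circ> S)\<close>. Since \<open>S\<close> maps the ball into a compact subset of the ball of \<open>X\<^sup>*\<^sup>*\<close>, Cauchy's estimate
  shows that this functional is continuous for the compact-open topology, so it lies in the
  predual (\<open>HL0_compose_small\<close>, \<open>predual_map\<close>). The extension of \<open>g \<circ> S\<close> is \<open>g\<close> composed
  with the weak-star continuous extension of \<open>S\<close> (\<open>AB_extension_finite_rank\<close>). Hence \<open>R T\<^sub>\<Theta>\<close> moves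
  the evaluation at \<open>z\<close> by at most the distance from \<open>z\<close> to \<open>\<Sum>i. z(\<phi>\<^sub>i) m\<^sub>i\<close>, and since the
  evaluations span a dense subspace (\<open>delta_span_dense\<close>) it suffices to make this distance small for
  finitely many \<open>z\<close>.

  The metric approximation property of the bidual provides such operators of finite rank on
  \<open>X\<^sup>*\<^sup>*\<close>, but with functionals in \<open>X\<^sup>*\<^sup>*\<^sup>*\<close>. A form of the principle of local reflexivity
  (\<open>local_reflexivity\<close>) replaces these by elements of \<open>X\<^sup>*\<close>: elements of a bidual can be
  replaced by elements of the space with the same values on finitely many functionals and with
  almost the same norms of finitely many linear combinations. It is derived from Helly's theorem,
  and that from the Hahn--Banach theorem.

  The same principle gives the properties of the extension. In the manner of Davie and Gamelin, a
  sequence in \<open>X\<close> is chosen along which the iterated limits that define the extensions of the Taylor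
  polynomials of \<open>f\<close> are attained exactly, and its averages are used to approximate
  (\<open>AB_form_approximation\<close>). Doing this for two points \<open>z\<close> and \<open>w\<close> at once, with control of the norm
  of the differences, carries the Lipschitz estimate over from \<open>f\<close> to its extension with the
  same constant.
\<close>

section \<open>The Hahn--Banach theorem\<close>

definition sublinear :: "(real \<Rightarrow> 'b \<Rightarrow> 'b) \<Rightarrow> ('b::ab_group_add \<Rightarrow> real) \<Rightarrow> bool"
  where "sublinear s q \<longleftrightarrow>
    (\<forall>x y. q (x + y) \<le> q x + q y) \<and> (\<forall>c\<ge>0. \<forall>x. q (s c x) = c * q x)"

lemma sublinearI:
  fixes s :: "real \<Rightarrow> 'b \<Rightarrow> 'b::ab_group_add"
  assumes "vector_space s"
    and add: "\<And>x y. q (x + y) \<le> q x + q y"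
    and scale: "\<And>c x. c > 0 \<Longrightarrow> c * q x \<le> q (s c x)"
    and zero: "q 0 = 0"
  shows "sublinear s q"
proof -
  interpret vector_space s by fact
  have "q (s c x) = c * q x" if "c \<ge> 0" for c x
  proof (cases "c = 0")
    case False
    with that have c: "c > 0" by simp
    have "inverse c * q (s c x) \<le> q (s (inverse c) (s c x))"
      using c by (intro scale) simp
    also have "s (inverse c) (s c x) = x"
      using c by simp
    finally have "q (s c x) \<le> c * q x"
      using c by (simp add: field_simps)
    with scale[OF c] show ?thesis
      by (simp add: antisym)
  qed (simp add: zero)
  with add show ?thesis
    by (auto simp: sublinear_def)
qed

text \<open>For fixed \<open>y\<close> the functional \<open>x \<mapsto> inf (q (x + t y) - t q y)\<close>, with the infimum over
  \<open>t \<ge> 0\<close>, is sublinear and below \<open>q\<close>. By minimality it equals \<open>q\<close>, and \<open>t = 1\<close> gives the missing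
  inequality.\<close>

lemma minimal_sublinear_additive:
  fixes s :: "real \<Rightarrow> 'b \<Rightarrow> 'b::ab_group_add"
  assumes vs: "vector_space s" and q: "sublinear s q"
    and minimal: "\<And>q'. sublinear s q' \<Longrightarrow> (\<And>x. q' x \<le> q x) \<Longrightarrow> q' = q"
  shows "q (x + y) = q x + q y"
proof -
  interpret vector_space s by (rule vs)
  have add: "q (x + y) \<le> q x + q y" and scale: "c \<ge> 0 \<Longrightarrow> q (s c x) = c * q x" for c x y
    using q by (auto simp: sublinear_def)
  have q0: "q 0 = 0"
    using scale[of 0 0] by simp
  define q' where "q' x = (INF t\<in>{0..}. q (x + s t y) - t * q y)" for x
  have lower: "- q (- x) \<le> q (x + s t y) - t * q y" if "t \<ge> 0" for t x
    using add[of "x + s t y" "- x"] scale[OF that, of y] by simp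
  have bdd: "bdd_below ((\<lambda>t. q (x + s t y) - t * q y) ` {0..})" for x
    using lower by (intro bdd_belowI2) auto
  have le: "q' x \<le> q (x + s t y) - t * q y" if "t \<ge> 0" for x t
    unfolding q'_def using that by (intro cINF_lower bdd) auto
  have ge: "a \<le> q' x" if "\<And>t. t \<ge> 0 \<Longrightarrow> a \<le> q (x + s t y) - t * q y" for a x
    unfolding q'_def using that by (intro cINF_greatest) auto
  have "sublinear s q'"
  proof (rule sublinearI[OF vs])
    fix x x'
    have "q' (x + x') \<le> (q (x + s t y) - t * q y) + (q (x' + s t' y) - t' * q y)"
      if "t \<ge> 0" "t' \<ge> 0" for t t'
    proof -
      have "q' (x + x') \<le> q (x + x' + s (t + t') y) - (t + t') * q y"
        using that by (intro le) simp
      also have "x + x' + s (t + t') y = (x + s t y) + (x' + s t' y)"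
        by (simp add: scale_left_distrib)
      finally show ?thesis
        using add[of "x + s t y" "x' + s t' y"] by (simp add: algebra_simps)
    qed
    then have "q' (x + x') - (q (x' + s t' y) - t' * q y) \<le> q' x" if "t' \<ge> 0" for t'
      using that by (intro ge) (simp add: algebra_simps)
    then have "q' (x + x') - q' x \<le> q' x'"
      by (intro ge) (simp add: algebra_simps)
    then show "q' (x + x') \<le> q' x + q' x'" by simp
  next
    fix c :: real and x assume c: "c > 0"
    show "c * q' x \<le> q' (s c x)"
    proof (rule ge)
      fix t :: real assume t: "t \<ge> 0"
      have "q (s c x + s t y) = c * q (x + s (t / c) y)"
        using c scale[of c "x + s (t / c) y"] by (simp add: scale_right_distrib)
      moreover have "q' x \<le> q (x + s (t / c) y) - (t / c) * q y"
        using c t by (intro le) simp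
      ultimately show "c * q' x \<le> q (s c x + s t y) - t * q y"
        using c by (simp add: field_simps)
    qed
  next
    show "q' 0 = 0"
      using le[of 0 0] scale by (intro antisym ge) (auto simp: q0)
  qed
  moreover have "q' x \<le> q x" for x
    using le[of 0 x] by simp
  ultimately have "q' = q"
    by (rule minimal)
  then have "q x \<le> q (x + y) - q y"
    using le[of 1 x] by simp
  with add[of x y] show ?thesis by simp
qed

text \<open>Zorn's lemma applies because the pointwise infimum of a chain of sublinear functionals below
  \<open>p\<close> is finite, by \<open>- p (- x) \<le> q x\<close>, and again sublinear.\<close>

lemma ex_minimal_sublinear:
  fixes s :: "real \<Rightarrow> 'b \<Rightarrow> 'b::ab_group_add"
  assumes vs: "vector_space s" and p: "sublinear s p"
  obtains q where "sublinear s q" "\<And>x. q x \<le> p x"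
    "\<And>q'. sublinear s q' \<Longrightarrow> (\<And>x. q' x \<le> q x) \<Longrightarrow> q' = q"
proof -
  interpret vector_space s by (rule vs)
  define A where "A = {q. sublinear s q \<and> (\<forall>x. q x \<le> p x)}"
  define P where "P q q' \<longleftrightarrow> (\<forall>x. q' x \<le> q x)" for q q' :: "'b \<Rightarrow> real"
  have "\<exists>m\<in>A. \<forall>a\<in>A. P m a \<longrightarrow> a = m"
  proof (rule predicate_Zorn)
    show "partial_order_on A (relation_of P A)"
      by (rule partial_order_on_relation_ofI)
        (auto simp: P_def fun_eq_iff intro: order_trans antisym)
  next
    fix C assume "C \<in> Chains (relation_of P A)"
    then have CA: "C \<subseteq> A" and chain: "\<And>q q'. q \<in> C \<Longrightarrow> q' \<in> C \<Longrightarrow> P q q' \<or> P q' q"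
      by (auto simp: Chains_def relation_of_def)
    show "\<exists>u\<in>A. \<forall>a\<in>C. P a u"
    proof (cases "C = {}")
      case True
      then show ?thesis using p by (auto simp: A_def)
    next
      case False
      define u where "u x = (INF q\<in>C. q x)" for x
      have sub: "q (x + y) \<le> q x + q y" and scale: "c \<ge> 0 \<Longrightarrow> q (s c x) = c * q x"
        and le_p: "q x \<le> p x" if "q \<in> C" for q c x y
        using that CA by (auto simp: A_def sublinear_def)
      have zero: "q 0 = 0" if "q \<in> C" for q
        using scale[OF that, of 0 0] by simp
      have "- p (- x) \<le> q x" if "q \<in> C" for q x
        using sub[OF that, of x "- x"] zero[OF that] le_p[OF that, of "- x"] by simp
      then have bdd: "bdd_below ((\<lambda>q. q x) ` C)" for x
        by (intro bdd_belowI2) auto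
      have le: "u x \<le> q x" if "q \<in> C" for q x
        unfolding u_def using that by (intro cINF_lower bdd)
      have ge: "a \<le> u x" if "\<And>q. q \<in> C \<Longrightarrow> a \<le> q x" for a x
        unfolding u_def using that False by (intro cINF_greatest) auto
      have "sublinear s u"
      proof (rule sublinearI[OF vs])
        fix x y
        have *: "u (x + y) \<le> q x + q' y" if qq': "q \<in> C" "q' \<in> C" for q q'
          using chain[OF qq']
        proof
          assume "P q q'"
          then have "q' x \<le> q x" by (auto simp: P_def)
          then show ?thesis
            using le[OF qq'(2), of "x + y"] sub[OF qq'(2), of x y] by simp
        next
          assume "P q' q"
          then have "q y \<le> q' y" by (auto simp: P_def)
          then show ?thesis
            using le[OF qq'(1), of "x + y"] sub[OF qq'(1), of x y] by simp
        qed
        have "u (x + y) - q' y \<le> u x" if "q' \<in> C" for q'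
          using *[OF _ that] by (intro ge) (simp add: algebra_simps)
        then have "u (x + y) - u x \<le> u y"
          by (intro ge) (simp add: algebra_simps)
        then show "u (x + y) \<le> u x + u y" by simp
      next
        fix c :: real and x assume "c > 0"
        then show "c * u x \<le> u (s c x)"
          using mult_left_mono[OF le, of _ c x] scale by (intro ge) simp
      next
        show "u 0 = 0"
          using False zero le[of _ 0] ge[of 0 0] by (metis all_not_in_conv antisym order_refl)
      qed
      moreover have "u x \<le> p x" for x
        using False le le_p order_trans by blast
      ultimately show ?thesis
        using le by (intro bexI[of _ u]) (auto simp: A_def P_def)
    qed
  qed
  then obtain q where "q \<in> A" and min: "\<And>a. a \<in> A \<Longrightarrow> P q a \<Longrightarrow> a = q" by blast
  show thesis
  proof (rule that)
    fix q' assume q': "sublinear s q'" "\<And>x. q' x \<le> q x"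
    then have "q' \<in> A"
      using \<open>q \<in> A\<close> by (auto simp: A_def intro: order_trans)
    with q' show "q' = q" by (intro min) (auto simp: P_def)
  qed (use \<open>q \<in> A\<close> in \<open>auto simp: A_def\<close>)
qed

text \<open>The largest sublinear functional that is below \<open>p\<close> everywhere and below \<open>g\<close> on \<open>S\<close> is an
  infimal convolution. A minimal sublinear functional below it is linear, and on \<open>S\<close> it is at most
  \<open>g\<close>, hence equal to \<open>g\<close> because \<open>S\<close> is symmetric.\<close>

theorem hahn_banach_real:
  fixes s :: "real \<Rightarrow> 'b \<Rightarrow> 'b::ab_group_add"
  assumes vs: "vector_space s" and p: "sublinear s p"
    and S: "0 \<in> S" "\<And>x y. x \<in> S \<Longrightarrow> y \<in> S \<Longrightarrow> x + y \<in> S" "\<And>c x. x \<in> S \<Longrightarrow> s c x \<in> S"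
    and g_add: "\<And>x y. x \<in> S \<Longrightarrow> y \<in> S \<Longrightarrow> g (x + y) = g x + g y"
    and g_scale: "\<And>c x. x \<in> S \<Longrightarrow> g (s c x) = c * g x"
    and g_le: "\<And>x. x \<in> S \<Longrightarrow> g x \<le> p x"
  obtains u where "\<And>x y. u (x + y) = u x + u y" "\<And>c x. u (s c x) = c * u x"
    "\<And>x. u x \<le> p x" "\<And>x. x \<in> S \<Longrightarrow> u x = g x"
proof -
  interpret vector_space s by (rule vs)
  have p_add: "p (x + y) \<le> p x + p y" and p_scale: "c \<ge> 0 \<Longrightarrow> p (s c x) = c * p x" for c x y
    using p by (auto simp: sublinear_def)
  have S_minus: "- y \<in> S" and g_minus: "g (- y) = - g y" if "y \<in> S" for y
    using S(3)[OF that, of "- 1"] g_scale[OF that, of "- 1"] by simp_all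
  have g0: "g 0 = 0"
    using g_scale[OF S(1), of 0] by simp
  define p0 where "p0 x = (INF y\<in>S. p (x - y) + g y)" for x
  have "- p (- x) \<le> p (x - y) + g y" if "y \<in> S" for x y
    using p_add[of "x - y" "- x"] g_le[OF S_minus[OF that]] g_minus[OF that] by simp
  then have bdd: "bdd_below ((\<lambda>y. p (x - y) + g y) ` S)" for x
    by (intro bdd_belowI2) auto
  have le: "p0 x \<le> p (x - y) + g y" if "y \<in> S" for x y
    unfolding p0_def using that by (intro cINF_lower bdd)
  have ge: "a \<le> p0 x" if "\<And>y. y \<in> S \<Longrightarrow> a \<le> p (x - y) + g y" for a x
    unfolding p0_def using that S(1) by (intro cINF_greatest) auto
  have "sublinear s p0"
  proof (rule sublinearI[OF vs])
    fix x x'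
    have *: "p0 (x + x') \<le> (p (x - y) + g y) + (p (x' - y') + g y')" if "y \<in> S" "y' \<in> S" for y y'
      using le[OF S(2)[OF that], of "x + x'"] p_add[of "x - y" "x' - y'"] g_add[OF that]
      by (simp add: algebra_simps)
    have "p0 (x + x') - (p (x' - y') + g y') \<le> p0 x" if "y' \<in> S" for y'
      using *[OF _ that] by (intro ge) (simp add: algebra_simps)
    then have "p0 (x + x') - p0 x \<le> p0 x'"
      by (intro ge) (simp add: algebra_simps)
    then show "p0 (x + x') \<le> p0 x + p0 x'" by simp
  next
    fix c :: real and x assume c: "c > 0"
    show "c * p0 x \<le> p0 (s c x)"
    proof (rule ge)
      fix y assume y: "y \<in> S"
      have "s c x - y = s c (x - s (inverse c) y)"
        using c by (simp add: scale_right_diff_distrib)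
      then have "p (s c x - y) = c * p (x - s (inverse c) y)"
        using p_scale c by simp
      moreover have "p0 x \<le> p (x - s (inverse c) y) + g (s (inverse c) y)"
        using y by (intro le S)
      then have "c * p0 x \<le> c * (p (x - s (inverse c) y) + inverse c * g y)"
        using c g_scale[OF y] by (intro mult_left_mono) auto
      moreover have "c * (p (x - s (inverse c) y) + inverse c * g y) = c * p (x - s (inverse c) y) + g y"
        using c by (simp add: distrib_left)
      ultimately show "c * p0 x \<le> p (s c x - y) + g y"
        by simp
    qed
  next
    have "p0 0 \<le> 0"
      using le[OF S(1), of 0] p_scale[of 0 0] g0 by simp
    moreover have "0 \<le> p0 0"
      using g_le[OF S_minus] g_minus by (intro ge) fastforce
    ultimately show "p0 0 = 0" by simp
  qed
  from ex_minimal_sublinear[OF vs this] obtain u where u: "sublinear s u" "\<And>x. u x \<le> p0 x"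
    and min: "\<And>q'. sublinear s q' \<Longrightarrow> (\<And>x. q' x \<le> u x) \<Longrightarrow> q' = u" by blast
  have u_add: "u (x + y) = u x + u y" for x y
    by (rule minimal_sublinear_additive[OF vs u(1) min])
  have u_pos: "u (s c x) = c * u x" if "c \<ge> 0" for c x
    using u(1) that by (auto simp: sublinear_def)
  have u0: "u 0 = 0"
    using u_pos[of 0 0] by simp
  have u_minus: "u (- x) = - u x" for x
    using u_add[of x "- x"] u0 by simp
  have u_scale: "u (s c x) = c * u x" for c x
  proof (cases "c \<ge> 0")
    case False
    then have "u (s (- c) x) = (- c) * u x"
      by (intro u_pos) simp
    then show ?thesis
      by (simp add: u_minus)
  qed (rule u_pos)
  have u_le_g: "u x \<le> g x" if "x \<in> S" for x
    using u(2)[of x] le[OF that, of x] p_scale[of 0 0] by simp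
  show thesis
  proof (rule that[OF u_add u_scale])
    show "u x \<le> p x" for x
      using u(2)[of x] le[OF S(1), of x] g0 by simp
    show "u x = g x" if "x \<in> S" for x
      using u_le_g[OF that] u_le_g[OF S_minus[OF that]] g_minus[OF that] u_minus by simp
  qed
qed

definition seminorm :: "(complex \<Rightarrow> 'b \<Rightarrow> 'b) \<Rightarrow> ('b::ab_group_add \<Rightarrow> real) \<Rightarrow> bool"
  where "seminorm s p \<longleftrightarrow>
    (\<forall>x y. p (x + y) \<le> p x + p y) \<and> (\<forall>c x. p (s c x) = cmod c * p x)"

definition clinear_on :: "(complex \<Rightarrow> 'b \<Rightarrow> 'b) \<Rightarrow> 'b::ab_group_add set \<Rightarrow> ('b \<Rightarrow> complex) \<Rightarrow> bool"
  where "clinear_on s S g \<longleftrightarrow>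
    (\<forall>x\<in>S. \<forall>y\<in>S. g (x + y) = g x + g y) \<and> (\<forall>c. \<forall>x\<in>S. g (s c x) = c * g x)"

text \<open>A complex functional is determined by its real part \<open>u\<close> as \<open>u x - \<i> u (\<i> x)\<close>; the bound for
  its modulus follows from the one for \<open>u\<close> by rotating the argument.\<close>

theorem hahn_banach:
  fixes s :: "complex \<Rightarrow> 'b \<Rightarrow> 'b::ab_group_add"
  assumes vs: "vector_space s" and p: "seminorm s p" and S: "module.subspace s S"
    and g: "clinear_on s S g" and g_le: "\<And>x. x \<in> S \<Longrightarrow> cmod (g x) \<le> p x"
  obtains h where "clinear_on s UNIV h" "\<And>x. cmod (h x) \<le> p x" "\<And>x. x \<in> S \<Longrightarrow> h x = g x"
proof -
  interpret vector_space s by (rule vs)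
  define r where "r a = s (complex_of_real a)" for a
  have r: "vector_space r"
    by unfold_locales (simp_all add: r_def algebra_simps)
  have sub: "sublinear r p"
    using p by (auto simp: sublinear_def seminorm_def r_def)
  have g_add: "\<And>x y. x \<in> S \<Longrightarrow> y \<in> S \<Longrightarrow> g (x + y) = g x + g y"
    and g_scale: "\<And>c x. x \<in> S \<Longrightarrow> g (s c x) = c * g x"
    using g by (auto simp: clinear_on_def)
  obtain u where u_add: "\<And>x y. u (x + y) = u x + u y" and u_r: "\<And>c x. u (r c x) = c * u x"
    and u_le: "\<And>x. u x \<le> p x" and u_g: "\<And>x. x \<in> S \<Longrightarrow> u x = Re (g x)"
  proof (rule hahn_banach_real[OF r sub, of S "\<lambda>x. Re (g x)"])
    show "Re (g x) \<le> p x" if "x \<in> S" for x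
      using complex_Re_le_cmod[of "g x"] g_le[OF that] by linarith
  qed (use S in \<open>auto simp: g_add g_scale r_def subspace_0 subspace_add subspace_scale\<close>)
  have u_i: "u (s (\<i> * of_real a) x) = a * u (s \<i> x)" for a x
    using u_r[of a "s \<i> x"] by (simp add: r_def mult.commute)
  have u_scale: "u (s c x) = Re c * u x + Im c * u (s \<i> x)" for c x
  proof -
    have "s c x = r (Re c) x + s (\<i> * of_real (Im c)) x"
      using complex_eq[of c] by (metis r_def scale_left_distrib)
    then show ?thesis
      by (simp add: u_add u_r u_i)
  qed
  define h where "h x = Complex (u x) (- u (s \<i> x))" for x
  have h_add: "h (x + y) = h x + h y" for x y
    by (simp add: h_def u_add scale_right_distrib complex_eq_iff)
  have h_scale: "h (s c x) = c * h x" for c x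
    using u_scale[of c x] u_scale[of "\<i> * c" x]
    by (simp add: h_def complex_eq_iff)
  have "cmod (h x) \<le> p x" for x
  proof (cases "h x = 0")
    case True
    have "0 \<le> p x"
      using u_le[of x] u_le[of "- x"] u_r[of "- 1" x] p
      unfolding seminorm_def r_def
      by (metis add.inverse_inverse True h_def complex_eq_iff complex.sel(1) zero_complex.sel(1))
    with True show ?thesis by simp
  next
    case False
    define c where "c = cnj (h x) / cmod (h x)"
    have c: "cmod c = 1"
      using False by (simp add: c_def norm_divide)
    have "c * h x = cmod (h x)"
      using False by (simp add: c_def complex_norm_square[symmetric] power2_eq_square mult.commute)
    then have "cmod (h x) = Re (h (s c x))"
      by (simp add: h_scale)
    also have "\<dots> = u (s c x)"
      by (simp add: h_def)
    also have "\<dots> \<le> p (s c x)"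
      by (rule u_le)
    also have "\<dots> = p x"
      using p c by (simp add: seminorm_def)
    finally show ?thesis .
  qed
  moreover have "h x = g x" if "x \<in> S" for x
    using that S by (simp add: h_def complex_eq_iff u_g g_scale subspace_scale)
  ultimately show thesis
    using h_add h_scale by (intro that[of h]) (auto simp: clinear_on_def)
qed


section \<open>Helly's theorem\<close>

lemma clinear_on_scale: "clinear_on s UNIV g \<Longrightarrow> g (s c x) = c * g x"
  by (simp add: clinear_on_def)

text \<open>In the induction step, either \<open>\<psi> j\<close> is superfluous, or there is a vector \<open>n\<close> on which it is
  the only one not to vanish; then subtracting the right multiple of \<open>\<psi> j\<close> from \<open>g\<close> reduces the
  claim to the remaining functionals.\<close>

lemma functional_combination:
  fixes s :: "complex \<Rightarrow> 'b \<Rightarrow> 'b::ab_group_add"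
  assumes vs: "vector_space s" and "finite J"
    and \<psi>: "\<And>j. j \<in> J \<Longrightarrow> clinear_on s UNIV (\<psi> j)"
    and "clinear_on s UNIV g" and "\<And>v. (\<And>j. j \<in> J \<Longrightarrow> \<psi> j v = 0) \<Longrightarrow> g v = 0"
  shows "\<exists>a. \<forall>v. g v = (\<Sum>j\<in>J. a j * \<psi> j v)"
  using assms(2-)
proof (induction J arbitrary: g)
  case empty
  then show ?case by simp
next
  case (insert j J)
  note g = insert.prems(2)
  have \<psi>j: "clinear_on s UNIV (\<psi> j)" using insert.prems(1) by simp
  show ?case
  proof (cases "\<exists>n. (\<forall>i\<in>J. \<psi> i n = 0) \<and> \<psi> j n \<noteq> 0")
    case True
    then obtain n where n: "\<And>i. i \<in> J \<Longrightarrow> \<psi> i n = 0" "\<psi> j n \<noteq> 0" by blast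
    define t where "t = g n / \<psi> j n"
    have "\<exists>a. \<forall>v. g v - t * \<psi> j v = (\<Sum>i\<in>J. a i * \<psi> i v)"
    proof (rule insert.IH)
      show "clinear_on s UNIV (\<lambda>v. g v - t * \<psi> j v)"
        using g \<psi>j by (auto simp: clinear_on_def algebra_simps)
      fix v assume v: "\<And>i. i \<in> J \<Longrightarrow> \<psi> i v = 0"
      define r where "r = - \<psi> j v / \<psi> j n"
      have "g (v + s r n) = 0"
      proof (rule insert.prems(3))
        fix i assume i: "i \<in> insert j J"
        then have "\<psi> i (v + s r n) = \<psi> i v + r * \<psi> i n"
          using insert.prems(1)[OF i] by (simp add: clinear_on_def)
        with i n v show "\<psi> i (v + s r n) = 0"
          by (cases "i = j") (auto simp: r_def)
      qed
      then show "g v - t * \<psi> j v = 0"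
        using g n by (simp add: clinear_on_def r_def t_def)
    qed (use insert.prems(1) in simp)
    then obtain a where a: "\<And>v. g v - t * \<psi> j v = (\<Sum>i\<in>J. a i * \<psi> i v)" by blast
    have "g v = (\<Sum>i\<in>insert j J. (a(j := t)) i * \<psi> i v)" for v
    proof -
      have "(\<Sum>i\<in>J. (a(j := t)) i * \<psi> i v) = (\<Sum>i\<in>J. a i * \<psi> i v)"
        using insert.hyps by (intro sum.cong) auto
      then show ?thesis
        using a[of v] insert.hyps by (simp add: algebra_simps)
    qed
    then show ?thesis by blast
  next
    case False
    then have "\<exists>a. \<forall>v. g v = (\<Sum>i\<in>J. a i * \<psi> i v)"
      using insert.prems by (intro insert.IH) auto
    then obtain a where a: "\<And>v. g v = (\<Sum>i\<in>J. a i * \<psi> i v)" by blast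
    have "g v = (\<Sum>i\<in>insert j J. (a(j := 0)) i * \<psi> i v)" for v
    proof -
      have "(\<Sum>i\<in>J. (a(j := 0)) i * \<psi> i v) = (\<Sum>i\<in>J. a i * \<psi> i v)"
        using insert.hyps by (intro sum.cong) auto
      then show ?thesis
        using a[of v] insert.hyps by simp
    qed
    then show ?thesis by blast
  qed
qed

text \<open>The condition says that the right-hand sides satisfy every linear relation between the
  functionals.\<close>

lemma functional_system_solvable:
  fixes s :: "complex \<Rightarrow> 'b \<Rightarrow> 'b::ab_group_add"
  assumes vs: "vector_space s" and "finite J"
    and \<psi>: "\<And>j. j \<in> J \<Longrightarrow> clinear_on s UNIV (\<psi> j)"
    and "\<And>a. (\<And>v. (\<Sum>j\<in>J. a j * \<psi> j v) = 0) \<Longrightarrow> (\<Sum>j\<in>J. a j * c j) = 0"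
  shows "\<exists>v. \<forall>j\<in>J. \<psi> j v = c j"
  using assms(2-)
proof (induction J)
  case empty
  then show ?case by simp
next
  case (insert j J)
  have *: "(\<Sum>i\<in>insert j J. (a(j := t)) i * f i) = t * f j + (\<Sum>i\<in>J. a i * f i)"
    for a t and f :: "_ \<Rightarrow> complex"
  proof -
    have "(\<Sum>i\<in>J. (a(j := t)) i * f i) = (\<Sum>i\<in>J. a i * f i)"
      using insert.hyps by (intro sum.cong) auto
    then show ?thesis using insert.hyps by simp
  qed
  have "\<exists>v. \<forall>i\<in>J. \<psi> i v = c i"
  proof (rule insert.IH)
    fix a assume "\<And>v. (\<Sum>i\<in>J. a i * \<psi> i v) = 0"
    then show "(\<Sum>i\<in>J. a i * c i) = 0"
      using insert.prems(2)[of "a(j := 0)"] unfolding * by simp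
  qed (use insert.prems in auto)
  then obtain v where v: "\<And>i. i \<in> J \<Longrightarrow> \<psi> i v = c i" by blast
  show ?case
  proof (cases "\<exists>n. (\<forall>i\<in>J. \<psi> i n = 0) \<and> \<psi> j n \<noteq> 0")
    case True
    then obtain n where n: "\<And>i. i \<in> J \<Longrightarrow> \<psi> i n = 0" "\<psi> j n \<noteq> 0" by blast
    have "\<psi> i (v + s ((c j - \<psi> j v) / \<psi> j n) n) = c i" if i: "i \<in> insert j J" for i
      using insert.prems(1)[OF i] i n v
      by (cases "i = j") (auto simp: clinear_on_def)
    then show ?thesis by blast
  next
    case False
    then have "\<exists>a. \<forall>v. \<psi> j v = (\<Sum>i\<in>J. a i * \<psi> i v)"
      using insert.prems insert.hyps by (intro functional_combination[OF vs]) auto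
    then obtain a where a: "\<And>v. \<psi> j v = (\<Sum>i\<in>J. a i * \<psi> i v)" by blast
    have "(\<Sum>i\<in>insert j J. (a(j := - 1)) i * c i) = 0"
    proof (rule insert.prems(2))
      show "(\<Sum>i\<in>insert j J. (a(j := - 1)) i * \<psi> i v) = 0" for v
        unfolding * using a[of v] by simp
    qed
    then have "c j = (\<Sum>i\<in>J. a i * \<psi> i v)"
      unfolding * using v by simp
    then have "\<psi> j v = c j"
      using a by simp
    with v show ?thesis by auto
  qed
qed

lemma seminorm_nonneg:
  fixes s :: "complex \<Rightarrow> 'b \<Rightarrow> 'b::ab_group_add"
  assumes "vector_space s" "seminorm s p"
  shows "0 \<le> p x"
proof -
  interpret vector_space s by fact
  have scale: "p (s c y) = cmod c * p y" and add: "p (y + z) \<le> p y + p z" for c y z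
    using assms(2) by (auto simp: seminorm_def)
  have "p (x + s (- 1) x) \<le> p x + p x"
    using add[of x "s (- 1) x"] scale[of "- 1" x] by simp
  moreover have "p (x + s (- 1) x) = 0"
    using scale[of 0 x] by simp
  ultimately show ?thesis by simp
qed

text \<open>If every solution had seminorm at least 1, then the functional that is 1 at one solution \<open>v0\<close>
  and 0 on the common kernel \<open>N\<close> would be bounded by \<open>p\<close>. Its Hahn--Banach extension is a
  combination of the \<open>\<psi> j\<close>, and evaluating it at \<open>v0\<close> contradicts the hypothesis.\<close>

theorem helly:
  fixes s :: "complex \<Rightarrow> 'b \<Rightarrow> 'b::ab_group_add"
  assumes vs: "vector_space s" and p: "seminorm s p" and J: "finite J"
    and \<psi>: "\<And>j. j \<in> J \<Longrightarrow> clinear_on s UNIV (\<psi> j)" and K: "K < 1"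
    and bound: "\<And>a. (\<And>v. cmod (\<Sum>j\<in>J. a j * \<psi> j v) \<le> p v) \<Longrightarrow> cmod (\<Sum>j\<in>J. a j * c j) \<le> K"
  obtains v where "\<And>j. j \<in> J \<Longrightarrow> \<psi> j v = c j" "p v < 1"
proof -
  interpret vector_space s by (rule vs)
  have p_add: "p (x + y) \<le> p x + p y" and p_scale: "p (s a x) = cmod a * p x" for a x y
    using p by (auto simp: seminorm_def)
  have "\<exists>v. \<forall>j\<in>J. \<psi> j v = c j"
  proof (rule functional_system_solvable[OF vs J \<psi>])
    fix a assume a: "\<And>v. (\<Sum>j\<in>J. a j * \<psi> j v) = 0"
    let ?x = "\<Sum>j\<in>J. a j * c j"
    have *: "cmod t * cmod ?x \<le> K" for t
      using bound[of "\<lambda>j. t * a j"] a seminorm_nonneg[OF vs p]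
      by (simp add: mult.assoc flip: sum_distrib_left norm_mult)
    show "?x = 0"
    proof (rule ccontr)
      assume "?x \<noteq> 0"
      then show False
        using *[of "inverse ?x"] K by (simp flip: norm_mult)
    qed
  qed
  then obtain v0 where v0: "\<And>j. j \<in> J \<Longrightarrow> \<psi> j v0 = c j" by blast
  define N where "N = {n. \<forall>j\<in>J. \<psi> j n = 0}"
  have N: "subspace N"
    using \<psi> scale_zero_left clinear_on_scale[of s _ 0]
    unfolding subspace_def N_def by (auto simp: clinear_on_def)
  show thesis
  proof (cases "\<exists>n\<in>N. p (v0 + n) < 1")
    case True
    then show thesis
      using \<psi> v0 by (auto simp: N_def clinear_on_def intro!: that)
  next
    case False
    have ge: "cmod t \<le> p (s t v0 + n)" if "n \<in> N" for t n
    proof (cases "t = 0")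
      case False
      have "1 \<le> p (v0 + s (inverse t) n)"
        using \<open>\<not> (\<exists>n\<in>N. p (v0 + n) < 1)\<close> that N by (meson not_le subspace_scale)
      then have "cmod t \<le> cmod t * p (v0 + s (inverse t) n)"
        by (simp add: mult_le_cancel_left1)
      also have "\<dots> = p (s t v0 + n)"
        using False by (simp add: scale_right_distrib flip: p_scale)
      finally show ?thesis .
    qed (use seminorm_nonneg[OF vs p] in simp)
    have v0N: "v0 \<notin> N"
      using ge[of "s (- 1) v0" 1] N p_scale[of 0 0] subspace_scale[OF N, of v0 "- 1"] by auto
    define g where "g x = (THE t. x - s t v0 \<in> N)" for x
    have g_eq: "g x = t" if "x - s t v0 \<in> N" for x t
      unfolding g_def
    proof (rule the_equality)
      fix t' assume t': "x - s t' v0 \<in> N"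
      have "(x - s t' v0) - (x - s t v0) = s (t - t') v0"
        by (simp add: scale_left_diff_distrib)
      then have d: "s (t - t') v0 \<in> N"
        using subspace_diff[OF N t' that] by simp
      show "t' = t"
      proof (rule ccontr)
        assume "t' \<noteq> t"
        then have "s (inverse (t - t')) (s (t - t') v0) = v0" by simp
        then show False
          using subspace_scale[OF N d, of "inverse (t - t')"] v0N by simp
      qed
    qed (rule that)
    define S where "S = {x. \<exists>t. x - s t v0 \<in> N}"
    have g_mem: "x - s (g x) v0 \<in> N" if "x \<in> S" for x
      using that g_eq by (auto simp: S_def)
    have add_mem: "(x + y) - s (g x + g y) v0 \<in> N" if "x \<in> S" "y \<in> S" for x y
      using subspace_add[OF N g_mem[OF that(1)] g_mem[OF that(2)]]
      by (simp add: algebra_simps)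
    have scale_mem: "s a x - s (a * g x) v0 \<in> N" if "x \<in> S" for x a
      using subspace_scale[OF N g_mem[OF that], of a]
      by (simp add: scale_right_diff_distrib)
    have S: "subspace S"
      unfolding subspace_def
    proof (intro conjI ballI allI)
      show "0 \<in> S"
        using subspace_0[OF N] unfolding S_def by (auto intro!: exI[of _ 0])
    qed (use add_mem scale_mem in \<open>unfold S_def, blast+\<close>)
    obtain h where h: "clinear_on s UNIV h" "\<And>x. cmod (h x) \<le> p x"
      and hg: "\<And>x. x \<in> S \<Longrightarrow> h x = g x"
    proof (rule hahn_banach[OF vs p S])
      show "clinear_on s S g"
        unfolding clinear_on_def using add_mem scale_mem g_eq by blast
      show "cmod (g x) \<le> p x" if "x \<in> S" for x
        using ge[OF g_mem[OF that], of "g x"] by simp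
    qed blast
    have "v0 - s 1 v0 \<in> N"
      using subspace_0[OF N] by simp
    then have "g v0 = 1" "v0 \<in> S"
      unfolding S_def by (rule g_eq, blast)
    then have "h v0 = 1"
      using hg[of v0] by metis
    moreover have "h n = 0" if "n \<in> N" for n
    proof -
      have "n - s 0 v0 \<in> N"
        using that by simp
      then have "g n = 0" "n \<in> S"
        unfolding S_def by (rule g_eq, blast)
      then show ?thesis
        using hg[of n] by metis
    qed
    then have "\<exists>a. \<forall>v. h v = (\<Sum>j\<in>J. a j * \<psi> j v)"
      by (intro functional_combination[OF vs J \<psi> h(1)]) (auto simp: N_def)
    then obtain a where a: "\<And>v. h v = (\<Sum>j\<in>J. a j * \<psi> j v)" by blast
    ultimately have "1 = cmod (\<Sum>j\<in>J. a j * c j)"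
      using v0 by (metis (mono_tags, lifting) norm_one sum.cong)
    also have "\<dots> \<le> K"
      using h(2) a by (intro bound) simp
    finally show thesis using K by simp
  qed
qed


section \<open>Operators between complex normed spaces\<close>

lemma cblinfun_bounded_linear: "bounded_linear (cblinfun_apply f)"
  using cblinfun_apply[of f] by simp

lemmas cblinfun_add [simp] = linear_add[OF bounded_linear.linear[OF cblinfun_bounded_linear]]
  and cblinfun_diff [simp] = linear_diff[OF bounded_linear.linear[OF cblinfun_bounded_linear]]
  and cblinfun_minus [simp] = linear_neg[OF bounded_linear.linear[OF cblinfun_bounded_linear]]
  and cblinfun_zero [simp] = linear_0[OF bounded_linear.linear[OF cblinfun_bounded_linear]]
  and cblinfun_sum = linear_sum[OF bounded_linear.linear[OF cblinfun_bounded_linear]]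

lemma cblinfun_scaleC [simp]: "cblinfun_apply f (c *\<^sub>C x) = c *\<^sub>C cblinfun_apply f x"
  using cblinfun_apply[of f] by simp

declare plus_cblinfun.rep_eq [simp] minus_cblinfun.rep_eq [simp] uminus_cblinfun.rep_eq [simp]
  zero_cblinfun.rep_eq [simp] scaleC_cblinfun.rep_eq [simp]

lemma scaleC_complex [simp]: "c *\<^sub>C (z :: complex) = c * z"
  by (rule scaleC_complex_def)

lemma scaleR_eq_scaleC: "r *\<^sub>R (x :: 'a::complex_normed_vector) = complex_of_real r *\<^sub>C x"
  by (rule scaleC_of_real[symmetric])

lemma cblinfun_sum_apply: "cblinfun_apply (\<Sum>i\<in>I. f i) x = (\<Sum>i\<in>I. cblinfun_apply (f i) x)"
  by (induction I rule: infinite_finite_induct) auto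

lemma cblinfun_norm: "norm (cblinfun_apply f x) \<le> norm f * norm x"
  unfolding norm_cblinfun.rep_eq by (rule onorm[OF cblinfun_bounded_linear])

lemma cblinfun_norm_le:
  assumes "K \<ge> 0" "\<And>x. norm (cblinfun_apply f x) \<le> K * norm x"
  shows "norm f \<le> K"
  unfolding norm_cblinfun.rep_eq using assms by (rule onorm_bound)

lemma ex_cblinfun:
  assumes "\<And>x y. f (x + y) = f x + f y" "\<And>c x. f (c *\<^sub>C x) = c *\<^sub>C f x"
    and "\<And>x. norm (f x) \<le> K * norm x"
  obtains F where "cblinfun_apply F = f"
proof -
  have "bounded_linear f"
    using assms by (intro bounded_linear_intro[where K = K]) (auto simp: scaleR_eq_scaleC mult.commute)
  then show thesis
    using assms by (intro that[of "CBlinfun f"] CBlinfun_inverse) auto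
qed

lemma ex_cblinfun_compose:
  obtains E where "cblinfun_apply E = (\<lambda>x. cblinfun_apply F (cblinfun_apply G x))"
proof (rule ex_cblinfun[of "\<lambda>x. cblinfun_apply F (cblinfun_apply G x)" "norm F * norm G"])
  show "norm (cblinfun_apply F (cblinfun_apply G x)) \<le> norm F * norm G * norm x" for x
    using cblinfun_norm[of F "cblinfun_apply G x"] mult_left_mono[OF cblinfun_norm[of G x], of "norm F"]
    by (simp add: mult.assoc)
qed auto

lemma cblinfun_norm_approx:
  assumes "r < norm f"
  obtains x where "norm x \<le> 1" "r < norm (cblinfun_apply f x)"
proof (rule ccontr)
  assume "\<not> thesis"
  then have no: "\<not> (norm x \<le> 1 \<and> r < norm (cblinfun_apply f x))" for x
    using that by blast
  have le: "norm (cblinfun_apply f x) \<le> r" if "norm x \<le> 1" for x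
    using no \<open>norm x \<le> 1\<close> by (metis not_le)
  have "norm f \<le> r"
  proof (rule cblinfun_norm_le)
    show "0 \<le> r"
      using le[of 0] by simp
    fix x
    show "norm (cblinfun_apply f x) \<le> r * norm x"
    proof (cases "x = 0")
      case False
      have "norm (cblinfun_apply f (complex_of_real (inverse (norm x)) *\<^sub>C x)) \<le> r"
        using False by (intro le) (simp add: norm_scaleC norm_inverse)
      with False show ?thesis
        by (simp add: norm_scaleC field_simps norm_divide)
    qed simp
  qed
  with assms show False by simp
qed

text \<open>Rotating the argument makes the value of a functional real.\<close>

lemma dual_norm_approx:
  fixes f :: "'a::complex_normed_vector dual"
  assumes "r < norm f"
  obtains x where "norm x \<le> 1" "Im (cblinfun_apply f x) = 0" "r < Re (cblinfun_apply f x)"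
proof -
  obtain x where x: "norm x \<le> 1" "r < norm (cblinfun_apply f x)"
    using cblinfun_norm_approx[OF assms] .
  define z where "z = cblinfun_apply f x"
  define c where "c = (if z = 0 then 1 else cnj z / cmod z)"
  have "cmod c = 1"
    by (auto simp: c_def norm_divide)
  moreover have "c * z = cmod z"
    by (auto simp: c_def complex_norm_square[symmetric] power2_eq_square mult.commute)
  ultimately show thesis
    using x by (intro that[of "c *\<^sub>C x"]) (simp_all add: norm_scaleC z_def)
qed

lemma sum_dual_norms_le:
  fixes w :: "'i \<Rightarrow> 'a::complex_normed_vector dual"
  assumes "finite L" and le: "\<And>b. (\<And>l. l \<in> L \<Longrightarrow> norm (b l) \<le> 1) \<Longrightarrow> cmod (\<Sum>l\<in>L. cblinfun_apply (w l) (b l)) \<le> C"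
  shows "(\<Sum>l\<in>L. norm (w l)) \<le> C"
proof (rule field_le_epsilon)
  fix e :: real assume e: "e > 0"
  define d where "d = e / (card L + 1)"
  have d: "d > 0" using e by (simp add: d_def add_nonneg_pos)
  have "\<exists>b. norm b \<le> 1 \<and> Im (cblinfun_apply (w l) b) = 0 \<and> norm (w l) - d < Re (cblinfun_apply (w l) b)" for l
    using dual_norm_approx[of "norm (w l) - d" "w l"] d by auto
  then obtain b where b: "\<And>l. norm (b l) \<le> 1" "\<And>l. Im (cblinfun_apply (w l) (b l)) = 0"
    "\<And>l. norm (w l) - d < Re (cblinfun_apply (w l) (b l))" by metis
  have "(\<Sum>l\<in>L. norm (w l) - d) \<le> (\<Sum>l\<in>L. Re (cblinfun_apply (w l) (b l)))"
    by (intro sum_mono less_imp_le b)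
  also have "\<dots> \<le> cmod (\<Sum>l\<in>L. cblinfun_apply (w l) (b l))"
    by (simp flip: Re_sum add: complex_Re_le_cmod)
  also have "\<dots> \<le> C"
    by (rule le) (rule b)
  finally have "(\<Sum>l\<in>L. norm (w l)) \<le> C + card L * d"
    by (simp add: sum_subtractf)
  also have "card L * d \<le> e"
    using e by (simp add: d_def field_simps)
  finally show "(\<Sum>l\<in>L. norm (w l)) \<le> C + e" by simp
qed

lemma hahn_banach_dual:
  fixes g :: "'a::complex_normed_vector \<Rightarrow> complex"
  assumes S: "complex_vector.subspace S" and g: "clinear_on scaleC S g"
    and le: "\<And>x. x \<in> S \<Longrightarrow> cmod (g x) \<le> K * norm x" and K: "K \<ge> 0"
  obtains h where "\<And>x. x \<in> S \<Longrightarrow> cblinfun_apply h x = g x" "norm h \<le> K"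
proof -
  have "seminorm scaleC (\<lambda>x :: 'a. K * norm x)"
    using K norm_triangle_ineq by (auto simp: seminorm_def norm_scaleC simp flip: distrib_left intro: mult_left_mono)
  from hahn_banach[OF complex_vector.vector_space_axioms this S g le]
  obtain h where h: "clinear_on scaleC UNIV h" "\<And>x. cmod (h x) \<le> K * norm x" "\<And>x. x \<in> S \<Longrightarrow> h x = g x"
    by blast
  obtain H where "cblinfun_apply H = h"
    using h by (auto simp: clinear_on_def intro: ex_cblinfun[of h K])
  with h show thesis
    using K by (intro that[of H]) (auto intro: cblinfun_norm_le)
qed


section \<open>Approximation of finitely many elements of the bidual\<close>

lemma vector_space_fun: "vector_space (\<lambda>c (v :: 'i \<Rightarrow> 'a::complex_normed_vector) i. c *\<^sub>C v i)"
  by unfold_locales (auto simp: fun_eq_iff scaleC_add_right scaleC_add_left scaleC_scaleC)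

text \<open>Inserting 0 gives the value 0 for the empty index set.\<close>

definition max_norm :: "'l set \<Rightarrow> ('l \<Rightarrow> 'a::real_normed_vector) \<Rightarrow> real"
  where "max_norm L y = Max (insert 0 ((\<lambda>l. norm (y l)) ` L))"

lemma norm_le_max_norm: "finite L \<Longrightarrow> l \<in> L \<Longrightarrow> norm (y l) \<le> max_norm L y"
  unfolding max_norm_def by (intro Max_ge) auto

lemma max_norm_le_iff: "finite L \<Longrightarrow> C \<ge> 0 \<Longrightarrow> max_norm L y \<le> C \<longleftrightarrow> (\<forall>l\<in>L. norm (y l) \<le> C)"
  unfolding max_norm_def by (subst Max_le_iff) auto

lemma max_norm_less_iff: "finite L \<Longrightarrow> C > 0 \<Longrightarrow> max_norm L y < C \<longleftrightarrow> (\<forall>l\<in>L. norm (y l) < C)"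
  unfolding max_norm_def by (subst Max_less_iff) auto

lemma max_norm_nonneg: "finite L \<Longrightarrow> 0 \<le> max_norm L y"
  unfolding max_norm_def by (intro Max_ge) auto

lemma max_norm_scale:
  fixes y :: "'l \<Rightarrow> 'a::complex_normed_vector"
  assumes L: "finite L"
  shows "max_norm L (\<lambda>l. c *\<^sub>C y l) = cmod c * max_norm L y"
proof (rule antisym)
  show *: "max_norm L (\<lambda>l. c *\<^sub>C y l) \<le> cmod c * max_norm L y" for c and y :: "'l \<Rightarrow> 'a"
    using L max_norm_nonneg[OF L, of y] norm_le_max_norm[OF L, of _ y]
    by (subst max_norm_le_iff) (auto simp: norm_scaleC mult_left_mono)
  show "cmod c * max_norm L y \<le> max_norm L (\<lambda>l. c *\<^sub>C y l)"
  proof (cases "c = 0")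
    case False
    then show ?thesis
      using *[of "inverse c" "\<lambda>l. c *\<^sub>C y l"] by (simp add: scaleC_scaleC norm_divide field_simps)
  qed (use max_norm_nonneg[OF L] in auto)
qed

lemma max_norm_triangle:
  assumes L: "finite L"
  shows "max_norm L (\<lambda>l. x l + y l) \<le> max_norm L x + max_norm L y"
  using L max_norm_nonneg[OF L, of x] max_norm_nonneg[OF L, of y]
  by (subst max_norm_le_iff)
    (auto intro: order_trans[OF norm_triangle_ineq] add_mono norm_le_max_norm)

lemma seminorm_max_norm:
  assumes "finite L"
  shows "seminorm (\<lambda>c v i. c *\<^sub>C v i) (max_norm L :: ('l \<Rightarrow> 'a::complex_normed_vector) \<Rightarrow> real)"
  unfolding seminorm_def
  using max_norm_scale[OF assms] max_norm_triangle[OF assms] by (auto simp: plus_fun_def)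

text \<open>The dual of a finite \<open>\<ell>\<^sub>\<infinity>\<close>-sum is the \<open>\<ell>\<^sub>1\<close>-sum of the duals.\<close>

lemma max_norm_dual:
  fixes h :: "('l \<Rightarrow> 'a::complex_normed_vector) \<Rightarrow> complex"
  assumes L: "finite L" and h: "clinear_on (\<lambda>c v i. c *\<^sub>C v i) UNIV h"
    and le: "\<And>y. cmod (h y) \<le> max_norm L y"
  obtains w :: "'l \<Rightarrow> 'a dual" where "\<And>y. h y = (\<Sum>l\<in>L. cblinfun_apply (w l) (y l))"
    "(\<Sum>l\<in>L. norm (w l)) \<le> 1"
proof -
  have h_add: "h (\<lambda>i. x i + y i) = h x + h y" for x y
    using h by (auto simp: clinear_on_def plus_fun_def)
  have h_scale: "h (\<lambda>i. c *\<^sub>C x i) = c * h x" for c x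
    using h by (auto simp: clinear_on_def)
  define single where "single l b i = (if i = l then b else 0)" for l i :: 'l and b :: 'a
  have "\<exists>W. \<forall>b. cblinfun_apply W b = h (single l b)" for l
  proof -
    obtain W where "cblinfun_apply W = (\<lambda>b. h (single l b))"
    proof (rule ex_cblinfun[of "\<lambda>b. h (single l b)" 1])
      show "h (single l (b + b')) = h (single l b) + h (single l b')" for b b'
        by (subst h_add[symmetric]) (auto simp: single_def intro!: arg_cong[of _ _ h])
      show "h (single l (c *\<^sub>C b)) = c *\<^sub>C h (single l b)" for b c
        by (subst scaleC_complex, subst h_scale[symmetric])
          (auto simp: single_def intro!: arg_cong[of _ _ h])
      show "norm (h (single l b)) \<le> 1 * norm b" for b
        using le[of "single l b"] max_norm_le_iff[OF L, of "norm b" "single l b"]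
        by (auto simp: single_def)
    qed blast
    then show ?thesis by metis
  qed
  then obtain w :: "'l \<Rightarrow> 'a dual" where w: "\<And>l b. cblinfun_apply (w l) b = h (single l b)" by metis
  have h_eq0: "h y = 0" if "\<And>l. l \<in> L \<Longrightarrow> y l = 0" for y
    using le[of y] max_norm_le_iff[OF L, of 0 y] that
    by (metis norm_le_zero_iff norm_zero order_refl order_trans)
  have on_fin: "h (\<lambda>i. if i \<in> L' then y i else 0) = (\<Sum>l\<in>L'. cblinfun_apply (w l) (y l))"
    if "finite L'" for L' y
    using that
  proof (induction L')
    case empty
    then show ?case using h_eq0[of "\<lambda>i. 0"] by simp
  next
    case (insert l L')
    have "(\<lambda>i. if i \<in> insert l L' then y i else 0) = (\<lambda>i. single l (y l) i + (if i \<in> L' then y i else 0))"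
      using insert.hyps by (auto simp: fun_eq_iff single_def)
    then show ?case
      using insert by (simp add: h_add w)
  qed
  have h_eq: "h y = (\<Sum>l\<in>L. cblinfun_apply (w l) (y l))" for y
  proof -
    have "h y = h (\<lambda>i. (if i \<in> L then y i else 0) + (if i \<in> L then 0 else y i))"
      by (intro arg_cong[of _ _ h]) auto
    also have "\<dots> = h (\<lambda>i. if i \<in> L then y i else 0)"
      by (subst h_add) (simp add: h_eq0)
    finally show ?thesis
      using on_fin[OF L] by simp
  qed
  show thesis
  proof (rule that[OF h_eq])
    show "(\<Sum>l\<in>L. norm (w l)) \<le> 1"
    proof (rule sum_dual_norms_le[OF L])
      fix b :: "'l \<Rightarrow> 'a" assume "\<And>l. l \<in> L \<Longrightarrow> norm (b l) \<le> 1"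
      then have "max_norm L b \<le> 1"
        using L by (simp add: max_norm_le_iff)
      with le[of b] h_eq[of b] show "cmod (\<Sum>l\<in>L. cblinfun_apply (w l) (b l)) \<le> 1" by simp
    qed
  qed
qed

text \<open>Helly's theorem is applied to families \<open>v\<close> with the seminorm given by the norms of the
  combinations with coefficients \<open>a l\<close>. A combination of the functionals \<open>v \<mapsto> \<phi> (v i)\<close> that is
  bounded by this seminorm factors through an \<open>\<ell>\<^sub>\<infinity>\<close>-sum, so it is given by functionals \<open>w l\<close>
  with \<open>\<Sum>l. \<parallel>w l\<parallel> \<le> 1\<close>, and then the \<open>z i\<close> satisfy the corresponding estimate.\<close>

lemma local_reflexivity_unit:
  fixes z :: "'i \<Rightarrow> 'a::complex_normed_vector bidual" and a :: "'l \<Rightarrow> 'i \<Rightarrow> complex"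
  assumes I: "finite I" and L: "finite L" and \<Phi>: "finite \<Phi>"
    and z: "\<And>l. l \<in> L \<Longrightarrow> norm (\<Sum>i\<in>I. a l i *\<^sub>C z i) < 1"
  obtains x :: "'i \<Rightarrow> 'a" where "\<And>i \<phi>. i \<in> I \<Longrightarrow> \<phi> \<in> \<Phi> \<Longrightarrow> cblinfun_apply \<phi> (x i) = cblinfun_apply (z i) \<phi>"
    "\<And>l. l \<in> L \<Longrightarrow> norm (\<Sum>i\<in>I. a l i *\<^sub>C x i) < 1"
proof -
  define A where "A v l = (\<Sum>i\<in>I. a l i *\<^sub>C v i)" for v :: "'i \<Rightarrow> 'a" and l
  have A_add: "A (u + v) = A u + A v" and A_scale: "A (\<lambda>i. c *\<^sub>C v i) = (\<lambda>l. c *\<^sub>C A v l)" for u v c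
    by (auto simp: A_def fun_eq_iff scaleC_add_right sum.distrib complex_vector.scale_sum_right
        scaleC_scaleC mult.commute)
  define p where "p v = max_norm L (A v)" for v
  define K where "K = max_norm L (\<lambda>l. \<Sum>i\<in>I. a l i *\<^sub>C z i)"
  have K: "0 \<le> K" "K < 1" "\<And>l. l \<in> L \<Longrightarrow> norm (\<Sum>i\<in>I. a l i *\<^sub>C z i) \<le> K"
    using z L by (auto simp: K_def max_norm_nonneg max_norm_less_iff intro: norm_le_max_norm)
  have semi: "seminorm (\<lambda>c v i. c *\<^sub>C v i) p"
    unfolding seminorm_def
  proof (intro conjI allI)
    show "p (u + v) \<le> p u + p v" for u v
      unfolding p_def A_add unfolding plus_fun_def by (rule max_norm_triangle[OF L])
    show "p (\<lambda>i. c *\<^sub>C v i) = cmod c * p v" for c v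
      unfolding p_def A_scale by (rule max_norm_scale[OF L])
  qed
  have fin: "finite (I \<times> \<Phi>)"
    using I \<Phi> by simp
  obtain v where v: "\<And>j. j \<in> I \<times> \<Phi> \<Longrightarrow> (\<lambda>(i, \<phi>) v. cblinfun_apply \<phi> (v i)) j v = (\<lambda>(i, \<phi>). cblinfun_apply (z i) \<phi>) j"
    and pv: "p v < 1"
  proof (rule helly[OF vector_space_fun semi fin _ K(2)])
    show "clinear_on (\<lambda>c v i. c *\<^sub>C v i) UNIV ((\<lambda>(i, \<phi>) v. cblinfun_apply \<phi> (v i)) j)" for j :: "'i \<times> 'a dual"
      by (auto simp: clinear_on_def split: prod.splits)
  next
    fix b :: "'i \<times> 'a dual \<Rightarrow> complex"
    define \<beta> where "\<beta> v = (\<Sum>j\<in>I \<times> \<Phi>. b j * (\<lambda>(i, \<phi>) v. cblinfun_apply \<phi> (v i)) j v)" for v :: "'i \<Rightarrow> 'a"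
    assume "\<And>v. cmod (\<Sum>j\<in>I \<times> \<Phi>. b j * (\<lambda>(i, \<phi>) v. cblinfun_apply \<phi> (v i)) j v) \<le> p v"
    then have le: "cmod (\<beta> v) \<le> p v" for v
      by (simp add: \<beta>_def)
    have \<beta>_add: "\<beta> (u + v) = \<beta> u + \<beta> v" and \<beta>_scale: "\<beta> (\<lambda>i. c *\<^sub>C v i) = c * \<beta> v" for u v c
      by (auto simp: \<beta>_def sum.distrib sum_distrib_left algebra_simps split: prod.splits intro!: sum.cong
          simp flip: sum.distrib)
    have \<beta>_cong: "\<beta> u = \<beta> v" if "A u = A v" for u v
    proof -
      have "A (u + (\<lambda>i. (- 1) *\<^sub>C v i)) = 0"
        using that by (simp only: A_add A_scale) (simp add: fun_eq_iff)
      then have "p (u + (\<lambda>i. (- 1) *\<^sub>C v i)) = 0"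
        using max_norm_le_iff[OF L, of 0 "\<lambda>l. 0 :: 'a"] max_norm_nonneg[OF L, of "\<lambda>l. 0 :: 'a"]
        by (simp add: p_def zero_fun_def)
      then have "\<beta> (u + (\<lambda>i. (- 1) *\<^sub>C v i)) = 0"
        using le[of "u + (\<lambda>i. (- 1) *\<^sub>C v i)"] by simp
      then show ?thesis
        by (simp only: \<beta>_add \<beta>_scale) simp
    qed
    define g where "g y = \<beta> (SOME v. A v = y)" for y
    have g: "g (A v) = \<beta> v" for v
      unfolding g_def by (rule \<beta>_cong) (rule someI[of _ v], simp)
    interpret Y: vector_space "\<lambda>c (v :: 'l \<Rightarrow> 'a) i. c *\<^sub>C v i" by (rule vector_space_fun)
    have "A (\<lambda>i. 0) = 0"
      by (simp add: A_def fun_eq_iff)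
    then have sub: "Y.subspace (range A)"
      unfolding Y.subspace_def by (auto simp flip: A_add A_scale intro: range_eqI sym)
    obtain h where h: "clinear_on (\<lambda>c v i. c *\<^sub>C v i) UNIV h" "\<And>y. cmod (h y) \<le> max_norm L y"
      and hg: "\<And>y. y \<in> range A \<Longrightarrow> h y = g y"
    proof (rule hahn_banach[OF vector_space_fun seminorm_max_norm[OF L] sub])
      show "clinear_on (\<lambda>c v i. c *\<^sub>C v i) (range A) g"
        unfolding clinear_on_def by (auto simp: g \<beta>_add \<beta>_scale simp flip: A_add A_scale)
      show "cmod (g y) \<le> max_norm L y" if "y \<in> range A" for y
        using that le by (auto simp: g p_def)
    qed blast
    obtain w where w: "\<And>y. h y = (\<Sum>l\<in>L. cblinfun_apply (w l) (y l))" and w1: "(\<Sum>l\<in>L. norm (w l)) \<le> 1"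
      using max_norm_dual[OF L h] by blast
    have coord: "(\<Sum>\<phi>\<in>\<Phi>. b (i, \<phi>) *\<^sub>C \<phi>) = (\<Sum>l\<in>L. a l i *\<^sub>C w l)" if i: "i \<in> I" for i
    proof (rule cblinfun_eqI)
      fix x :: 'a
      define v where "v j = (if j = i then x else 0)" for j
      have "\<beta> v = (\<Sum>j\<in>I. \<Sum>\<phi>\<in>\<Phi>. b (j, \<phi>) * cblinfun_apply \<phi> (v j))"
        by (simp add: \<beta>_def sum.cartesian_product split: prod.splits) (auto intro!: sum.cong)
      also have "\<dots> = (\<Sum>j\<in>I. if j = i then \<Sum>\<phi>\<in>\<Phi>. b (i, \<phi>) * cblinfun_apply \<phi> x else 0)"
        by (intro sum.cong) (auto simp: v_def)
      also have "\<dots> = (\<Sum>\<phi>\<in>\<Phi>. b (i, \<phi>) * cblinfun_apply \<phi> x)"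
        using i I by simp
      finally have 1: "\<beta> v = (\<Sum>\<phi>\<in>\<Phi>. b (i, \<phi>) * cblinfun_apply \<phi> x)" .
      have "A v l = a l i *\<^sub>C x" for l
      proof -
        have "A v l = (\<Sum>j\<in>I. if j = i then a l i *\<^sub>C x else 0)"
          unfolding A_def by (intro sum.cong) (auto simp: v_def)
        then show ?thesis using i I by simp
      qed
      then have "\<beta> v = (\<Sum>l\<in>L. a l i * cblinfun_apply (w l) x)"
        using hg[of "A v"] g[of v] w[of "A v"] by simp
      with 1 show "cblinfun_apply (\<Sum>\<phi>\<in>\<Phi>. b (i, \<phi>) *\<^sub>C \<phi>) x = cblinfun_apply (\<Sum>l\<in>L. a l i *\<^sub>C w l) x"
        by (simp add: cblinfun_sum_apply)
    qed
    have "(\<Sum>j\<in>I \<times> \<Phi>. b j * (\<lambda>(i, \<phi>). cblinfun_apply (z i) \<phi>) j) = (\<Sum>i\<in>I. \<Sum>\<phi>\<in>\<Phi>. b (i, \<phi>) * cblinfun_apply (z i) \<phi>)"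
      by (simp add: sum.cartesian_product split: prod.splits) (auto intro!: sum.cong)
    also have "\<dots> = (\<Sum>i\<in>I. cblinfun_apply (z i) (\<Sum>\<phi>\<in>\<Phi>. b (i, \<phi>) *\<^sub>C \<phi>))"
      by (simp add: cblinfun_sum)
    also have "\<dots> = (\<Sum>i\<in>I. \<Sum>l\<in>L. a l i * cblinfun_apply (z i) (w l))"
      by (intro sum.cong refl) (simp add: coord cblinfun_sum)
    also have "\<dots> = (\<Sum>l\<in>L. cblinfun_apply (\<Sum>i\<in>I. a l i *\<^sub>C z i) (w l))"
      by (subst sum.swap) (simp add: cblinfun_sum_apply)
    also have "cmod \<dots> \<le> (\<Sum>l\<in>L. K * norm (w l))"
      using K by (intro sum_norm_le order_trans[OF cblinfun_norm] mult_right_mono) auto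
    also have "\<dots> \<le> K * 1"
      unfolding sum_distrib_left[symmetric] using w1 K by (intro mult_left_mono) auto
    finally show "cmod (\<Sum>j\<in>I \<times> \<Phi>. b j * (\<lambda>(i, \<phi>). cblinfun_apply (z i) \<phi>) j) \<le> K" by simp
  qed blast
  show thesis
    using v pv L by (intro that[of v]) (auto simp: p_def A_def max_norm_less_iff)
qed

text \<open>This serves three purposes: with one element it is Goldstine's theorem, with two it produces
  pairs with a controlled difference, and in the dual it moves the functionals of an operator of
  finite rank on the bidual into the dual.\<close>

theorem local_reflexivity:
  fixes z :: "'i \<Rightarrow> 'a::complex_normed_vector bidual" and a :: "'l \<Rightarrow> 'i \<Rightarrow> complex"
  assumes I: "finite I" and L: "finite L" and \<Phi>: "finite \<Phi>"
    and z: "\<And>l. l \<in> L \<Longrightarrow> norm (\<Sum>i\<in>I. a l i *\<^sub>C z i) < c l"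
  obtains x :: "'i \<Rightarrow> 'a" where "\<And>i \<phi>. i \<in> I \<Longrightarrow> \<phi> \<in> \<Phi> \<Longrightarrow> cblinfun_apply \<phi> (x i) = cblinfun_apply (z i) \<phi>"
    "\<And>l. l \<in> L \<Longrightarrow> norm (\<Sum>i\<in>I. a l i *\<^sub>C x i) < c l"
proof -
  define a' where "a' l i = inverse (complex_of_real (c l)) * a l i" for l i
  have a': "(\<Sum>i\<in>I. a' l i *\<^sub>C y i) = inverse (complex_of_real (c l)) *\<^sub>C (\<Sum>i\<in>I. a l i *\<^sub>C y i)"
    for l and y :: "'i \<Rightarrow> 'b::complex_normed_vector"
    by (simp add: a'_def complex_vector.scale_sum_right scaleC_scaleC)
  have c: "c l > 0" if "l \<in> L" for l
    using z[OF that] norm_ge_zero order_le_less_trans by blast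
  have eq: "norm (\<Sum>i\<in>I. a' l i *\<^sub>C y i) < 1 \<longleftrightarrow> norm (\<Sum>i\<in>I. a l i *\<^sub>C y i) < c l"
    if "l \<in> L" for l and y :: "'i \<Rightarrow> 'b::complex_normed_vector"
    using c[OF that] by (simp add: a' norm_scaleC norm_divide field_simps)
  obtain x :: "'i \<Rightarrow> 'a" where "\<And>i \<phi>. i \<in> I \<Longrightarrow> \<phi> \<in> \<Phi> \<Longrightarrow> cblinfun_apply \<phi> (x i) = cblinfun_apply (z i) \<phi>"
    "\<And>l. l \<in> L \<Longrightarrow> norm (\<Sum>i\<in>I. a' l i *\<^sub>C x i) < 1"
    using local_reflexivity_unit[OF I L \<Phi>, of a' z] z by (auto simp: eq)
  then show thesis
    by (intro that[of x]) (auto simp: eq)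
qed


section \<open>Finite-dimensional subspaces\<close>

lemma dist_closed_pos:
  fixes x :: "'a::metric_space"
  assumes "closed S" "x \<notin> S"
  obtains d where "d > 0" "\<And>y. y \<in> S \<Longrightarrow> d \<le> dist x y"
proof -
  obtain d where d: "d > 0" "ball x d \<subseteq> - S"
    using assms open_contains_ball[of "- S"] by (auto simp: open_Compl)
  show thesis
    using d by (intro that[of d]) (auto simp: subset_iff not_less[symmetric])
qed

lemma seq_compact_imp_closed:
  fixes S :: "'a::real_normed_vector set"
  assumes "\<And>y :: nat \<Rightarrow> 'a. bounded (range y) \<Longrightarrow> range y \<subseteq> S \<Longrightarrow>
    \<exists>l r. l \<in> S \<and> strict_mono r \<and> (y \<circ> r) \<longlonglongrightarrow> l"
  shows "closed S"
  unfolding closed_sequential_limits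
proof (intro allI impI)
  fix y l assume "(\<forall>n. y n \<in> S) \<and> y \<longlonglongrightarrow> l"
  then have y: "range y \<subseteq> S" "y \<longlonglongrightarrow> l" by auto
  then obtain l' r where l': "l' \<in> S" "strict_mono r" "(y \<circ> r) \<longlonglongrightarrow> l'"
    using assms[of y] convergent_imp_bounded by blast
  then have "l = l'"
    using LIMSEQ_subseq_LIMSEQ[OF y(2)] LIMSEQ_unique by blast
  with l' show "l \<in> S" by simp
qed

lemma coefficient_bound:
  assumes d: "\<And>y. y \<in> complex_vector.span B \<Longrightarrow> d \<le> dist b y" and y: "y \<in> complex_vector.span B"
  shows "cmod c * d \<le> norm (c *\<^sub>C b + y)"
proof (cases "c = 0")
  case False
  have "d \<le> dist b ((- inverse c) *\<^sub>C y)"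
    using y by (intro d complex_vector.span_scale)
  then have "cmod c * d \<le> cmod c * norm (b + inverse c *\<^sub>C y)"
    by (intro mult_left_mono) (simp_all add: dist_norm)
  also have "\<dots> = norm (c *\<^sub>C b + y)"
    using False by (simp add: scaleC_add_right scaleC_scaleC flip: norm_scaleC)
  finally show ?thesis .
qed simp

text \<open>Induction on the number of generators: if \<open>b\<close> has positive distance from the closed span of
  the others, then the coefficients of \<open>b\<close> in a bounded sequence are bounded, and passing to
  subsequences handles them and the rest separately.\<close>

lemma finite_span_seq_compact:
  fixes B :: "'a::complex_normed_vector set" and x :: "nat \<Rightarrow> 'a"
  assumes "finite B" "bounded (range x)" "range x \<subseteq> complex_vector.span B"
  shows "\<exists>l r. l \<in> complex_vector.span B \<and> strict_mono r \<and> (x \<circ> r) \<longlonglongrightarrow> l"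
  using assms
proof (induction B arbitrary: x rule: finite_induct)
  case empty
  then have "x = (\<lambda>n. 0)"
    by (auto simp: fun_eq_iff)
  show ?case
  proof (intro exI conjI)
    show "0 \<in> complex_vector.span ({} :: 'a set)" by simp
    show "strict_mono (\<lambda>n :: nat. n)" by (simp add: strict_mono_def)
    show "(x \<circ> (\<lambda>n. n)) \<longlonglongrightarrow> 0" by (simp add: \<open>x = (\<lambda>n. 0)\<close> o_def)
  qed
next
  case (insert b B)
  let ?S = "complex_vector.span B"
  have "closed ?S"
    by (rule seq_compact_imp_closed) (rule insert.IH)
  show ?case
  proof (cases "b \<in> ?S")
    case True
    then show ?thesis
      using insert.IH[OF insert.prems(1)] insert.prems(2) by (simp add: complex_vector.span_redundant)
  next
    case False
    then obtain d where d: "d > 0" "\<And>y. y \<in> ?S \<Longrightarrow> d \<le> dist b y"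
      using dist_closed_pos[OF \<open>closed ?S\<close>] by blast
    have "\<exists>c. x n - c *\<^sub>C b \<in> ?S" for n
      using insert.prems(2) complex_vector.span_breakdown_eq by blast
    then obtain c where c: "\<And>n. x n - c n *\<^sub>C b \<in> ?S" by metis
    obtain C where C: "\<And>n. norm (x n) \<le> C"
      using insert.prems(1) by (auto simp: bounded_iff)
    have "cmod (c n) \<le> C / d" for n
      using coefficient_bound[OF d(2) c[of n], of "c n"] C[of n] d(1) by (simp add: pos_le_divide_eq)
    then have "bounded (range c)"
      by (auto simp: bounded_iff)
    then obtain a r where r: "strict_mono r" "(c \<circ> r) \<longlonglongrightarrow> a"
      using bounded_imp_convergent_subsequence by blast
    have cr: "(\<lambda>n. c (r n) *\<^sub>C b) \<longlonglongrightarrow> a *\<^sub>C b"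
    proof (rule Lim_null_comparison[THEN Lim_null[THEN iffD2]])
      show "\<forall>\<^sub>F n in sequentially. norm (c (r n) *\<^sub>C b - a *\<^sub>C b) \<le> cmod (c (r n) - a) * norm b"
        by (simp flip: complex_vector.scale_left_diff_distrib add: norm_scaleC)
      show "(\<lambda>n. cmod (c (r n) - a) * norm b) \<longlonglongrightarrow> 0"
        using r(2) by (auto simp: o_def intro!: tendsto_eq_intros dest: Lim_null[THEN iffD1])
    qed
    define y where "y n = x (r n) - c (r n) *\<^sub>C b" for n
    have "norm (y n) \<le> C + C / d * norm b" for n
      unfolding y_def using C mult_right_mono[OF \<open>\<And>n. cmod (c n) \<le> C / d\<close> norm_ge_zero[of b]]
      by (intro order_trans[OF norm_triangle_ineq4] add_mono) (auto simp: norm_scaleC)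
    then have "bounded (range y)"
      by (auto simp: bounded_iff)
    moreover have "range y \<subseteq> ?S"
      using c by (auto simp: y_def)
    ultimately obtain l r' where r': "l \<in> ?S" "strict_mono r'" "(y \<circ> r') \<longlonglongrightarrow> l"
      using insert.IH by blast
    have "(\<lambda>n. c (r (r' n)) *\<^sub>C b + y (r' n)) \<longlonglongrightarrow> a *\<^sub>C b + l"
      using LIMSEQ_subseq_LIMSEQ[OF cr r'(2)] r'(3) by (intro tendsto_add) (simp_all add: o_def)
    moreover have "a *\<^sub>C b + l \<in> complex_vector.span (insert b B)"
    proof (intro complex_vector.span_add complex_vector.span_scale)
      show "b \<in> complex_vector.span (insert b B)"
        by (intro complex_vector.span_base) simp
      show "l \<in> complex_vector.span (insert b B)"
        using r'(1) complex_vector.span_mono[of B "insert b B"] by blast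
    qed
    ultimately show ?thesis
      using strict_mono_o[OF r(1) r'(2)]
      by (intro exI[of _ "a *\<^sub>C b + l"] exI[of _ "r \<circ> r'"]) (simp add: y_def o_def)
  qed
qed

lemma compact_finite_span_cball:
  fixes B :: "'a::complex_normed_vector set"
  assumes "finite B"
  shows "compact (complex_vector.span B \<inter> cball 0 \<rho>)"
  unfolding compact_eq_seq_compact_metric seq_compact_def
proof (intro allI impI)
  fix x :: "nat \<Rightarrow> 'a" assume x: "\<forall>n. x n \<in> complex_vector.span B \<inter> cball 0 \<rho>"
  then have "bounded (range x)"
    by (auto simp: bounded_iff)
  then obtain l r where l: "l \<in> complex_vector.span B" "strict_mono r" "(x \<circ> r) \<longlonglongrightarrow> l"
    using finite_span_seq_compact[OF assms, of x] x by blast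
  moreover have "l \<in> cball 0 \<rho>"
    using x by (intro closed_sequentially[OF closed_cball _ l(3)]) auto
  ultimately show "\<exists>l\<in>complex_vector.span B \<inter> cball 0 \<rho>. \<exists>r. strict_mono r \<and> (x \<circ> r) \<longlonglongrightarrow> l"
    by blast
qed

lemma closed_finite_span:
  fixes B :: "'a::complex_normed_vector set"
  assumes "finite B"
  shows "closed (complex_vector.span B)"
  by (rule seq_compact_imp_closed) (rule finite_span_seq_compact[OF assms])

text \<open>A coordinate functional is bounded on the span because a basis vector has positive distance
  from the span of the others, so it extends to the whole space.\<close>

lemma finite_span_coordinates:
  fixes B :: "'a::complex_normed_vector set"
  assumes "finite B"
  obtains B' and h :: "'a \<Rightarrow> 'a dual" where "finite B'" "B' \<subseteq> B"
    "complex_vector.span B' = complex_vector.span B"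
    "\<And>x. x \<in> complex_vector.span B \<Longrightarrow> x = (\<Sum>b\<in>B'. cblinfun_apply (h b) x *\<^sub>C b)"
proof -
  obtain B' where B': "B' \<subseteq> B" "complex_vector.independent B'" "B \<subseteq> complex_vector.span B'"
    by (rule complex_vector.maximal_independent_subset)
  have fin: "finite B'"
    using B'(1) assms by (rule finite_subset)
  have span: "complex_vector.span B' = complex_vector.span B"
    using complex_vector.span_mono[OF B'(1)] complex_vector.span_mono[OF B'(3)]
    by (simp add: complex_vector.span_span)
  let ?rep = "complex_vector.representation B'"
  have "\<exists>h :: 'a dual. \<forall>x\<in>complex_vector.span B'. cblinfun_apply h x = ?rep x b" if b: "b \<in> B'" for b
  proof -
    let ?S = "complex_vector.span (B' - {b})"
    have "b \<notin> ?S"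
      using B'(2) b by (auto simp: complex_vector.dependent_def)
    then obtain d where d: "d > 0" "\<And>y. y \<in> ?S \<Longrightarrow> d \<le> dist b y"
      using dist_closed_pos[OF closed_finite_span, of "B' - {b}" b] fin by blast
    have le: "cmod (?rep x b) \<le> inverse d * norm x" if x: "x \<in> complex_vector.span B'" for x
    proof (cases "?rep x b = 0")
      case False
      define c where "c = ?rep x b"
      have "x = (\<Sum>b'\<in>B'. ?rep x b' *\<^sub>C b')"
        using complex_vector.sum_representation_eq[OF B'(2) x fin order_refl] by simp
      also have "\<dots> = c *\<^sub>C b + (\<Sum>b'\<in>B' - {b}. ?rep x b' *\<^sub>C b')"
        using b fin by (simp add: sum.remove c_def)
      finally have x_eq: "x = c *\<^sub>C b + (\<Sum>b'\<in>B' - {b}. ?rep x b' *\<^sub>C b')" .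
      define y where "y = (\<Sum>b'\<in>B' - {b}. ?rep x b' *\<^sub>C b')"
      have "y \<in> ?S"
        unfolding y_def by (intro complex_vector.span_sum complex_vector.span_scale complex_vector.span_base)
      then have "cmod c * d \<le> norm x"
        using coefficient_bound[OF d(2) \<open>y \<in> ?S\<close>, of c] x_eq by (simp only: y_def)
      then show ?thesis
        using d(1) by (simp add: c_def field_simps)
    qed (use d(1) in simp)
    obtain h where "\<And>x. x \<in> complex_vector.span B' \<Longrightarrow> cblinfun_apply h x = ?rep x b"
    proof (rule hahn_banach_dual[OF complex_vector.subspace_span _ le])
      show "clinear_on scaleC (complex_vector.span B') (\<lambda>x. ?rep x b)"
        using complex_vector.representation_add[OF B'(2)] complex_vector.representation_scale[OF B'(2)]
        by (simp add: clinear_on_def)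
    qed (use d(1) in auto)
    then show ?thesis by blast
  qed
  then obtain h :: "'a \<Rightarrow> 'a dual" where
    h: "\<And>b x. b \<in> B' \<Longrightarrow> x \<in> complex_vector.span B' \<Longrightarrow> cblinfun_apply (h b) x = ?rep x b"
    by metis
  show thesis
  proof (rule that[OF fin B'(1) span])
    fix x assume "x \<in> complex_vector.span B"
    then have x: "x \<in> complex_vector.span B'" by (simp add: span)
    then show "x = (\<Sum>b\<in>B'. cblinfun_apply (h b) x *\<^sub>C b)"
      using complex_vector.sum_representation_eq[OF B'(2) x fin order_refl] h by simp
  qed
qed

text \<open>Almost norming points for a finite net of the compact unit sphere.\<close>

lemma finitely_many_norming_points:
  fixes B :: "'a::complex_normed_vector dual set"
  assumes "finite B" and \<epsilon>: "\<epsilon> > 0"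
  obtains N :: "'a set" where "finite N" "\<And>\<eta>. \<eta> \<in> N \<Longrightarrow> norm \<eta> \<le> 1"
    "\<And>m K. m \<in> complex_vector.span B \<Longrightarrow> (\<And>\<eta>. \<eta> \<in> N \<Longrightarrow> cmod (cblinfun_apply m \<eta>) \<le> K) \<Longrightarrow>
      norm m \<le> (1 + \<epsilon>) * K"
proof -
  define \<delta> where "\<delta> = \<epsilon> / (2 * (1 + \<epsilon>))"
  have \<delta>: "\<delta> > 0" "(1 + \<epsilon>) * (1 - 2 * \<delta>) = 1"
    using \<epsilon> by (auto simp: \<delta>_def field_simps)
  let ?M = "complex_vector.span B"
  define S where "S = ?M \<inter> cball 0 1 \<inter> sphere 0 1"
  have "closed (sphere 0 1 :: 'a dual set)"
    unfolding sphere_def by (intro closed_Collect_eq continuous_intros)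
  then have "compact S"
    unfolding S_def by (intro compact_Int_closed[OF compact_finite_span_cball] assms)
  then obtain F where F: "F \<subseteq> S" "finite F" "S \<subseteq> (\<Union>m\<in>F. ball m \<delta>)"
    using \<delta>(1) by (elim compactE_image[of S S "\<lambda>m. ball m \<delta>"]) auto
  have "\<exists>\<eta>. norm \<eta> \<le> 1 \<and> 1 - \<delta> < cmod (cblinfun_apply m \<eta>)" if "m \<in> F" for m
  proof -
    have "norm m = 1"
      using that F(1) by (auto simp: S_def)
    with \<delta>(1) have "1 - \<delta> < norm m" by simp
    then show ?thesis
      by (rule cblinfun_norm_approx) blast
  qed
  then obtain \<eta> where \<eta>: "\<And>m. m \<in> F \<Longrightarrow> norm (\<eta> m) \<le> 1"
    "\<And>m. m \<in> F \<Longrightarrow> 1 - \<delta> < cmod (cblinfun_apply m (\<eta> m))" by metis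
  show thesis
  proof (rule that[of "insert 0 (\<eta> ` F)"])
    fix m K assume m: "m \<in> ?M" and K: "\<And>\<xi>. \<xi> \<in> insert 0 (\<eta> ` F) \<Longrightarrow> cmod (cblinfun_apply m \<xi>) \<le> K"
    show "norm m \<le> (1 + \<epsilon>) * K"
    proof (cases "m = 0")
      case True
      then show ?thesis using K[of 0] \<epsilon> by simp
    next
      case False
      define m' where "m' = complex_of_real (inverse (norm m)) *\<^sub>C m"
      have "m' \<in> S"
        using m False by (auto simp: S_def m'_def norm_scaleC complex_vector.span_scale norm_inverse)
      then obtain f where f: "f \<in> F" "dist f m' < \<delta>"
        using F(3) by auto
      have "cmod (cblinfun_apply (f - m') (\<eta> f)) \<le> norm (f - m') * norm (\<eta> f)"
        by (rule cblinfun_norm)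
      also have "\<dots> \<le> \<delta> * 1"
        using f \<eta>(1)[OF f(1)] \<delta>(1) by (intro mult_mono) (auto simp: dist_norm)
      finally have "cmod (cblinfun_apply f (\<eta> f) - cblinfun_apply m' (\<eta> f)) \<le> \<delta>" by simp
      then have "1 - 2 * \<delta> \<le> cmod (cblinfun_apply m' (\<eta> f))"
        using \<eta>(2)[OF f(1)] norm_triangle_ineq2[of "cblinfun_apply f (\<eta> f)" "cblinfun_apply m' (\<eta> f)"]
        by linarith
      also have "\<dots> = inverse (norm m) * cmod (cblinfun_apply m (\<eta> f))"
        by (simp add: m'_def norm_mult norm_inverse)
      also have "\<dots> \<le> inverse (norm m) * K"
        using K[of "\<eta> f"] f by (intro mult_left_mono) auto
      finally have "(1 - 2 * \<delta>) * norm m \<le> K"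
        using False by (simp add: field_simps)
      then have "(1 + \<epsilon>) * ((1 - 2 * \<delta>) * norm m) \<le> (1 + \<epsilon>) * K"
        using \<epsilon> by (intro mult_left_mono) auto
      then show ?thesis
        unfolding mult.assoc[symmetric] \<delta>(2) by simp
    qed
  qed (use F \<eta> in auto)
qed


section \<open>Bounded multilinear forms\<close>

text \<open>Compared with \<open>symmetric_form\<close>, neither symmetry nor the value 0 on lists of a different
  length is required: fixing some arguments of a form, or extending it to the bidual, preserves this
  weaker notion.\<close>

definition multilinear_form :: "nat \<Rightarrow> ('a::complex_normed_vector list \<Rightarrow> complex) \<Rightarrow> bool"
  where "multilinear_form n A \<longleftrightarrow>
    (\<forall>us vs x y. length us + 1 + length vs = n \<longrightarrow>
       A (us @ (x + y) # vs) = A (us @ x # vs) + A (us @ y # vs)) \<and>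
    (\<forall>us vs c x. length us + 1 + length vs = n \<longrightarrow>
       A (us @ (c *\<^sub>C x) # vs) = c * A (us @ x # vs)) \<and>
    (\<exists>C. \<forall>xs. length xs = n \<longrightarrow> cmod (A xs) \<le> C * prod_list (map norm xs))"

lemma symmetric_form_multilinear: "symmetric_form n A \<Longrightarrow> multilinear_form n A"
  unfolding symmetric_form_def multilinear_form_def by blast

lemma symmetric_form_mset: "symmetric_form n A \<Longrightarrow> length xs = n \<Longrightarrow> mset xs = mset ys \<Longrightarrow> A xs = A ys"
  unfolding symmetric_form_def by blast

lemma symmetric_form_outside: "symmetric_form n A \<Longrightarrow> length xs \<noteq> n \<Longrightarrow> A xs = 0"
  unfolding symmetric_form_def by blast

lemma multilinear_form_bound:
  assumes "multilinear_form n A"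
  obtains C where "C \<ge> 0" "\<And>xs. length xs = n \<Longrightarrow> cmod (A xs) \<le> C * prod_list (map norm xs)"
proof -
  obtain C where C: "\<And>xs. length xs = n \<Longrightarrow> cmod (A xs) \<le> C * prod_list (map norm xs)"
    using assms unfolding multilinear_form_def by blast
  have "cmod (A xs) \<le> \<bar>C\<bar> * prod_list (map norm xs)" if "length xs = n" for xs
  proof -
    have "0 \<le> prod_list (map norm xs)"
      by (rule prod_list_nonneg) auto
    then have "C * prod_list (map norm xs) \<le> \<bar>C\<bar> * prod_list (map norm xs)"
      by (intro mult_right_mono) auto
    with C[OF that] show ?thesis by simp
  qed
  then show thesis by (intro that[of "\<bar>C\<bar>"]) auto
qed

lemma multilinear_form_add_at:
  "multilinear_form n A \<Longrightarrow> length us + 1 + length vs = n \<Longrightarrow>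
    A (us @ (x + y) # vs) = A (us @ x # vs) + A (us @ y # vs)"
  unfolding multilinear_form_def by blast

lemma multilinear_form_scale_at:
  "multilinear_form n A \<Longrightarrow> length us + 1 + length vs = n \<Longrightarrow>
    A (us @ (c *\<^sub>C x) # vs) = c * A (us @ x # vs)"
  unfolding multilinear_form_def by blast

lemma multilinear_form_add_head:
  "multilinear_form (Suc n) A \<Longrightarrow> length vs = n \<Longrightarrow> A ((x + y) # vs) = A (x # vs) + A (y # vs)"
  using multilinear_form_add_at[of "Suc n" A "[]" vs] by simp

lemma multilinear_form_scale_head:
  "multilinear_form (Suc n) A \<Longrightarrow> length vs = n \<Longrightarrow> A ((c *\<^sub>C x) # vs) = c * A (x # vs)"
  using multilinear_form_scale_at[of "Suc n" A "[]" vs] by simp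

lemma multilinear_form_Cons:
  fixes A :: "'a::complex_normed_vector list \<Rightarrow> complex"
  assumes A: "multilinear_form (Suc n) A"
  shows "multilinear_form n (\<lambda>xs. A (x # xs))"
  unfolding multilinear_form_def
proof (intro conjI allI impI)
  fix us vs :: "'a list" and y z assume "length us + 1 + length vs = n"
  then show "A (x # us @ (y + z) # vs) = A (x # us @ y # vs) + A (x # us @ z # vs)"
    using multilinear_form_add_at[OF A, of "x # us" vs y z] by simp
next
  fix us vs :: "'a list" and c y assume "length us + 1 + length vs = n"
  then show "A (x # us @ (c *\<^sub>C y) # vs) = c * A (x # us @ y # vs)"
    using multilinear_form_scale_at[OF A, of "x # us" vs c y] by simp
next
  obtain C where "C \<ge> 0" and C: "\<And>xs. length xs = Suc n \<Longrightarrow> cmod (A xs) \<le> C * prod_list (map norm xs)"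
    using multilinear_form_bound[OF A] by blast
  show "\<exists>C. \<forall>xs. length xs = n \<longrightarrow> cmod (A (x # xs)) \<le> C * prod_list (map norm xs)"
    using C[of "x # _"] by (intro exI[of _ "C * norm x"]) (simp add: mult.assoc)
qed

lemma symmetric_form_Cons:
  assumes A: "symmetric_form (Suc n) A"
  shows "symmetric_form n (\<lambda>xs. A (x # xs))"
proof -
  have "A (x # xs) = A (x # ys)" if "length xs = n" "mset xs = mset ys" for xs ys
    using that by (intro symmetric_form_mset[OF A]) auto
  moreover have "A (x # xs) = 0" if "length xs \<noteq> n" for xs
    using that by (intro symmetric_form_outside[OF A]) auto
  ultimately show ?thesis
    using multilinear_form_Cons[OF symmetric_form_multilinear[OF A], of x]
    unfolding symmetric_form_def multilinear_form_def by blast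
qed

lemma multilinear_form_lincomb:
  fixes A B :: "'a::complex_normed_vector list \<Rightarrow> complex"
  assumes A: "multilinear_form n A" and B: "multilinear_form n B"
  shows "multilinear_form n (\<lambda>xs. A xs + c * B xs)"
proof -
  obtain C where "C \<ge> 0" and C: "\<And>xs. length xs = n \<Longrightarrow> cmod (A xs) \<le> C * prod_list (map norm xs)"
    using multilinear_form_bound[OF A] by blast
  obtain D where "D \<ge> 0" and D: "\<And>xs. length xs = n \<Longrightarrow> cmod (B xs) \<le> D * prod_list (map norm xs)"
    using multilinear_form_bound[OF B] by blast
  have "cmod (A xs + c * B xs) \<le> (C + cmod c * D) * prod_list (map norm xs)" if "length xs = n" for xs
  proof -
    have "cmod (A xs + c * B xs) \<le> cmod (A xs) + cmod c * cmod (B xs)"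
      by (rule order_trans[OF norm_triangle_ineq]) (simp add: norm_mult)
    also have "\<dots> \<le> C * prod_list (map norm xs) + cmod c * (D * prod_list (map norm xs))"
      by (intro add_mono mult_left_mono C D that) simp
    finally show ?thesis by (simp add: algebra_simps)
  qed
  then have "\<exists>C. \<forall>xs. length xs = n \<longrightarrow> cmod (A xs + c * B xs) \<le> C * prod_list (map norm xs)"
    by blast
  note bound = this
  show ?thesis
    unfolding multilinear_form_def
  proof (intro conjI allI impI bound)
    fix us vs :: "'a list" and x y a assume l: "length us + 1 + length vs = n"
    show "A (us @ (x + y) # vs) + c * B (us @ (x + y) # vs)
        = A (us @ x # vs) + c * B (us @ x # vs) + (A (us @ y # vs) + c * B (us @ y # vs))"
      unfolding multilinear_form_add_at[OF A l] multilinear_form_add_at[OF B l]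
      by (simp add: algebra_simps)
    show "A (us @ (a *\<^sub>C x) # vs) + c * B (us @ (a *\<^sub>C x) # vs)
        = a * (A (us @ x # vs) + c * B (us @ x # vs))"
      unfolding multilinear_form_scale_at[OF A l] multilinear_form_scale_at[OF B l]
      by (simp add: algebra_simps)
  qed
qed

lemma symmetric_form_lincomb:
  assumes A: "symmetric_form n A" and B: "symmetric_form n B"
  shows "symmetric_form n (\<lambda>xs. A xs + c * B xs)"
proof -
  have "A xs + c * B xs = A ys + c * B ys" if "length xs = n" "mset xs = mset ys" for xs ys
    using symmetric_form_mset[OF A that] symmetric_form_mset[OF B that] by simp
  moreover have "A xs + c * B xs = 0" if "length xs \<noteq> n" for xs
    using symmetric_form_outside[OF A that] symmetric_form_outside[OF B that] by simp
  ultimately show ?thesis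
    using multilinear_form_lincomb[OF symmetric_form_multilinear[OF A] symmetric_form_multilinear[OF B], of c]
    unfolding symmetric_form_def multilinear_form_def by blast
qed

lemma multilinear_form_head_functional:
  assumes A: "multilinear_form (Suc n) A" and vs: "length vs = n"
  obtains \<psi> where "\<And>x. cblinfun_apply \<psi> x = A (x # vs)"
proof -
  obtain C where "C \<ge> 0" and C: "\<And>xs. length xs = Suc n \<Longrightarrow> cmod (A xs) \<le> C * prod_list (map norm xs)"
    using multilinear_form_bound[OF A] by blast
  obtain \<psi> where "cblinfun_apply \<psi> = (\<lambda>x. A (x # vs))"
  proof (rule ex_cblinfun[of "\<lambda>x. A (x # vs)" "C * prod_list (map norm vs)"])
    show "norm (A (x # vs)) \<le> C * prod_list (map norm vs) * norm x" for x
      using C[of "x # vs"] vs by (simp add: mult_ac)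
  qed (use multilinear_form_add_head[OF A vs] multilinear_form_scale_head[OF A vs] in auto)
  then show thesis by (intro that[of \<psi>]) simp
qed


subsection \<open>Differentiation along the diagonal\<close>

text \<open>The derivative of \<open>z \<mapsto> A (z, \<dots>, z)\<close> in the direction \<open>h\<close>, by the product rule: \<open>h\<close> is
  put in place of each argument in turn.\<close>

fun diagonal_derivative ::
  "('a::complex_normed_vector list \<Rightarrow> complex) \<Rightarrow> nat \<Rightarrow> 'a \<Rightarrow> 'a \<Rightarrow> complex"
  where
    "diagonal_derivative A 0 z h = 0"
  | "diagonal_derivative A (Suc k) z h =
      A (h # replicate k z) + diagonal_derivative (\<lambda>xs. A (z # xs)) k z h"

lemma diagonal_derivative_add:
  "multilinear_form k A \<Longrightarrow>
    diagonal_derivative A k z (h + h') = diagonal_derivative A k z h + diagonal_derivative A k z h'"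
  by (induction k arbitrary: A) (auto simp: multilinear_form_add_head multilinear_form_Cons)

lemma diagonal_derivative_symmetric:
  "symmetric_form k A \<Longrightarrow> diagonal_derivative A k z h = of_nat k * A (h # replicate (k - 1) z)"
proof (induction k arbitrary: A)
  case (Suc k)
  show ?case
  proof (cases k)
    case (Suc m)
    have "A (z # h # replicate m z) = A (h # z # replicate m z)"
      using Suc by (intro symmetric_form_mset[OF Suc.prems]) auto
    then show ?thesis
      using Suc.IH[OF symmetric_form_Cons[OF Suc.prems], of z] Suc by (simp add: algebra_simps)
  qed simp
qed simp

text \<open>Linearity in the first argument writes the function as \<open>A (z, \<dots>) + t A (h, \<dots>)\<close>, where the
  induction hypothesis applies to both forms in the other arguments.\<close>

lemma has_field_derivative_diagonal_0:
  "multilinear_form k A \<Longrightarrow>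
    ((\<lambda>t. A (replicate k (z + t *\<^sub>C h))) has_field_derivative diagonal_derivative A k z h) (at 0)"
proof (induction k arbitrary: A)
  case (Suc k)
  note lin = multilinear_form_add_head[OF Suc.prems] multilinear_form_scale_head[OF Suc.prems]
  have "((\<lambda>t. A (z # replicate k (z + t *\<^sub>C h)) + t * A (h # replicate k (z + t *\<^sub>C h)))
      has_field_derivative
        diagonal_derivative (\<lambda>xs. A (z # xs)) k z h
        + (0 * diagonal_derivative (\<lambda>xs. A (h # xs)) k z h + 1 * A (h # replicate k (z + 0 *\<^sub>C h)))) (at 0)"
    by (intro DERIV_add DERIV_mult' DERIV_ident Suc.IH multilinear_form_Cons Suc.prems)
  then show ?case
    by (simp add: lin add.commute)
qed simp

lemma has_field_derivative_diagonal:
  assumes A: "multilinear_form k A"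
  shows "((\<lambda>t. A (replicate k (z + t *\<^sub>C h))) has_field_derivative
    diagonal_derivative A k (z + t0 *\<^sub>C h) h) (at t0)"
proof -
  have "((\<lambda>t. A (replicate k ((z + t0 *\<^sub>C h) + t *\<^sub>C h))) has_field_derivative
    diagonal_derivative A k (z + t0 *\<^sub>C h) h) (at (t0 - t0))"
    using has_field_derivative_diagonal_0[OF A] by simp
  then have "((\<lambda>t. A (replicate k ((z + t0 *\<^sub>C h) + (t - t0) *\<^sub>C h))) has_field_derivative
    diagonal_derivative A k (z + t0 *\<^sub>C h) h) (at t0)"
    using DERIV_shift[of "\<lambda>t. A (replicate k ((z + t0 *\<^sub>C h) + t *\<^sub>C h))" _ t0 "- t0"] by simp
  moreover have "z + t0 *\<^sub>C h + (t - t0) *\<^sub>C h = z + t *\<^sub>C h" for t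
    by (simp add: complex_vector.scale_left_diff_distrib)
  ultimately show ?thesis by simp
qed

text \<open>A symmetric form is determined by its values on the diagonal: differentiating
  \<open>A (x, \<dots>, x) = 0\<close> in the direction \<open>h\<close> gives \<open>A (h, x, \<dots>, x) = 0\<close>, and one argument after the
  other becomes free.\<close>

lemma polarization:
  assumes "symmetric_form k A" "\<And>x. A (replicate k x) = 0"
  shows "A xs = 0"
proof (cases "length xs = k")
  case True
  then show ?thesis
    using assms
  proof (induction k arbitrary: A xs)
    case (Suc k)
    obtain h ys where xs: "xs = h # ys" "length ys = k"
      using Suc.prems(1) by (auto simp: length_Suc_conv)
    have "A (h # replicate k z) = 0" for z
    proof -
      have "((\<lambda>t. A (replicate (Suc k) (z + t *\<^sub>C h))) has_field_derivative
          diagonal_derivative A (Suc k) z h) (at 0)"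
        by (rule has_field_derivative_diagonal_0) (rule symmetric_form_multilinear[OF Suc.prems(2)])
      moreover have "((\<lambda>t. A (replicate (Suc k) (z + t *\<^sub>C h))) has_field_derivative 0) (at 0)"
        using Suc.prems(3) by simp
      ultimately have "diagonal_derivative A (Suc k) z h = 0"
        by (rule DERIV_unique)
      then have "of_nat (Suc k) * A (h # replicate k z) = 0"
        unfolding diagonal_derivative_symmetric[OF Suc.prems(2)] by simp
      then show ?thesis
        using of_nat_neq_0[of k] by (metis mult_eq_0_iff)
    qed
    then have "A (h # ys) = 0"
      by (rule Suc.IH[of ys "\<lambda>xs. A (h # xs)", OF xs(2) symmetric_form_Cons[OF Suc.prems(2)]])
    then show ?case by (simp add: xs)
  qed simp
qed (simp add: symmetric_form_outside[OF assms(1)])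


section \<open>The Aron--Berner extension of a multilinear form\<close>

lemma weak_star_trace_tendsto:
  "(cblinfun_apply \<phi> \<longlongrightarrow> cblinfun_apply z \<phi>) (weak_star_trace z)"
proof -
  have "weak_star_trace z \<le> filtercomap (cblinfun_apply \<phi>) (nhds (cblinfun_apply z \<phi>))"
    unfolding weak_star_trace_def by (rule INF_lower[OF UNIV_I])
  then show ?thesis
    by (simp only: filterlim_iff_le_filtercomap)
qed

text \<open>A neighbourhood involves finitely many functionals, and there is a point of the space at which
  these have the same values as at \<open>z\<close>.\<close>

lemma weak_star_trace_neq_bot:
  fixes z :: "'a::complex_normed_vector bidual"
  shows "weak_star_trace z \<noteq> bot"
  unfolding trivial_limit_def
proof
  assume "eventually (\<lambda>x. False) (weak_star_trace z)"
  then have "\<exists>X\<subseteq>UNIV. finite X \<and>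
    eventually (\<lambda>x. False) (INF \<phi>\<in>X. filtercomap (cblinfun_apply \<phi>) (nhds (cblinfun_apply z \<phi>)))"
    unfolding weak_star_trace_def by (subst (asm) eventually_INF)
  then obtain X where X: "finite X"
    "eventually (\<lambda>x. False) (INF \<phi>\<in>X. filtercomap (cblinfun_apply \<phi>) (nhds (cblinfun_apply z \<phi>)))"
    by (elim exE conjE)
  obtain x where x: "\<And>\<phi>. \<phi> \<in> X \<Longrightarrow> cblinfun_apply \<phi> x = cblinfun_apply z \<phi>"
  proof (rule local_reflexivity[of "{()}" "{} :: unit set" X "\<lambda>l i. 1" "\<lambda>i. z" "\<lambda>l. 1"])
    fix x :: "unit \<Rightarrow> 'a"
    assume "\<And>i \<phi>. i \<in> {()} \<Longrightarrow> \<phi> \<in> X \<Longrightarrow> cblinfun_apply \<phi> (x i) = cblinfun_apply z \<phi>"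
    then show thesis by (intro that[of "x ()"]) blast
  qed (use X(1) in simp_all)
  have "principal {x} \<le> (INF \<phi>\<in>X. filtercomap (cblinfun_apply \<phi>) (nhds (cblinfun_apply z \<phi>)))"
  proof (rule INF_greatest)
    fix \<phi> assume "\<phi> \<in> X"
    then show "principal {x} \<le> filtercomap (cblinfun_apply \<phi>) (nhds (cblinfun_apply z \<phi>))"
      using x[of \<phi>] unfolding le_filter_def eventually_principal eventually_filtercomap
      by (metis eventually_nhds_x_imp_x singletonD)
  qed
  with X(2) show False
    by (auto simp: le_filter_def eventually_principal)
qed

lemma AB_form_cong:
  "(\<And>xs. length xs = length zs \<Longrightarrow> A xs = B xs) \<Longrightarrow> AB_form A zs = AB_form B zs"
proof (induction zs arbitrary: A B)
  case (Cons z zs)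
  then have "AB_form (\<lambda>xs. A (x # xs)) zs = AB_form (\<lambda>xs. B (x # xs)) zs" for x
    by (intro Cons.IH) auto
  then show ?case by simp
qed simp

text \<open>The outermost limit is the limit of a bounded functional on the space, so it exists and is
  the value of \<open>z\<close> at this functional.\<close>

lemma AB_form_Cons:
  assumes "\<And>x. cblinfun_apply \<psi> x = AB_form (\<lambda>xs. A (x # xs)) zs"
  shows "AB_form A (z # zs) = cblinfun_apply z \<psi>"
proof -
  have "cblinfun_apply \<psi> = (\<lambda>x. AB_form (\<lambda>xs. A (x # xs)) zs)"
    using assms by blast
  with weak_star_trace_tendsto[of \<psi> z]
  have "((\<lambda>x. AB_form (\<lambda>xs. A (x # xs)) zs) \<longlongrightarrow> cblinfun_apply z \<psi>) (weak_star_trace z)"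
    by (simp only:)
  then show ?thesis
    using tendsto_Lim[OF weak_star_trace_neq_bot] by simp
qed

declare AB_form.simps(2) [simp del]

text \<open>Isolated from the induction below because the functional of the first argument is needed both
  there and for the result of it; \<open>lin\<close> and \<open>bound\<close> are the induction hypotheses.\<close>

lemma AB_form_head_functional_aux:
  assumes F: "multilinear_form (Suc (length zs)) F"
    and lin: "\<And>F G c. multilinear_form (length zs) F \<Longrightarrow> multilinear_form (length zs) G \<Longrightarrow>
      AB_form (\<lambda>xs. F xs + c * G xs) zs = AB_form F zs + c * AB_form G zs"
    and bound: "\<And>F C. multilinear_form (length zs) F \<Longrightarrow>
      (\<And>xs. length xs = length zs \<Longrightarrow> cmod (F xs) \<le> C * prod_list (map norm xs)) \<Longrightarrow>
      cmod (AB_form F zs) \<le> \<bar>C\<bar> * prod_list (map norm zs)"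
  shows "\<exists>\<psi>. (\<forall>x. cblinfun_apply \<psi> x = AB_form (\<lambda>xs. F (x # xs)) zs) \<and>
    (\<forall>C. (\<forall>xs. length xs = Suc (length zs) \<longrightarrow> cmod (F xs) \<le> C * prod_list (map norm xs)) \<longrightarrow>
      norm \<psi> \<le> \<bar>C\<bar> * prod_list (map norm zs))"
proof -
  have tail: "multilinear_form (length zs) (\<lambda>xs. F (x # xs))" for x
    by (rule multilinear_form_Cons[OF F])
  have F_bound: "cmod (AB_form (\<lambda>xs. F (x # xs)) zs) \<le> \<bar>C\<bar> * prod_list (map norm zs) * norm x"
    if C: "\<And>xs. length xs = Suc (length zs) \<Longrightarrow> cmod (F xs) \<le> C * prod_list (map norm xs)" for C x
    using bound[OF tail[of x], of "C * norm x"] C[of "x # _"] by (simp add: abs_mult mult_ac)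
  obtain C where C: "\<And>xs. length xs = Suc (length zs) \<Longrightarrow> cmod (F xs) \<le> C * prod_list (map norm xs)"
    using multilinear_form_bound[OF F] by blast
  obtain \<psi> where \<psi>: "cblinfun_apply \<psi> = (\<lambda>x. AB_form (\<lambda>xs. F (x # xs)) zs)"
  proof (rule ex_cblinfun[OF _ _ F_bound[OF C]])
    fix x y
    have "AB_form (\<lambda>xs. F ((x + y) # xs)) zs = AB_form (\<lambda>xs. F (x # xs) + 1 * F (y # xs)) zs"
      by (rule AB_form_cong) (simp add: multilinear_form_add_head[OF F])
    then show "AB_form (\<lambda>xs. F ((x + y) # xs)) zs
        = AB_form (\<lambda>xs. F (x # xs)) zs + AB_form (\<lambda>xs. F (y # xs)) zs"
      using lin[OF tail[of x] tail[of y], of 1] by simp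
  next
    fix c x
    have "AB_form (\<lambda>xs. F ((c *\<^sub>C x) # xs)) zs = AB_form (\<lambda>xs. F (x # xs) + (c - 1) * F (x # xs)) zs"
      by (rule AB_form_cong) (simp add: multilinear_form_scale_head[OF F] algebra_simps)
    then show "AB_form (\<lambda>xs. F ((c *\<^sub>C x) # xs)) zs = c *\<^sub>C AB_form (\<lambda>xs. F (x # xs)) zs"
      using lin[OF tail[of x] tail[of x], of "c - 1"] by (simp add: algebra_simps)
  qed blast
  have "norm \<psi> \<le> \<bar>C\<bar> * prod_list (map norm zs)"
    if "\<And>xs. length xs = Suc (length zs) \<Longrightarrow> cmod (F xs) \<le> C * prod_list (map norm xs)" for C
    using F_bound[OF that] by (intro cblinfun_norm_le) (auto simp: \<psi> intro!: mult_nonneg_nonneg prod_list_nonneg)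
  with \<psi> show ?thesis by (intro exI[of _ \<psi>]) auto
qed

text \<open>Linearity and the bound have to be proved together: both are needed for the remaining
  arguments to know that the first argument enters through a bounded functional.\<close>

lemma AB_form_lincomb_bound:
  assumes "multilinear_form (length zs) A" "multilinear_form (length zs) B"
  shows "AB_form (\<lambda>xs. A xs + c * B xs) zs = AB_form A zs + c * AB_form B zs \<and>
    (\<forall>C. (\<forall>xs. length xs = length zs \<longrightarrow> cmod (A xs) \<le> C * prod_list (map norm xs)) \<longrightarrow>
       cmod (AB_form A zs) \<le> \<bar>C\<bar> * prod_list (map norm zs))"
  using assms
proof (induction zs arbitrary: A B c)
  case Nil
  then show ?case by (auto intro: order_trans)
next
  case (Cons z zs)
  let ?n = "length zs"
  have tail: "multilinear_form ?n (\<lambda>xs. F (x # xs))" if "multilinear_form (Suc ?n) F"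
    for F :: "'a list \<Rightarrow> complex" and x
    by (rule multilinear_form_Cons[OF that])
  have IH_lin: "AB_form (\<lambda>xs. F xs + c * G xs) zs = AB_form F zs + c * AB_form G zs"
    if "multilinear_form ?n F" "multilinear_form ?n G" for F G c
    using Cons.IH[OF that] by blast
  have IH_bound: "cmod (AB_form F zs) \<le> \<bar>C\<bar> * prod_list (map norm zs)"
    if "multilinear_form ?n F" "\<And>xs. length xs = ?n \<Longrightarrow> cmod (F xs) \<le> C * prod_list (map norm xs)" for F C
    using Cons.IH[OF that(1) that(1)] that(2) by blast
  have A: "multilinear_form (Suc ?n) A" and B: "multilinear_form (Suc ?n) B"
    using Cons.prems by simp_all
  obtain \<psi> where \<psi>: "\<And>x. cblinfun_apply \<psi> x = AB_form (\<lambda>xs. A (x # xs)) zs"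
    "\<And>C. (\<And>xs. length xs = Suc ?n \<Longrightarrow> cmod (A xs) \<le> C * prod_list (map norm xs)) \<Longrightarrow>
        norm \<psi> \<le> \<bar>C\<bar> * prod_list (map norm zs)"
    using AB_form_head_functional_aux[OF A IH_lin IH_bound] by blast
  obtain \<theta> where \<theta>: "\<And>x. cblinfun_apply \<theta> x = AB_form (\<lambda>xs. B (x # xs)) zs"
    using AB_form_head_functional_aux[OF B IH_lin IH_bound] by blast
  have "AB_form (\<lambda>xs. A xs + c * B xs) (z # zs) = cblinfun_apply z (\<psi> + c *\<^sub>C \<theta>)"
    by (rule AB_form_Cons) (simp add: \<psi> \<theta> IH_lin tail A B)
  moreover have "cmod (AB_form A (z # zs)) \<le> \<bar>C\<bar> * prod_list (map norm (z # zs))"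
    if "\<And>xs. length xs = Suc ?n \<Longrightarrow> cmod (A xs) \<le> C * prod_list (map norm xs)" for C
  proof -
    have "cmod (cblinfun_apply z \<psi>) \<le> norm z * norm \<psi>"
      by (rule cblinfun_norm)
    also have "\<dots> \<le> norm z * (\<bar>C\<bar> * prod_list (map norm zs))"
      using \<psi>(2)[OF that] by (intro mult_left_mono) auto
    finally show ?thesis
      using AB_form_Cons[of \<psi> A zs z] \<psi>(1) by (simp add: mult_ac)
  qed
  ultimately show ?case
    using AB_form_Cons[of \<psi> A zs z] AB_form_Cons[of \<theta> B zs z] \<psi>(1) \<theta> by simp
qed

lemma AB_form_lincomb:
  "multilinear_form (length zs) A \<Longrightarrow> multilinear_form (length zs) B \<Longrightarrow>
    AB_form (\<lambda>xs. A xs + c * B xs) zs = AB_form A zs + c * AB_form B zs"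
  by (rule AB_form_lincomb_bound[THEN conjunct1])

lemma AB_form_bound:
  assumes "multilinear_form (length zs) A" "C \<ge> 0"
    "\<And>xs. length xs = length zs \<Longrightarrow> cmod (A xs) \<le> C * prod_list (map norm xs)"
  shows "cmod (AB_form A zs) \<le> C * prod_list (map norm zs)"
  using AB_form_lincomb_bound[OF assms(1) assms(1), THEN conjunct2, rule_format, OF assms(3)] assms(2)
  by simp

lemma AB_form_head_functional:
  fixes A :: "'a::complex_normed_vector list \<Rightarrow> complex"
  assumes A: "multilinear_form (Suc (length zs)) A"
  obtains \<psi> where "\<And>x. cblinfun_apply \<psi> x = AB_form (\<lambda>xs. A (x # xs)) zs"
    "\<And>z. AB_form A (z # zs) = cblinfun_apply z \<psi>"
proof -
  have "\<exists>\<psi>. (\<forall>x. cblinfun_apply \<psi> x = AB_form (\<lambda>xs. A (x # xs)) zs) \<and>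
    (\<forall>C. (\<forall>xs. length xs = Suc (length zs) \<longrightarrow> cmod (A xs) \<le> C * prod_list (map norm xs)) \<longrightarrow>
      norm \<psi> \<le> \<bar>C\<bar> * prod_list (map norm zs))"
  proof (rule AB_form_head_functional_aux[OF A AB_form_lincomb])
    fix F :: "'a list \<Rightarrow> complex" and C assume "multilinear_form (length zs) F"
      "\<And>xs. length xs = length zs \<Longrightarrow> cmod (F xs) \<le> C * prod_list (map norm xs)"
    then show "cmod (AB_form F zs) \<le> \<bar>C\<bar> * prod_list (map norm zs)"
      using AB_form_lincomb_bound[of zs F F] by blast
  qed
  then obtain \<psi> where "\<And>x. cblinfun_apply \<psi> x = AB_form (\<lambda>xs. A (x # xs)) zs" by blast
  then show thesis
    by (intro that[of \<psi>] AB_form_Cons) auto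
qed

lemma multilinear_form_AB_form:
  fixes A :: "'a::complex_normed_vector list \<Rightarrow> complex"
  assumes "multilinear_form n A"
  shows "multilinear_form n (AB_form A)"
proof -
  have lin: "AB_form A (us @ (y + c *\<^sub>C z) # vs) = AB_form A (us @ y # vs) + c * AB_form A (us @ z # vs)"
    if "multilinear_form n A" "length us + 1 + length vs = n" for us vs y z c
    using that
  proof (induction us arbitrary: A n)
    case Nil
    then have "multilinear_form (Suc (length vs)) A" by simp
    then obtain \<psi> where "\<And>x. cblinfun_apply \<psi> x = AB_form (\<lambda>xs. A (x # xs)) vs"
      and "\<And>z. AB_form A (z # vs) = cblinfun_apply z \<psi>"
      by (rule AB_form_head_functional) blast
    then show ?case by simp
  next
    case (Cons u us)
    let ?F = "\<lambda>w. AB_form A (u # us @ w # vs)"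
    have A: "multilinear_form (Suc (length (us @ w # vs))) A" for w
      using Cons.prems by simp
    have "\<exists>\<psi>. (\<forall>x. cblinfun_apply \<psi> x = AB_form (\<lambda>xs. A (x # xs)) (us @ w # vs)) \<and>
        (\<forall>z. AB_form A (z # us @ w # vs) = cblinfun_apply z \<psi>)" for w
      by (rule AB_form_head_functional[OF A[of w]]) blast
    then obtain \<psi> where \<psi>: "\<And>x w. cblinfun_apply (\<psi> w) x = AB_form (\<lambda>xs. A (x # xs)) (us @ w # vs)"
      "\<And>z w. AB_form A (z # us @ w # vs) = cblinfun_apply z (\<psi> w)"
      by metis
    have "\<psi> (y + c *\<^sub>C z) = \<psi> y + c *\<^sub>C \<psi> z"
    proof (rule cblinfun_eqI)
      fix x
      have "AB_form (\<lambda>xs. A (x # xs)) (us @ (y + c *\<^sub>C z) # vs)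
        = AB_form (\<lambda>xs. A (x # xs)) (us @ y # vs) + c * AB_form (\<lambda>xs. A (x # xs)) (us @ z # vs)"
        using multilinear_form_Cons[OF A[of y], of x] by (intro Cons.IH[of "length us + 1 + length vs"]) simp_all
      then show "cblinfun_apply (\<psi> (y + c *\<^sub>C z)) x = cblinfun_apply (\<psi> y + c *\<^sub>C \<psi> z) x"
        by (simp add: \<psi>(1))
    qed
    then show ?case
      by (simp add: \<psi>(2))
  qed
  have zero: "AB_form A (us @ 0 # vs) = 0" if "length us + 1 + length vs = n" for us vs
    using lin[OF assms that, of 0 1 0] by simp
  obtain C where C: "C \<ge> 0" "\<And>xs. length xs = n \<Longrightarrow> cmod (A xs) \<le> C * prod_list (map norm xs)"
    using multilinear_form_bound[OF assms] by blast
  show ?thesis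
    unfolding multilinear_form_def
  proof (intro conjI allI impI)
    fix us vs :: "'a bidual list" and y z assume l: "length us + 1 + length vs = n"
    show "AB_form A (us @ (y + z) # vs) = AB_form A (us @ y # vs) + AB_form A (us @ z # vs)"
      using lin[OF assms l, of y 1 z] by simp
  next
    fix us vs :: "'a bidual list" and c z assume l: "length us + 1 + length vs = n"
    show "AB_form A (us @ (c *\<^sub>C z) # vs) = c * AB_form A (us @ z # vs)"
      using lin[OF assms l, of 0 c z] zero[OF l] by simp
  next
    show "\<exists>C. \<forall>zs. length zs = n \<longrightarrow> cmod (AB_form A zs) \<le> C * prod_list (map norm zs)"
      using AB_form_bound[OF _ C(1)] C(2) assms by (intro exI[of _ C]) auto
  qed
qed

text \<open>Through \<open>S = \<Sum>i. \<phi>\<^sub>i \<otimes> m\<^sub>i\<close> the first argument enters as a combination of the functionals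
  \<open>\<phi>\<^sub>i\<close>, so that the limit replaces each \<open>\<phi>\<^sub>i x\<close> by \<open>z \<phi>\<^sub>i\<close>.\<close>

lemma AB_form_finite_rank:
  fixes \<phi> :: "'i \<Rightarrow> 'a::complex_normed_vector dual" and m :: "'i \<Rightarrow> 'b::complex_normed_vector"
  assumes "multilinear_form (length zs) B"
  shows "AB_form (\<lambda>xs. B (map (\<lambda>x. \<Sum>i\<in>I. cblinfun_apply (\<phi> i) x *\<^sub>C m i) xs)) zs
    = B (map (\<lambda>z. \<Sum>i\<in>I. cblinfun_apply z (\<phi> i) *\<^sub>C m i) zs)"
  using assms
proof (induction zs arbitrary: B)
  case (Cons z zs)
  let ?S = "\<lambda>x. \<Sum>i\<in>I. cblinfun_apply (\<phi> i) x *\<^sub>C m i"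
  let ?T = "\<lambda>z. \<Sum>i\<in>I. cblinfun_apply z (\<phi> i) *\<^sub>C m i"
  have B: "multilinear_form (Suc (length zs)) B"
    using Cons.prems by simp
  obtain \<theta> where \<theta>: "\<And>y. cblinfun_apply \<theta> y = B (y # map ?T zs)"
    using multilinear_form_head_functional[OF B, of "map ?T zs"] by auto
  have "AB_form (\<lambda>xs. B (map ?S xs)) (z # zs) = cblinfun_apply z (\<Sum>i\<in>I. cblinfun_apply \<theta> (m i) *\<^sub>C \<phi> i)"
  proof (rule AB_form_Cons)
    fix x
    have "AB_form (\<lambda>xs. B (?S x # map ?S xs)) zs = B (?S x # map ?T zs)"
      by (rule Cons.IH) (rule multilinear_form_Cons[OF B])
    then show "cblinfun_apply (\<Sum>i\<in>I. cblinfun_apply \<theta> (m i) *\<^sub>C \<phi> i) x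
        = AB_form (\<lambda>xs. B (map ?S (x # xs))) zs"
      by (simp add: cblinfun_sum_apply cblinfun_sum mult.commute flip: \<theta>)
  qed
  also have "\<dots> = cblinfun_apply \<theta> (?T z)"
    by (simp add: cblinfun_sum mult.commute)
  finally show ?case by (simp add: \<theta>)
qed simp


section \<open>Holomorphic functions on normed spaces\<close>

definition complex_differentiable ::
  "('a::complex_normed_vector \<Rightarrow> 'b::complex_normed_vector) \<Rightarrow> 'a \<Rightarrow> bool"
  where "complex_differentiable f x \<longleftrightarrow> (\<exists>D :: ('a, 'b) cblinfun. (f has_derivative cblinfun_apply D) (at x))"

lemma holomorphic_ball_iff: "holomorphic_ball f \<longleftrightarrow> (\<forall>x\<in>ball 0 1. complex_differentiable f x)"
  by (simp add: holomorphic_ball_def complex_differentiable_def)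

definition directional_derivative ::
  "'a::complex_normed_vector \<Rightarrow> ('a \<Rightarrow> complex) \<Rightarrow> 'a \<Rightarrow> complex"
  where "directional_derivative v f x = deriv (\<lambda>t. f (x + t *\<^sub>C v)) 0"

lemma bounded_linear_line: "bounded_linear (\<lambda>t. t *\<^sub>C (v :: 'a::complex_normed_vector))"
  by (rule bounded_linear_intro[where K = "norm v"])
    (simp_all add: scaleC_add_left norm_scaleC scaleR_eq_scaleC scaleC_scaleC)

lemma has_field_derivative_line:
  assumes "(f has_derivative cblinfun_apply (D :: 'a::complex_normed_vector dual)) (at (x + t0 *\<^sub>C v))"
  shows "((\<lambda>t. f (x + t *\<^sub>C v)) has_field_derivative cblinfun_apply D v) (at t0)"
proof -
  have "((\<lambda>t. x + t *\<^sub>C v) has_derivative (\<lambda>t. t *\<^sub>C v)) (at t0)"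
    using has_derivative_add[OF has_derivative_const bounded_linear.has_derivative[OF bounded_linear_line has_derivative_ident]]
    by simp
  from has_derivative_compose[OF this assms]
  have "((\<lambda>t. f (x + t *\<^sub>C v)) has_derivative (\<lambda>t. cblinfun_apply D (t *\<^sub>C v))) (at t0)" .
  then show ?thesis
    by (simp add: has_field_derivative_def mult_commute_abs)
qed

lemma directional_derivative_eq:
  assumes "(f has_derivative cblinfun_apply (D :: 'a::complex_normed_vector dual)) (at x)"
  shows "directional_derivative v f x = cblinfun_apply D v"
  unfolding directional_derivative_def
  using has_field_derivative_line[of f D x 0 v] assms by (simp add: DERIV_imp_deriv)

lemma complex_differentiable_line:
  assumes "complex_differentiable f (x + t0 *\<^sub>C v)"
  shows "((\<lambda>t. f (x + t *\<^sub>C v)) has_field_derivative directional_derivative v f (x + t0 *\<^sub>C v)) (at t0)"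
  using assms has_field_derivative_line directional_derivative_eq
  unfolding complex_differentiable_def by metis

lemma complex_differentiable_continuous: "complex_differentiable f x \<Longrightarrow> isCont f x"
  unfolding complex_differentiable_def by (auto dest: has_derivative_continuous)

lemma directional_derivative_add:
  assumes "complex_differentiable f x"
  shows "directional_derivative (v + w) f x = directional_derivative v f x + directional_derivative w f x"
proof -
  obtain D :: "'a dual" where "(f has_derivative cblinfun_apply D) (at x)"
    using assms unfolding complex_differentiable_def by blast
  then show ?thesis by (simp add: directional_derivative_eq)
qed

lemma directional_derivative_scale:
  assumes "complex_differentiable f x"
  shows "directional_derivative (c *\<^sub>C v) f x = c * directional_derivative v f x"
proof -
  obtain D :: "'a dual" where "(f has_derivative cblinfun_apply D) (at x)"
    using assms unfolding complex_differentiable_def by blast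
  then show ?thesis by (simp add: directional_derivative_eq)
qed

lemma complex_differentiable_lincomb:
  fixes f g :: "'a::complex_normed_vector \<Rightarrow> complex"
  assumes "complex_differentiable f x" "complex_differentiable g x"
  shows "complex_differentiable (\<lambda>y. a * f y + b * g y) x"
    and "directional_derivative v (\<lambda>y. a * f y + b * g y) x
      = a * directional_derivative v f x + b * directional_derivative v g x"
proof -
  obtain D E :: "'a dual" where D: "(f has_derivative cblinfun_apply D) (at x)"
    and E: "(g has_derivative cblinfun_apply E) (at x)"
    using assms unfolding complex_differentiable_def by blast
  have *: "((\<lambda>y. a * f y + b * g y) has_derivative cblinfun_apply (a *\<^sub>C D + b *\<^sub>C E)) (at x)"
    using has_derivative_add[OF has_derivative_mult_right[OF D, of a] has_derivative_mult_right[OF E, of b]]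
    by (simp add: fun_eq_iff)
  then show "complex_differentiable (\<lambda>y. a * f y + b * g y) x"
    unfolding complex_differentiable_def by blast
  show "directional_derivative v (\<lambda>y. a * f y + b * g y) x
      = a * directional_derivative v f x + b * directional_derivative v g x"
    using directional_derivative_eq[OF *] directional_derivative_eq[OF D] directional_derivative_eq[OF E]
    by simp
qed

lemma complex_differentiable_shift:
  fixes f :: "'a::complex_normed_vector \<Rightarrow> complex"
  assumes "complex_differentiable f (x + h)"
  shows "complex_differentiable (\<lambda>y. f (y + h)) x"
    and "directional_derivative v (\<lambda>y. f (y + h)) x = directional_derivative v f (x + h)"
proof -
  obtain D :: "'a dual" where D: "(f has_derivative cblinfun_apply D) (at (x + h))"
    using assms unfolding complex_differentiable_def by blast
  have "((\<lambda>y. y + h) has_derivative (\<lambda>y. y)) (at x)"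
    by (intro derivative_eq_intros | simp)+
  from has_derivative_compose[OF this D]
  have *: "((\<lambda>y. f (y + h)) has_derivative cblinfun_apply D) (at x)" by simp
  then show "complex_differentiable (\<lambda>y. f (y + h)) x"
    unfolding complex_differentiable_def by blast
  show "directional_derivative v (\<lambda>y. f (y + h)) x = directional_derivative v f (x + h)"
    using directional_derivative_eq[OF *] directional_derivative_eq[OF D] by simp
qed


subsection \<open>Cauchy estimates\<close>

lemma Cauchy_estimate_ball:
  assumes g: "g holomorphic_on ball z R" and R: "R > 0" and M: "\<And>t. t \<in> ball z R \<Longrightarrow> cmod (g t) \<le> M"
  shows "cmod ((deriv ^^ n) g z) \<le> fact n * M / R ^ n"
proof -
  let ?c = "cmod ((deriv ^^ n) g z)"
  have "?c * r ^ n \<le> fact n * M" if r: "0 < r" "r < R" for r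
  proof -
    have "continuous_on (cball z r) g"
      by (rule holomorphic_on_imp_continuous_on[OF holomorphic_on_subset[OF g]]) (use r in auto)
    then have "?c \<le> fact n * M / r ^ n"
      using r by (intro Cauchy_inequality holomorphic_on_subset[OF g] M) (auto simp: dist_norm)
    then show ?thesis
      using r by (simp add: pos_le_divide_eq)
  qed
  then have "\<forall>\<^sub>F r in at_left R. ?c * r ^ n \<le> fact n * M"
    using R eventually_at_left_field by (force intro: exI[of _ 0])
  moreover have "((\<lambda>r. ?c * r ^ n) \<longlongrightarrow> ?c * R ^ n) (at_left R)"
    by (intro tendsto_intros)
  ultimately have "?c * R ^ n \<le> fact n * M"
    by (intro tendsto_upperbound[of "\<lambda>r. ?c * r ^ n"]) auto
  then show ?thesis
    using R by (simp add: pos_le_divide_eq)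
qed

text \<open>Taylor's formula on the disc of half the radius, around each point of which a disc of radius
  \<open>R / 4\<close> fits into the given one; this is where the constant comes from.\<close>

lemma quadratic_remainder:
  assumes g: "g holomorphic_on ball 0 R" and R: "R > 0"
    and M: "\<And>t. t \<in> ball 0 R \<Longrightarrow> cmod (g t) \<le> M" and t: "cmod t \<le> R / 2"
  shows "cmod (g t - g 0 - t * deriv g 0) \<le> 32 * M * (cmod t)\<^sup>2 / R\<^sup>2"
proof -
  let ?S = "cball 0 (R / 2) :: complex set"
  have sub: "ball w (R / 4) \<subseteq> ball 0 R" if "w \<in> ?S" for w :: complex
  proof
    fix y assume "y \<in> ball w (R / 4)"
    then show "y \<in> ball 0 R"
      using that norm_triangle_sub[of y w] R by (auto simp: dist_norm norm_minus_commute)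
  qed
  have "cmod ((deriv ^^ 0) g t - (\<Sum>i\<le>1. (deriv ^^ i) g 0 * (t - 0) ^ i / fact i))
    \<le> 32 * M / R\<^sup>2 * cmod (t - 0) ^ Suc 1 / fact 1"
  proof (rule complex_Taylor[of ?S 1 "\<lambda>i. (deriv ^^ i) g"])
    fix i and x :: complex assume "x \<in> ?S"
    then have "x \<in> ball 0 R"
      using R by auto
    then have "((deriv ^^ i) g has_field_derivative deriv ((deriv ^^ i) g) x) (at x)"
      by (intro holomorphic_derivI[OF holomorphic_higher_deriv[OF g]]) auto
    then show "((deriv ^^ i) g has_field_derivative (deriv ^^ Suc i) g x) (at x within ?S)"
      by (simp add: has_field_derivative_at_within)
  next
    fix x :: complex assume x: "x \<in> ?S"
    have "cmod ((deriv ^^ 2) g x) \<le> fact 2 * M / (R / 4) ^ 2"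
      using sub[OF x] R M by (intro Cauchy_estimate_ball holomorphic_on_subset[OF g]) auto
    also have "\<dots> = 32 * M / R\<^sup>2"
      by (simp add: power_divide fact_numeral)
    finally show "cmod ((deriv ^^ Suc 1) g x) \<le> 32 * M / R\<^sup>2"
      by (simp add: numeral_2_eq_2)
  qed (use R t in auto)
  then show ?thesis
    by (simp add: power2_eq_square algebra_simps)
qed

text \<open>The one-variable estimates are applied along unit vectors and then scaled.\<close>

lemma directional_estimates:
  fixes F :: "'a::complex_normed_vector \<Rightarrow> complex"
  assumes \<rho>: "\<rho> > 0" and M: "\<And>y. y \<in> ball x \<rho> \<Longrightarrow> cmod (F y) \<le> M"
    and hol: "\<And>v. norm v = 1 \<Longrightarrow> (\<lambda>t. F (x + t *\<^sub>C v)) holomorphic_on ball 0 \<rho>"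
  shows "directional_derivative (c *\<^sub>C w) F x = c * directional_derivative w F x"
    and "cmod (directional_derivative w F x) \<le> M / \<rho> * norm w"
    and "norm w \<le> \<rho> / 2 \<Longrightarrow>
      cmod (F (x + w) - F x - directional_derivative w F x) \<le> 32 * M / \<rho>\<^sup>2 * (norm w)\<^sup>2"
proof -
  have unit: "\<exists>u. norm u = 1 \<and> w = complex_of_real (norm w) *\<^sub>C u" if "w \<noteq> 0" for w :: 'a
    using that
    by (intro exI[of _ "complex_of_real (inverse (norm w)) *\<^sub>C w"]) (simp add: norm_scaleC norm_inverse scaleC_scaleC)
  have unit_diff: "(\<lambda>t. F (x + t *\<^sub>C u)) field_differentiable at 0" if "norm u = 1" for u
    using hol[OF that] \<rho> by (intro holomorphic_on_imp_differentiable_at[of _ "ball 0 \<rho>"]) auto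
  have scale_unit: "directional_derivative (c *\<^sub>C u) F x = c * directional_derivative u F x"
    if "norm u = 1" for c u
  proof -
    have "((\<lambda>t. F (x + t *\<^sub>C u)) has_field_derivative directional_derivative u F x) (at (c * 0))"
      using unit_diff[OF that] by (simp add: directional_derivative_def field_differentiable_derivI)
    then have "((\<lambda>t. F (x + (c * t) *\<^sub>C u)) has_field_derivative directional_derivative u F x * c) (at 0)"
      using DERIV_chain2[of "\<lambda>t. F (x + t *\<^sub>C u)" _ "\<lambda>t. c * t" 0 c] DERIV_cmult_Id by blast
    then show ?thesis
      unfolding directional_derivative_def
      by (simp add: scaleC_scaleC mult.commute DERIV_imp_deriv directional_derivative_def)
  qed
  have zero: "directional_derivative 0 F x = 0"
    by (simp add: directional_derivative_def)
  show "directional_derivative (c *\<^sub>C w) F x = c * directional_derivative w F x"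
  proof (cases "w = 0")
    case False
    then obtain u where u: "norm u = 1" "w = complex_of_real (norm w) *\<^sub>C u"
      using unit by blast
    have "directional_derivative (c *\<^sub>C complex_of_real (norm w) *\<^sub>C u) F x
        = c * directional_derivative (complex_of_real (norm w) *\<^sub>C u) F x"
      by (simp add: scaleC_scaleC scale_unit[OF u(1)])
    with u(2) show ?thesis by metis
  qed (simp add: zero)
  have M0: "M \<ge> 0"
    using M[of x] \<rho> norm_ge_zero order_trans by (metis centre_in_ball)
  have unit_bound: "cmod (F (x + t *\<^sub>C u)) \<le> M" if "norm u = 1" "t \<in> ball 0 \<rho>" for t u
    using that by (intro M) (simp add: dist_norm norm_scaleC)
  show "cmod (directional_derivative w F x) \<le> M / \<rho> * norm w"
  proof (cases "w = 0")
    case False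
    then obtain u where u: "norm u = 1" "w = complex_of_real (norm w) *\<^sub>C u"
      using unit by blast
    have "cmod (directional_derivative u F x) \<le> M / \<rho>"
      using Cauchy_estimate_ball[OF hol[OF u(1)] \<rho>, of M 1] unit_bound[OF u(1)]
      by (simp add: directional_derivative_def)
    moreover have "directional_derivative w F x = norm w * directional_derivative u F x"
      using scale_unit[OF u(1), of "norm w"] u(2) by simp
    ultimately have "cmod (directional_derivative w F x) \<le> norm w * (M / \<rho>)"
      by (simp add: norm_mult mult_left_mono del: times_divide_eq_right)
    then show ?thesis by (simp only: mult.commute)
  qed (use M0 \<rho> zero in simp)
  show "cmod (F (x + w) - F x - directional_derivative w F x) \<le> 32 * M / \<rho>\<^sup>2 * (norm w)\<^sup>2"
    if w: "norm w \<le> \<rho> / 2"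
  proof (cases "w = 0")
    case False
    then obtain u where u: "norm u = 1" "w = complex_of_real (norm w) *\<^sub>C u"
      using unit by blast
    have "directional_derivative w F x = norm w * directional_derivative u F x"
      using scale_unit[OF u(1), of "norm w"] u(2) by simp
    moreover have "cmod (F (x + complex_of_real (norm w) *\<^sub>C u) - F (x + 0 *\<^sub>C u)
        - complex_of_real (norm w) * deriv (\<lambda>t. F (x + t *\<^sub>C u)) 0)
      \<le> 32 * M * (cmod (complex_of_real (norm w)))\<^sup>2 / \<rho>\<^sup>2"
      by (rule quadratic_remainder[OF hol[OF u(1)] \<rho>]) (use unit_bound[OF u(1)] w in auto)
    ultimately show ?thesis
      using u(2) by (simp add: directional_derivative_def[of u])
  qed (use M0 zero in simp)
qed

text \<open>A locally bounded function that is holomorphic along complex lines is differentiable as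
  soon as its directional derivative is additive: by Cauchy's estimates the remainder of second
  order is uniform in the direction.\<close>

lemma gateaux_imp_complex_differentiable:
  fixes F :: "'a::complex_normed_vector \<Rightarrow> complex"
  assumes \<rho>: "\<rho> > 0" and M: "\<And>y. y \<in> ball x \<rho> \<Longrightarrow> cmod (F y) \<le> M"
    and hol: "\<And>v. norm v = 1 \<Longrightarrow> (\<lambda>t. F (x + t *\<^sub>C v)) holomorphic_on ball 0 \<rho>"
    and add: "\<And>v w. directional_derivative (v + w) F x = directional_derivative v F x + directional_derivative w F x"
  shows "complex_differentiable F x"
proof -
  note est = directional_estimates[OF \<rho> M hol]
  obtain D where D: "cblinfun_apply D = (\<lambda>v. directional_derivative v F x)"
    using ex_cblinfun[of "\<lambda>v. directional_derivative v F x" "M / \<rho>"] add est(1,2)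
    by (metis scaleC_complex)
  have "(F has_derivative cblinfun_apply D) (at x)"
  proof (rule has_derivativeI_sandwich[of "\<rho> / 2"])
    show "((\<lambda>y. 32 * M / \<rho>\<^sup>2 * norm (y - x)) \<longlongrightarrow> 0) (at x)"
      using \<rho> by (auto intro!: tendsto_eq_intros)
    fix y assume y: "y \<noteq> x" "dist y x < \<rho> / 2"
    have "norm (y - x) \<le> \<rho> / 2"
      using y(2) by (simp add: dist_norm)
    then have "cmod (F (x + (y - x)) - F x - cblinfun_apply D (y - x)) \<le> 32 * M / \<rho>\<^sup>2 * (norm (y - x))\<^sup>2"
      unfolding D by - (rule est(3), assumption+)
    then show "norm (F y - F x - cblinfun_apply D (y - x)) / norm (y - x) \<le> 32 * M / \<rho>\<^sup>2 * norm (y - x)"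
      using y(1) by (simp add: pos_divide_le_eq power2_eq_square mult.assoc)
  qed (use \<rho> in \<open>auto simp: cblinfun_bounded_linear\<close>)
  then show ?thesis
    unfolding complex_differentiable_def by blast
qed

lemma complex_differentiable_holomorphic_line:
  assumes "\<And>y. y \<in> ball x \<rho> \<Longrightarrow> complex_differentiable F y" "norm v = 1"
  shows "(\<lambda>t. F (x + t *\<^sub>C v)) holomorphic_on ball 0 \<rho>"
proof -
  have "(\<lambda>t. F (x + t *\<^sub>C v)) field_differentiable at t" if "t \<in> ball 0 \<rho>" for t
  proof -
    have "complex_differentiable F (x + t *\<^sub>C v)"
      using that assms(2) by (intro assms(1)) (simp add: dist_norm norm_scaleC)
    from complex_differentiable_line[OF this] show ?thesis
      by (auto simp: field_differentiable_def)
  qed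
  then show ?thesis
    by (auto simp: holomorphic_on_def intro: field_differentiable_at_within)
qed

lemma complex_differentiable_locally_bounded:
  fixes f :: "'a::complex_normed_vector \<Rightarrow> complex"
  assumes "complex_differentiable f x" "\<rho> > 0"
  obtains \<sigma> where "\<sigma> > 0" "\<sigma> \<le> \<rho>" "\<And>y. y \<in> ball x \<sigma> \<Longrightarrow> cmod (f y) \<le> cmod (f x) + 1"
proof -
  obtain d where d: "d > 0" "\<And>y. dist y x < d \<Longrightarrow> dist (f y) (f x) < 1"
    using complex_differentiable_continuous[OF assms(1)] unfolding continuous_at_eps_delta by (meson zero_less_one)
  have "cmod (f y) \<le> cmod (f x) + 1" if "y \<in> ball x (min d \<rho>)" for y
    using d(2)[of y] that norm_triangle_sub[of "f y" "f x"]
    by (auto simp: dist_norm norm_minus_commute)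
  with d(1) assms(2) show thesis
    by (intro that[of "min d \<rho>"]) auto
qed

text \<open>Along each complex line this is Weierstrass' theorem in one variable, and the additivity of
  the directional derivatives passes to the limit.\<close>

lemma uniform_limit_complex_differentiable:
  fixes F :: "nat \<Rightarrow> 'a::complex_normed_vector \<Rightarrow> complex"
  assumes \<rho>: "\<rho> > 0" and diff: "\<And>n y. y \<in> ball x \<rho> \<Longrightarrow> complex_differentiable (F n) y"
    and lim: "uniform_limit (ball x \<rho>) F G sequentially"
  shows "complex_differentiable G x"
    and "(\<lambda>n. directional_derivative v (F n) x) \<longlonglongrightarrow> directional_derivative v G x"
proof -
  have small: "\<exists>\<sigma>>0. \<forall>t\<in>ball 0 \<sigma>. x + t *\<^sub>C v \<in> ball x \<rho>" for v
  proof (intro exI[of _ "\<rho> / (norm v + 1)"] conjI ballI)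
    show "\<rho> / (norm v + 1) > 0"
      using \<rho> by (simp add: add_nonneg_pos)
    fix t :: complex assume "t \<in> ball 0 (\<rho> / (norm v + 1))"
    then have "cmod t * (norm v + 1) < \<rho>"
      by (simp add: pos_less_divide_eq add_nonneg_pos)
    moreover have "cmod t * norm v \<le> cmod t * (norm v + 1)"
      by (intro mult_left_mono) auto
    ultimately show "x + t *\<^sub>C v \<in> ball x \<rho>"
      by (simp add: dist_norm norm_scaleC)
  qed
  have line_deriv: "((\<lambda>t. F n (x + t *\<^sub>C v)) has_field_derivative directional_derivative v (F n) (x + t *\<^sub>C v)) (at t)"
    if "x + t *\<^sub>C v \<in> ball x \<rho>" for n t v
    by (rule complex_differentiable_line[OF diff[OF that]])
  have line_lim: "\<exists>d>0. cball t d \<subseteq> ball 0 \<sigma> \<and> uniform_limit (cball t d) (\<lambda>n t. F n (x + t *\<^sub>C v)) (\<lambda>t. G (x + t *\<^sub>C v)) sequentially"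
    if in_ball: "\<forall>t\<in>ball 0 \<sigma>. x + t *\<^sub>C v \<in> ball x \<rho>" and t: "t \<in> ball 0 \<sigma>" for \<sigma> v t
  proof -
    obtain d where d: "d > 0" "cball t d \<subseteq> ball 0 \<sigma>"
      using t open_ball open_contains_cball by blast
    have "uniform_limit (cball t d) (\<lambda>n t. F n (x + t *\<^sub>C v)) (\<lambda>t. G (x + t *\<^sub>C v)) sequentially"
      by (rule uniform_limit_compose'[OF lim]) (use d in_ball in auto)
    with d show ?thesis by blast
  qed
  show conv: "(\<lambda>n. directional_derivative v (F n) x) \<longlonglongrightarrow> directional_derivative v G x" for v
  proof -
    obtain \<sigma> where \<sigma>: "\<sigma> > 0" "\<forall>t\<in>ball 0 \<sigma>. x + t *\<^sub>C v \<in> ball x \<rho>"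
      using small[of v] by blast
    have "\<exists>g'. \<forall>t\<in>ball 0 \<sigma>. ((\<lambda>t. G (x + t *\<^sub>C v)) has_field_derivative g' t) (at t) \<and>
        (\<lambda>n. directional_derivative v (F n) (x + t *\<^sub>C v)) \<longlonglongrightarrow> g' t"
      using \<sigma> line_lim[OF \<sigma>(2)] line_deriv
      by (intro has_complex_derivative_uniform_sequence[of _ "\<lambda>n t. F n (x + t *\<^sub>C v)"]) auto
    then obtain g' where "((\<lambda>t. G (x + t *\<^sub>C v)) has_field_derivative g') (at 0)"
      "(\<lambda>n. directional_derivative v (F n) (x + 0 *\<^sub>C v)) \<longlonglongrightarrow> g'"
      using \<sigma>(1) by (metis centre_in_ball)
    then show ?thesis
      by (simp add: directional_derivative_def[of v G] DERIV_imp_deriv)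
  qed
  obtain N where N: "\<And>y. y \<in> ball x \<rho> \<Longrightarrow> dist (F N y) (G y) < 1"
    using uniform_limitD[OF lim zero_less_one] unfolding eventually_sequentially by blast
  have "complex_differentiable (F N) x"
    using \<rho> by (intro diff) simp
  then obtain \<sigma> where \<sigma>: "\<sigma> > 0" "\<sigma> \<le> \<rho>" "\<And>y. y \<in> ball x \<sigma> \<Longrightarrow> cmod (F N y) \<le> cmod (F N x) + 1"
    using complex_differentiable_locally_bounded[OF _ \<rho>] by blast
  show "complex_differentiable G x"
  proof (rule gateaux_imp_complex_differentiable[OF \<sigma>(1)])
    fix y assume y: "y \<in> ball x \<sigma>"
    show "cmod (G y) \<le> cmod (F N x) + 2"
      using N[of y] \<sigma>(2) \<sigma>(3)[OF y] y norm_triangle_sub[of "G y" "F N y"]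
      by (auto simp: dist_norm norm_minus_commute)
  next
    fix v :: 'a assume v: "norm v = 1"
    have ball: "\<forall>t\<in>ball 0 \<sigma>. x + t *\<^sub>C v \<in> ball x \<rho>"
      using v \<sigma>(2) by (auto simp: dist_norm norm_scaleC)
    show "(\<lambda>t. G (x + t *\<^sub>C v)) holomorphic_on ball 0 \<sigma>"
    proof (rule holomorphic_uniform_sequence[of _ "\<lambda>n t. F n (x + t *\<^sub>C v)"])
      show "(\<lambda>t. F n (x + t *\<^sub>C v)) holomorphic_on ball 0 \<sigma>" for n
        using v \<sigma>(2) diff by (intro complex_differentiable_holomorphic_line) auto
    qed (use line_lim[OF ball] in auto)
  next
    fix v w :: 'a
    have "directional_derivative (v + w) (F n) x = directional_derivative v (F n) x + directional_derivative w (F n) x" for n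
      using \<rho> by (intro directional_derivative_add diff) simp
    then have "(\<lambda>n. directional_derivative (v + w) (F n) x) \<longlonglongrightarrow> directional_derivative v G x + directional_derivative w G x"
      using tendsto_add[OF conv[of v] conv[of w]] by simp
    then show "directional_derivative (v + w) G x = directional_derivative v G x + directional_derivative w G x"
      using conv[of "v + w"] LIMSEQ_unique by blast
  qed
qed

text \<open>The derivative in the direction \<open>v\<close> is a locally uniform limit of difference quotients, so
  it is differentiable. Its derivative in the direction \<open>w\<close> is the limit of the difference quotients
  of the derivative in the direction \<open>w\<close>, which is the other mixed derivative.\<close>

lemma complex_differentiable_directional_derivative:
  fixes f :: "'a::complex_normed_vector \<Rightarrow> complex"
  assumes U: "open U" "x \<in> U" and diff: "\<And>y. y \<in> U \<Longrightarrow> complex_differentiable f y"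
  shows "complex_differentiable (directional_derivative v f) x"
    and "directional_derivative w (directional_derivative v f) x = directional_derivative v (directional_derivative w f) x"
proof -
  obtain \<rho>0 where \<rho>0: "\<rho>0 > 0" "ball x \<rho>0 \<subseteq> U"
    using U open_contains_ball by blast
  obtain \<rho> where \<rho>: "\<rho> > 0" "\<rho> \<le> \<rho>0" "\<And>y. y \<in> ball x \<rho> \<Longrightarrow> cmod (f y) \<le> cmod (f x) + 1"
    using complex_differentiable_locally_bounded[OF diff[OF U(2)] \<rho>0(1)] by blast
  have f_diff: "complex_differentiable f y" if "y \<in> ball x \<rho>" for y
    using that \<rho>0(2) \<rho>(2) by (intro diff) auto
  let ?M = "cmod (f x) + 1"
  let ?q = "\<lambda>h v y. inverse h * f (y + h *\<^sub>C v) + (- inverse h) * f y"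
  have est: "cmod (?q h v y - directional_derivative v f y) \<le> 128 * ?M / \<rho>\<^sup>2 * (norm v)\<^sup>2 * cmod h"
    if y: "y \<in> ball x (\<rho> / 2)" and h: "h \<noteq> 0" "cmod h * norm v \<le> \<rho> / 4" for y h v
  proof -
    have sub: "ball y (\<rho> / 2) \<subseteq> ball x \<rho>"
    proof
      fix u assume "u \<in> ball y (\<rho> / 2)"
      then show "u \<in> ball x \<rho>"
        using y dist_triangle[of x u y] by auto
    qed
    have "cmod (f (y + h *\<^sub>C v) - f y - directional_derivative (h *\<^sub>C v) f y) \<le> 32 * ?M / (\<rho> / 2)\<^sup>2 * (norm (h *\<^sub>C v))\<^sup>2"
      using sub \<rho>(1,3) h f_diff
      by (intro directional_estimates complex_differentiable_holomorphic_line) (auto simp: norm_scaleC)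
    also have "directional_derivative (h *\<^sub>C v) f y = h * directional_derivative v f y"
      using y \<rho>(1) by (intro directional_derivative_scale f_diff) auto
    also have "f (y + h *\<^sub>C v) - f y - h * directional_derivative v f y = h * (?q h v y - directional_derivative v f y)"
      using h(1) by (simp add: field_simps)
    finally have "cmod h * cmod (?q h v y - directional_derivative v f y) \<le> 32 * ?M / (\<rho> / 2)\<^sup>2 * (norm (h *\<^sub>C v))\<^sup>2"
      unfolding norm_mult .
    also have "\<dots> = cmod h * (128 * ?M / \<rho>\<^sup>2 * (norm v)\<^sup>2 * cmod h)"
      using \<rho>(1) by (simp add: norm_scaleC power2_eq_square field_simps)
    finally have "cmod h * cmod (?q h v y - directional_derivative v f y) \<le> cmod h * (128 * ?M / \<rho>\<^sup>2 * (norm v)\<^sup>2 * cmod h)" .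
    then show ?thesis
      by (rule mult_left_le_imp_le) (use h(1) in simp)
  qed
  \<comment> \<open>These steps keep \<open>y + h v\<close> in the ball of radius \<open>\<rho>\<close> for \<open>y\<close> in the ball of half the radius.\<close>
  define h where "h v n = complex_of_real (\<rho> / (4 * (norm v + 1)) / real (Suc n))" for v :: 'a and n
  have h: "h v n \<noteq> 0" "cmod (h v n) * norm v \<le> \<rho> / 4" and h_lim: "h v \<longlonglongrightarrow> 0" for v n
  proof -
    have pos: "0 < 4 * (norm v + 1)" "0 < norm v + 1"
      by (simp_all add: add_nonneg_pos)
    have cmod_h: "cmod (h v n) = \<rho> / (4 * (norm v + 1)) / real (Suc n)"
      unfolding h_def norm_of_real using \<rho>(1) pos(1) by (intro abs_of_nonneg divide_nonneg_nonneg) auto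
    have "0 < \<rho> / (4 * (norm v + 1)) / real (Suc n)"
      using \<rho>(1) pos(1) by (intro divide_pos_pos) auto
    then show "h v n \<noteq> 0"
      unfolding h_def of_real_eq_0_iff by linarith
    have "\<rho> / (4 * (norm v + 1)) / real (Suc n) \<le> \<rho> / (4 * (norm v + 1)) / 1"
      using \<rho>(1) pos(1) by (intro divide_left_mono) auto
    then have "cmod (h v n) * norm v \<le> \<rho> / (4 * (norm v + 1)) * (norm v + 1)"
      unfolding cmod_h using \<rho>(1) pos by (intro mult_mono) auto
    also have "\<dots> = \<rho> / 4"
      using pos(2) by (simp add: field_simps)
    finally show "cmod (h v n) * norm v \<le> \<rho> / 4" .
    have "(\<lambda>n. \<rho> / (4 * (norm v + 1)) / real (Suc n)) \<longlonglongrightarrow> 0"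
      by (rule LIMSEQ_Suc[OF lim_const_over_n])
    then show "h v \<longlonglongrightarrow> 0"
      unfolding h_def by (metis of_real_0 tendsto_of_real)
  qed
  have in_ball: "y + h v n *\<^sub>C v \<in> ball x \<rho>" if "y \<in> ball x (\<rho> / 2)" for y v n
  proof -
    have "dist x (y + h v n *\<^sub>C v) \<le> dist x y + norm (h v n *\<^sub>C v)"
      using dist_triangle[of x "y + h v n *\<^sub>C v" y] by (simp add: dist_norm)
    then show ?thesis
      using that h(2)[of v n] \<rho>(1) by (simp add: norm_scaleC)
  qed
  have half: "y \<in> ball x \<rho>" if "y \<in> ball x (\<rho> / 2)" for y
    using that \<rho>(1) by auto
  have q_diff: "complex_differentiable (?q (h v n) v) y"
    and q_deriv: "directional_derivative w (?q (h v n) v) y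
      = inverse (h v n) * directional_derivative w f (y + h v n *\<^sub>C v) + (- inverse (h v n)) * directional_derivative w f y"
    if "y \<in> ball x (\<rho> / 2)" for y v w n
  proof -
    note shift = complex_differentiable_shift[OF f_diff[OF in_ball[OF that]]]
    note lincomb = complex_differentiable_lincomb[OF shift(1) f_diff[OF half[OF that]]]
    show "complex_differentiable (?q (h v n) v) y"
      by (rule lincomb(1))
    show "directional_derivative w (?q (h v n) v) y
      = inverse (h v n) * directional_derivative w f (y + h v n *\<^sub>C v) + (- inverse (h v n)) * directional_derivative w f y"
      unfolding lincomb(2) shift(2) ..
  qed
  have "uniform_limit (ball x (\<rho> / 2)) (\<lambda>n. ?q (h v n) v) (directional_derivative v f) sequentially" for v
  proof (rule uniform_limitI)
    fix e :: real assume "e > 0"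
    have "(\<lambda>n. 128 * ?M / \<rho>\<^sup>2 * (norm v)\<^sup>2 * cmod (h v n)) \<longlonglongrightarrow> 128 * ?M / \<rho>\<^sup>2 * (norm v)\<^sup>2 * cmod 0"
      by (intro tendsto_intros h_lim)
    then have "\<forall>\<^sub>F n in sequentially. 128 * ?M / \<rho>\<^sup>2 * (norm v)\<^sup>2 * cmod (h v n) < e"
      using \<open>e > 0\<close> by (intro order_tendstoD(2)) auto
    then show "\<forall>\<^sub>F n in sequentially. \<forall>y\<in>ball x (\<rho> / 2). dist (?q (h v n) v y) (directional_derivative v f y) < e"
    proof (rule eventually_mono, intro ballI)
      fix n y assume "128 * ?M / \<rho>\<^sup>2 * (norm v)\<^sup>2 * cmod (h v n) < e" "y \<in> ball x (\<rho> / 2)"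
      with est[OF this(2) h, of v n] show "dist (?q (h v n) v y) (directional_derivative v f y) < e"
        unfolding dist_norm by linarith
    qed
  qed
  note lim = uniform_limit_complex_differentiable[OF _ q_diff this]
  have \<rho>2: "\<rho> / 2 > 0" using \<rho>(1) by simp
  show diff_v: "complex_differentiable (directional_derivative v f) x" for v
    by (rule lim(1)[OF \<rho>2])
  have "(\<lambda>n. directional_derivative w (?q (h v n) v) x) \<longlonglongrightarrow> directional_derivative w (directional_derivative v f) x"
    by (rule lim(2)[OF \<rho>2])
  moreover have "(\<lambda>n. directional_derivative w (?q (h v n) v) x) \<longlonglongrightarrow> directional_derivative v (directional_derivative w f) x"
  proof -
    have "((\<lambda>t. directional_derivative w f (x + t *\<^sub>C v)) has_field_derivative
        directional_derivative v (directional_derivative w f) (x + 0 *\<^sub>C v)) (at 0)"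
      by (rule complex_differentiable_line) (simp add: diff_v)
    then have "((\<lambda>t. (directional_derivative w f (x + t *\<^sub>C v) - directional_derivative w f x) / t)
        \<longlongrightarrow> directional_derivative v (directional_derivative w f) x) (at 0)"
      by (simp add: DERIV_def)
    then have "(\<lambda>n. (directional_derivative w f (x + h v n *\<^sub>C v) - directional_derivative w f x) / h v n)
        \<longlonglongrightarrow> directional_derivative v (directional_derivative w f) x"
      using h_lim h(1) unfolding tendsto_at_iff_sequentially o_def by auto
    moreover have "directional_derivative w (?q (h v n) v) x
      = (directional_derivative w f (x + h v n *\<^sub>C v) - directional_derivative w f x) / h v n" for n
    proof -
      have "x \<in> ball x (\<rho> / 2)"
        using \<rho>2 by simp
      from q_deriv[OF this, of w v n] show ?thesis
        unfolding divide_inverse by (simp add: algebra_simps)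
    qed
    ultimately show ?thesis by (simp only:)
  qed
  ultimately show "directional_derivative w (directional_derivative v f) x = directional_derivative v (directional_derivative w f) x"
    by (rule LIMSEQ_unique)
qed


subsection \<open>Iterated directional derivatives and the Taylor series\<close>

fun iterated_derivative :: "'a::complex_normed_vector list \<Rightarrow> ('a \<Rightarrow> complex) \<Rightarrow> 'a \<Rightarrow> complex"
  where
    "iterated_derivative [] f = f"
  | "iterated_derivative (v # vs) f = directional_derivative v (iterated_derivative vs f)"

lemma directional_derivative_cong:
  assumes "open U" "x \<in> U" "\<And>y. y \<in> U \<Longrightarrow> f y = g y"
  shows "directional_derivative v f x = directional_derivative v g x"
  unfolding directional_derivative_def
proof (rule deriv_cong_ev)
  have "open ((\<lambda>t. x + t *\<^sub>C v) -` U)"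
    by (intro open_vimage assms(1) continuous_on_add continuous_on_const
        linear_continuous_on[OF bounded_linear_line])
  moreover have "0 \<in> (\<lambda>t. x + t *\<^sub>C v) -` U"
    using assms(2) by simp
  ultimately have "\<forall>\<^sub>F t in nhds 0. x + t *\<^sub>C v \<in> U"
    unfolding eventually_nhds by blast
  then show "\<forall>\<^sub>F t in nhds 0. f (x + t *\<^sub>C v) = g (x + t *\<^sub>C v)"
    by (rule eventually_mono) (rule assms(3))
qed simp

lemma holomorphic_ball_directional_derivative:
  fixes f :: "'a::complex_normed_vector \<Rightarrow> complex"
  shows "holomorphic_ball f \<Longrightarrow> holomorphic_ball (directional_derivative v f)"
  unfolding holomorphic_ball_iff
  using complex_differentiable_directional_derivative(1)[OF open_ball, of _ 0 1 f v] by blast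

lemma holomorphic_ball_iterated_derivative:
  fixes f :: "'a::complex_normed_vector \<Rightarrow> complex"
  shows "holomorphic_ball f \<Longrightarrow> holomorphic_ball (iterated_derivative vs f)"
  by (induction vs) (auto intro: holomorphic_ball_directional_derivative)

lemma iterated_derivative_lincomb:
  fixes f :: "'a::complex_normed_vector \<Rightarrow> complex"
  assumes f: "holomorphic_ball f" and z: "z \<in> ball 0 1"
  shows "iterated_derivative (us @ (a *\<^sub>C x + b *\<^sub>C y) # vs) f z
    = a * iterated_derivative (us @ x # vs) f z + b * iterated_derivative (us @ y # vs) f z"
  using z
proof (induction us arbitrary: z)
  case Nil
  have "complex_differentiable (iterated_derivative vs f) z"
    using holomorphic_ball_iterated_derivative[OF f, of vs] Nil by (auto simp: holomorphic_ball_iff)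
  then show ?case
    by (simp add: directional_derivative_add directional_derivative_scale)
next
  case (Cons u us)
  have diff: "complex_differentiable (iterated_derivative ws f) z" for ws
    using holomorphic_ball_iterated_derivative[OF f, of ws] Cons.prems by (auto simp: holomorphic_ball_iff)
  have "directional_derivative u (iterated_derivative (us @ (a *\<^sub>C x + b *\<^sub>C y) # vs) f) z
    = directional_derivative u (\<lambda>z. a * iterated_derivative (us @ x # vs) f z + b * iterated_derivative (us @ y # vs) f z) z"
    by (rule directional_derivative_cong[OF open_ball Cons.prems Cons.IH])
  also have "\<dots> = a * directional_derivative u (iterated_derivative (us @ x # vs) f) z
      + b * directional_derivative u (iterated_derivative (us @ y # vs) f) z"
    by (rule complex_differentiable_lincomb(2)[OF diff diff])
  finally show ?case by simp
qed

lemma iterated_derivative_swap: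
  fixes f :: "'a::complex_normed_vector \<Rightarrow> complex"
  assumes f: "holomorphic_ball f" and z: "z \<in> ball 0 1"
  shows "iterated_derivative (us @ x # y # vs) f z = iterated_derivative (us @ y # x # vs) f z"
  using z
proof (induction us arbitrary: z)
  case Nil
  show ?case
    using holomorphic_ball_iterated_derivative[OF f, of vs] Nil
      complex_differentiable_directional_derivative(2)[OF open_ball Nil, of "iterated_derivative vs f"]
    by (auto simp: holomorphic_ball_iff)
next
  case (Cons u us)
  then show ?case
    using directional_derivative_cong[OF open_ball Cons.prems Cons.IH] by simp
qed

text \<open>Adjacent transpositions generate all permutations.\<close>

lemma mset_invariant:
  assumes swap: "\<And>us x y vs. P (us @ x # y # vs) = P (us @ y # x # vs)" and "mset xs = mset ys"
  shows "P xs = P ys"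
  using assms
proof (induction xs arbitrary: ys P)
  case (Cons x xs)
  note swap' = Cons.prems(1)
  have "x \<in> set ys"
    using Cons.prems(2) by (metis list.set_intros(1) mset_eq_setD)
  then obtain us vs where ys: "ys = us @ x # vs"
    by (auto dest: split_list)
  have "P (ws @ us @ x # vs) = P (ws @ x # us @ vs)" for ws
  proof (induction us arbitrary: ws)
    case (Cons u us)
    have "P (ws @ (u # us) @ x # vs) = P ((ws @ [u]) @ us @ x # vs)" by simp
    also have "\<dots> = P ((ws @ [u]) @ x # us @ vs)" by (rule Cons.IH)
    also have "\<dots> = P (ws @ u # x # us @ vs)" by simp
    also have "\<dots> = P (ws @ x # u # us @ vs)" by (rule swap')
    finally show ?case by simp
  qed simp
  from this[of "[]"] have "P ys = P (x # us @ vs)"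
    by (simp add: ys)
  also have "P (x # xs) = P (x # us @ vs)"
  proof (rule Cons.IH[of "\<lambda>xs. P (x # xs)"])
    show "P (x # ws @ u # v # ws') = P (x # ws @ v # u # ws')" for ws u v ws'
      using Cons.prems(1)[of "x # ws"] by simp
    show "mset xs = mset (us @ vs)"
      using Cons.prems(2) ys by simp
  qed
  finally show ?case by simp
qed simp

text \<open>Each differentiation costs a factor \<open>1 / s\<close> and shrinks the radius of the ball by \<open>s\<close>.\<close>

lemma iterated_derivative_bound:
  fixes f :: "'a::complex_normed_vector \<Rightarrow> complex"
  assumes f: "holomorphic_ball f" and M: "\<And>z. z \<in> ball 0 1 \<Longrightarrow> cmod (f z) \<le> M"
    and s: "s > 0" and z: "z \<in> ball 0 (1 - real (length vs) * s)"
  shows "cmod (iterated_derivative vs f z) \<le> M / s ^ length vs * prod_list (map norm vs)"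
  using z
proof (induction vs arbitrary: z)
  case (Cons v vs)
  let ?g = "iterated_derivative vs f"
  have sub: "ball z s \<subseteq> ball 0 (1 - real (length vs) * s)"
  proof
    fix y assume "y \<in> ball z s"
    then show "y \<in> ball 0 (1 - real (length vs) * s)"
      using Cons.prems dist_triangle[of 0 y z] by (simp add: algebra_simps)
  qed
  also have "\<dots> \<subseteq> ball 0 1"
    using s by (intro subset_ball) simp
  finally have sub1: "ball z s \<subseteq> ball 0 1" .
  have "cmod (directional_derivative v ?g z) \<le> M / s ^ length vs * prod_list (map norm vs) / s * norm v"
  proof (rule directional_estimates(2)[OF s])
    show "cmod (?g y) \<le> M / s ^ length vs * prod_list (map norm vs)" if "y \<in> ball z s" for y
      using sub that by (intro Cons.IH) blast
    show "(\<lambda>t. ?g (z + t *\<^sub>C u)) holomorphic_on ball 0 s" if "norm u = 1" for u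
      using holomorphic_ball_iterated_derivative[OF f, of vs] sub1 that
      by (intro complex_differentiable_holomorphic_line) (auto simp: holomorphic_ball_iff)
  qed
  then show ?case
    using s by (simp add: field_simps)
qed (use M in simp)

lemma higher_deriv_line:
  fixes f :: "'a::complex_normed_vector \<Rightarrow> complex"
  assumes f: "holomorphic_ball f" and t: "cmod t * norm x < 1"
  shows "(deriv ^^ k) (\<lambda>t. f (t *\<^sub>C x)) t = iterated_derivative (replicate k x) f (t *\<^sub>C x)"
  using t
proof (induction k arbitrary: t)
  case (Suc k)
  have "open {t :: complex. cmod t * norm x < 1}"
    by (intro open_Collect_less continuous_intros)
  then have "\<forall>\<^sub>F t in nhds t. cmod t * norm x < 1"
    using Suc.prems by (auto simp: eventually_nhds)
  then have ev: "\<forall>\<^sub>F t in nhds t. (deriv ^^ k) (\<lambda>t. f (t *\<^sub>C x)) t = iterated_derivative (replicate k x) f (t *\<^sub>C x)"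
    by (rule eventually_mono) (rule Suc.IH)
  have "complex_differentiable (iterated_derivative (replicate k x) f) (t *\<^sub>C x)"
    using holomorphic_ball_iterated_derivative[OF f, of "replicate k x"] Suc.prems
    by (auto simp: holomorphic_ball_iff norm_scaleC)
  then have "((\<lambda>t. iterated_derivative (replicate k x) f (0 + t *\<^sub>C x)) has_field_derivative
      directional_derivative x (iterated_derivative (replicate k x) f) (0 + t *\<^sub>C x)) (at t)"
    by (intro complex_differentiable_line) simp
  then have "deriv (\<lambda>t. iterated_derivative (replicate k x) f (t *\<^sub>C x)) t
      = directional_derivative x (iterated_derivative (replicate k x) f) (t *\<^sub>C x)"
    by (simp add: DERIV_imp_deriv)
  then show ?case
    using deriv_cong_ev[OF ev refl] by simp
qed simp

text \<open>The Taylor coefficient of order \<open>k\<close> at 0 as a symmetric form.\<close>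

definition derivative_form :: "('a::complex_normed_vector \<Rightarrow> complex) \<Rightarrow> nat \<Rightarrow> 'a list \<Rightarrow> complex"
  where "derivative_form f k xs = (if length xs = k then iterated_derivative xs f 0 / fact k else 0)"

lemma symmetric_form_derivative_form:
  fixes f :: "'a::complex_normed_vector \<Rightarrow> complex"
  assumes f: "holomorphic_ball f" and M: "\<And>z. z \<in> ball 0 1 \<Longrightarrow> cmod (f z) \<le> M"
  shows "symmetric_form k (derivative_form f k)"
  unfolding symmetric_form_def
proof (intro conjI allI impI)
  fix us vs :: "'a list" and x y c assume l: "length us + 1 + length vs = k"
  show "derivative_form f k (us @ (x + y) # vs) = derivative_form f k (us @ x # vs) + derivative_form f k (us @ y # vs)"
    using iterated_derivative_lincomb[OF f, of 0 us 1 x 1 y vs] l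
    by (simp add: derivative_form_def add_divide_distrib)
  show "derivative_form f k (us @ (c *\<^sub>C x) # vs) = c * derivative_form f k (us @ x # vs)"
    using iterated_derivative_lincomb[OF f, of 0 us c x 0 x vs] l
    by (simp add: derivative_form_def)
next
  define s where "s = 1 / (real k + 1)"
  have s: "s > 0" "real k * s < 1"
    by (simp_all add: s_def field_simps)
  have "cmod (derivative_form f k xs) \<le> (M / s ^ k / fact k) * prod_list (map norm xs)" if "length xs = k" for xs
  proof -
    have "cmod (iterated_derivative xs f 0) \<le> M / s ^ k * prod_list (map norm xs)"
      using iterated_derivative_bound[OF f M s(1), of 0 xs] that s(2) by simp
    then have "cmod (iterated_derivative xs f 0) / fact k \<le> M / s ^ k * prod_list (map norm xs) / fact k"
      by (intro divide_right_mono) auto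
    then show ?thesis
      using that by (simp add: derivative_form_def norm_divide)
  qed
  then show "\<exists>C. \<forall>xs. length xs = k \<longrightarrow> cmod (derivative_form f k xs) \<le> C * prod_list (map norm xs)"
    by blast
next
  fix xs ys :: "'a list" assume *: "length xs = k \<and> mset xs = mset ys"
  then have "iterated_derivative xs f 0 = iterated_derivative ys f 0"
    by (intro mset_invariant[of "\<lambda>xs. iterated_derivative xs f 0", OF iterated_derivative_swap[OF f]]) auto
  with * show "derivative_form f k xs = derivative_form f k ys"
    using mset_eq_length[of xs ys] by (simp add: derivative_form_def)
qed (simp add: derivative_form_def)

lemma holomorphic_on_line:
  fixes f :: "'a::complex_normed_vector \<Rightarrow> complex"
  assumes f: "holomorphic_ball f" and R: "\<And>t. cmod t < R \<Longrightarrow> cmod t * norm x < 1"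
  shows "(\<lambda>t. f (t *\<^sub>C x)) holomorphic_on ball 0 R"
  unfolding holomorphic_on_def
proof
  fix t :: complex assume "t \<in> ball 0 R"
  then have "complex_differentiable f (0 + t *\<^sub>C x)"
    using f R[of t] by (auto simp: holomorphic_ball_iff norm_scaleC)
  then have "((\<lambda>t. f (0 + t *\<^sub>C x)) has_field_derivative directional_derivative x f (0 + t *\<^sub>C x)) (at t)"
    by (rule complex_differentiable_line)
  then show "(\<lambda>t. f (t *\<^sub>C x)) field_differentiable at t within ball 0 R"
    by (auto simp: field_differentiable_def intro: has_field_derivative_at_within)
qed

lemma derivative_form_sums:
  fixes f :: "'a::complex_normed_vector \<Rightarrow> complex"
  assumes f: "holomorphic_ball f" and x: "norm x < 1"
  shows "(\<lambda>k. derivative_form f k (replicate k x)) sums f x"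
proof -
  \<comment> \<open>As \<open>R > 1\<close>, the power series of the restriction to the line may be evaluated at 1.\<close>
  define R where "R = (if x = 0 then 2 else 1 / norm x)"
  have R: "R > 1" "\<And>t. cmod t < R \<Longrightarrow> cmod t * norm x < 1"
    using x by (auto simp: R_def field_simps split: if_splits)
  have "(\<lambda>t. f (t *\<^sub>C x)) holomorphic_on ball 0 R"
    by (rule holomorphic_on_line[OF f R(2)])
  then have "(\<lambda>k. (deriv ^^ k) (\<lambda>t. f (t *\<^sub>C x)) 0 / fact k * (1 - 0) ^ k) sums f (1 *\<^sub>C x)"
    using R(1) by (intro holomorphic_power_series) auto
  then show ?thesis
    by (simp add: higher_deriv_line[OF f] derivative_form_def)
qed

lemma derivative_form_diagonal_bound:
  fixes f :: "'a::complex_normed_vector \<Rightarrow> complex"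
  assumes f: "holomorphic_ball f" and M: "\<And>z. z \<in> ball 0 1 \<Longrightarrow> cmod (f z) \<le> M"
  shows "cmod (derivative_form f k (replicate k x)) \<le> M * norm x ^ k"
proof (cases "x = 0 \<or> k = 0")
  case True
  have "derivative_form f k (replicate k 0) = 0" if "k = Suc m" for m
    using multilinear_form_scale_head[of m "derivative_form f k" "replicate m 0" 0 0]
      symmetric_form_multilinear[OF symmetric_form_derivative_form[OF f M]] that by simp
  moreover have "0 \<le> M"
    using order_trans[OF norm_ge_zero M[of 0]] by simp
  ultimately show ?thesis
    using True M[of 0] by (cases k) (auto simp: derivative_form_def)
next
  case False
  define R where "R = 1 / norm x"
  have R: "R > 0" "\<And>t. cmod t < R \<Longrightarrow> cmod t * norm x < 1"
    using False by (auto simp: R_def field_simps)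
  have "(\<lambda>t. f (t *\<^sub>C x)) holomorphic_on ball 0 R"
    by (rule holomorphic_on_line[OF f R(2)])
  then have "cmod ((deriv ^^ k) (\<lambda>t. f (t *\<^sub>C x)) 0) \<le> fact k * M / R ^ k"
    using R M by (intro Cauchy_estimate_ball) (auto simp: norm_scaleC)
  then have "cmod (iterated_derivative (replicate k x) f 0) \<le> fact k * (M * norm x ^ k)"
    by (simp add: higher_deriv_line[OF f] R_def power_divide mult.assoc)
  then have "cmod (iterated_derivative (replicate k x) f 0) / fact k \<le> M * norm x ^ k"
    by (simp only: pos_divide_le_eq fact_gt_zero mult.commute)
  then show ?thesis
    by (simp add: derivative_form_def norm_divide)
qed

lemma has_taylor_forms_derivative_form:
  fixes f :: "'a::complex_normed_vector \<Rightarrow> complex"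
  assumes f: "holomorphic_ball f" and M: "\<And>z. z \<in> ball 0 1 \<Longrightarrow> cmod (f z) \<le> M"
  shows "has_taylor_forms f (derivative_form f)"
  unfolding has_taylor_forms_def
proof (intro conjI allI exI[of _ "1/2"])
  have M0: "0 \<le> M"
    using order_trans[OF norm_ge_zero M[of 0]] by simp
  have "uniform_limit (ball 0 (1/2)) (\<lambda>n x. \<Sum>k<n. derivative_form f k (replicate k x))
      (\<lambda>x. \<Sum>k. derivative_form f k (replicate k x)) sequentially"
  proof (rule Weierstrass_m_test)
    fix k and x :: 'a assume "x \<in> ball 0 (1/2)"
    then have "M * norm x ^ k \<le> M * (1/2) ^ k"
      using M0 by (intro mult_left_mono power_mono) auto
    then show "cmod (derivative_form f k (replicate k x)) \<le> M * (1/2) ^ k"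
      using derivative_form_diagonal_bound[OF f M, of k x] by linarith
  qed (intro summable_mult summable_geometric, simp)
  moreover have "(\<Sum>k. derivative_form f k (replicate k x)) = f x" if "x \<in> ball 0 (1/2)" for x
    using that derivative_form_sums[OF f, of x] by (simp add: sums_iff)
  ultimately show "uniform_limit (ball 0 (1/2)) (\<lambda>n x. \<Sum>k<n. derivative_form f k (replicate k x)) f sequentially"
    by (subst (asm) uniform_limit_cong'[OF refl]) auto
qed (use symmetric_form_derivative_form[OF f M] in auto)

lemma multilinear_form_replicate_scale:
  "multilinear_form k A \<Longrightarrow> A (replicate k (c *\<^sub>C x)) = c ^ k * A (replicate k x)"
proof (induction k arbitrary: A)
  case (Suc k)
  have "A (c *\<^sub>C x # replicate k (c *\<^sub>C x)) = c * A (x # replicate k (c *\<^sub>C x))"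
    by (rule multilinear_form_scale_head[OF Suc.prems]) simp
  also have "A (x # replicate k (c *\<^sub>C x)) = c ^ k * A (x # replicate k x)"
    by (rule Suc.IH[OF multilinear_form_Cons[OF Suc.prems]])
  finally show ?case by simp
qed simp

text \<open>On a line through 0 two expansions are power series with the same sum, so they agree on the
  diagonal near 0, by homogeneity on the whole diagonal, and by polarization everywhere.\<close>

lemma has_taylor_forms_unique:
  fixes f :: "'a::complex_normed_vector \<Rightarrow> complex"
  assumes A: "has_taylor_forms f A" and B: "has_taylor_forms f B"
  shows "A = B"
proof -
  have sA: "symmetric_form k (A k)" and sB: "symmetric_form k (B k)" for k
    using A B by (auto simp: has_taylor_forms_def)
  define C where "C k xs = A k xs + (- 1) * B k xs" for k xs
  have sC: "symmetric_form k (C k)" for k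
    unfolding C_def by (rule symmetric_form_lincomb[OF sA sB])
  obtain r1 where r1: "r1 > 0" "uniform_limit (ball 0 r1) (\<lambda>n x. \<Sum>k<n. A k (replicate k x)) f sequentially"
    using A by (auto simp: has_taylor_forms_def)
  obtain r2 where r2: "r2 > 0" "uniform_limit (ball 0 r2) (\<lambda>n x. \<Sum>k<n. B k (replicate k x)) f sequentially"
    using B by (auto simp: has_taylor_forms_def)
  define r where "r = min r1 r2"
  have r: "r > 0" using r1 r2 by (simp add: r_def)
  have sums: "(\<lambda>k. C k (replicate k x)) sums 0" if "x \<in> ball 0 r" for x
  proof -
    have "(\<lambda>k. A k (replicate k x)) sums f x" "(\<lambda>k. B k (replicate k x)) sums f x"
      using tendsto_uniform_limitI[OF r1(2), of x] tendsto_uniform_limitI[OF r2(2), of x] that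
      by (auto simp: sums_def r_def)
    then have "(\<lambda>k. A k (replicate k x) + (- 1) * B k (replicate k x)) sums (f x + (- 1) * f x)"
      by (intro sums_add sums_mult)
    then show ?thesis by (simp add: C_def)
  qed
  have zero_small: "C k (replicate k x) = 0" if x: "x \<in> ball 0 r" for k x
  proof -
    let ?a = "\<lambda>k. C k (replicate k x)"
    have "(\<lambda>k. ?a k * (t - 0) ^ k) sums (\<lambda>t. 0) t" if "cmod (t - 0) < 1" for t
    proof -
      have "norm (t *\<^sub>C x) \<le> 1 * norm x"
        unfolding norm_scaleC using that by (intro mult_right_mono) auto
      then have "(\<lambda>k. C k (replicate k (t *\<^sub>C x))) sums 0"
        using x by (intro sums) auto
      then show ?thesis
        by (simp add: multilinear_form_replicate_scale[OF symmetric_form_multilinear[OF sC]] mult.commute)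
    qed
    note ps = this
    show ?thesis
    proof (cases "k = 0")
      case True
      have "(\<lambda>k. ?a k * 0 ^ k) sums 0"
        using ps[of 0] by simp
      then show ?thesis
        using True powser_sums_zero_iff[of ?a 0] by simp
    next
      case False
      show ?thesis
      proof (rule ccontr)
        assume "?a k \<noteq> 0"
        then obtain s where "0 < s" "\<And>z. z \<in> cball (0 :: complex) s - {0} \<Longrightarrow> (\<lambda>t. 0 :: complex) z \<noteq> 0"
          using powser_0_nonzero[OF zero_less_one ps _ \<open>?a k \<noteq> 0\<close>] False by blast
        from this(2)[of "complex_of_real s"] this(1) show False by simp
      qed
    qed
  qed
  have "C k (replicate k x) = 0" for k x
  proof -
    define c where "c = r / (2 * (norm x + 1))"
    have c: "c > 0" "c * norm x < r"
    proof -
      show "c > 0"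
        using r by (simp add: c_def add_nonneg_pos)
      have "c * norm x \<le> c * (norm x + 1)"
        using \<open>c > 0\<close> by simp
      also have "\<dots> = r / 2"
      proof -
        have "norm x + 1 \<noteq> 0"
          using norm_ge_zero[of x] by linarith
        then show ?thesis
          unfolding c_def by (metis nonzero_mult_divide_mult_cancel_right times_divide_eq_left)
      qed
      finally show "c * norm x < r" using r by simp
    qed
    then have "complex_of_real c *\<^sub>C x \<in> ball 0 r"
      by (simp add: norm_scaleC)
    from zero_small[OF this, of k] have "complex_of_real c ^ k * C k (replicate k x) = 0"
      by (simp add: multilinear_form_replicate_scale[OF symmetric_form_multilinear[OF sC]])
    with c(1) show ?thesis by simp
  qed
  then have "C k xs = 0" for k xs
    by (rule polarization[OF sC])
  then have "A k xs = B k xs" for k xs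
    by (simp add: C_def)
  then show ?thesis by blast
qed

lemma taylor_form_eqI: "has_taylor_forms f A \<Longrightarrow> taylor_form f = A"
  unfolding taylor_form_def by (rule the_equality) (auto dest: has_taylor_forms_unique)


section \<open>Approximation of Aron--Berner extensions by values on the space\<close>

lemma multilinear_form_append:
  "multilinear_form (length us + n) A \<Longrightarrow> multilinear_form n (\<lambda>xs. A (us @ xs))"
proof (induction us arbitrary: A)
  case (Cons u us)
  have "multilinear_form (length us + n) (\<lambda>xs. A (u # xs))"
    using Cons.prems by (intro multilinear_form_Cons) simp
  from Cons.IH[OF this] show ?case by simp
qed simp

text \<open>Local reflexivity for the two elements \<open>z\<close>, \<open>w\<close> and the three combinations \<open>z\<close>, \<open>w\<close>,
  \<open>z - w\<close>.\<close>

lemma goldstine_pair: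
  fixes z w :: "'a::complex_normed_vector bidual"
  assumes "finite \<Phi>" "norm z < a" "norm w < b" "norm (z - w) < d"
  obtains x y where "\<And>\<phi>. \<phi> \<in> \<Phi> \<Longrightarrow> cblinfun_apply \<phi> x = cblinfun_apply z \<phi>"
    "\<And>\<phi>. \<phi> \<in> \<Phi> \<Longrightarrow> cblinfun_apply \<phi> y = cblinfun_apply w \<phi>"
    "norm x < a" "norm y < b" "norm (x - y) < d"
proof -
  define \<alpha> :: "nat \<Rightarrow> bool \<Rightarrow> complex" where
    "\<alpha> l i = (if l = 0 then (if i then 0 else 1) else if l = 1 then (if i then 1 else 0) else if i then -1 else 1)" for l i
  define c where "c l = (if l = 0 then a else if l = 1 then b else d)" for l :: nat
  have sum: "(\<Sum>i\<in>UNIV. \<alpha> l i *\<^sub>C v i) = (if l = 0 then v False else if l = 1 then v True else v False - v True)"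
    for l and v :: "bool \<Rightarrow> 'c::complex_normed_vector"
    by (simp add: \<alpha>_def UNIV_bool)
  obtain x :: "bool \<Rightarrow> 'a" where x: "\<And>i \<phi>. i \<in> UNIV \<Longrightarrow> \<phi> \<in> \<Phi> \<Longrightarrow> cblinfun_apply \<phi> (x i) = cblinfun_apply (if i then w else z) \<phi>"
    "\<And>l. l \<in> {0, 1, 2} \<Longrightarrow> norm (\<Sum>i\<in>UNIV. \<alpha> l i *\<^sub>C x i) < c l"
  proof (rule local_reflexivity[of "UNIV :: bool set" "{0, 1, 2}" \<Phi> \<alpha> "\<lambda>i. if i then w else z" c])
    show "norm (\<Sum>i\<in>UNIV. \<alpha> l i *\<^sub>C (if i then w else z)) < c l" if "l \<in> {0, 1, 2}" for l
      using that assms by (auto simp: sum c_def)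
  qed (use assms(1) in auto)
  show thesis
  proof (rule that[of "x False" "x True"])
    show "norm (x False) < a" "norm (x True) < b" "norm (x False - x True) < d"
      using x(2)[of 0] x(2)[of 1] x(2)[of 2] by (simp_all add: sum c_def)
  qed (use x(1)[of False] x(1)[of True] in auto)
qed

text \<open>The iterated limits that define the extension are attained exactly along a sequence: the
  \<open>m\<close>-th term only has to satisfy finitely many linear equations, given by the previous terms.\<close>

lemma exact_sequence:
  fixes z w :: "'a::complex_normed_vector bidual" and A :: "nat \<Rightarrow> 'a list \<Rightarrow> complex"
  assumes A: "\<And>k. k < n \<Longrightarrow> multilinear_form k (A k)"
    and norms: "norm z < a" "norm w < b" "norm (z - w) < d"
  obtains x y :: "nat \<Rightarrow> 'a" where "\<And>i. norm (x i) < a" "\<And>i. norm (y i) < b" "\<And>i. norm (x i - y i) < d"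
    "\<And>k js. k < n \<Longrightarrow> length js = k \<Longrightarrow> sorted_wrt (<) js \<Longrightarrow> A k (map x js) = AB_form (A k) (replicate k z)"
    "\<And>k js. k < n \<Longrightarrow> length js = k \<Longrightarrow> sorted_wrt (<) js \<Longrightarrow> A k (map y js) = AB_form (A k) (replicate k w)"
proof -
  define good where "good z U x \<longleftrightarrow> (\<forall>k us. k < n \<and> length us < k \<and> set us \<subseteq> U \<longrightarrow>
      AB_form (\<lambda>xs. A k (us @ x # xs)) (replicate (k - length us - 1) z)
        = AB_form (\<lambda>xs. A k (us @ xs)) (replicate (k - length us) z))" for z U and x :: 'a
  have functionals: "\<exists>\<Phi>. finite \<Phi> \<and> (\<forall>x. (\<forall>\<phi>\<in>\<Phi>. cblinfun_apply \<phi> x = cblinfun_apply z \<phi>) \<longrightarrow> good z U x)"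
    if U: "finite U" for z and U :: "'a set"
  proof -
    define J where "J = {(k, us). k < n \<and> length us < k \<and> set us \<subseteq> U}"
    have "J \<subseteq> {..<n} \<times> {us. set us \<subseteq> U \<and> length us \<le> n}"
      by (auto simp: J_def)
    then have J: "finite J"
      by (rule finite_subset) (use finite_lists_length_le[OF U, of n] in auto)
    have "\<exists>\<psi>. (\<forall>x. cblinfun_apply \<psi> x = AB_form (\<lambda>xs. A k (us @ x # xs)) (replicate (k - length us - 1) z)) \<and>
        AB_form (\<lambda>xs. A k (us @ xs)) (replicate (k - length us) z) = cblinfun_apply z \<psi>"
      if j: "(k, us) \<in> J" for k us
    proof -
      have len: "length us < k" "k < n"
        using j by (auto simp: J_def)
      have "multilinear_form (length us + Suc (length (replicate (k - length us - 1) z))) (A k)"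
        using A[OF len(2)] len(1) by simp
      then have "multilinear_form (Suc (length (replicate (k - length us - 1) z))) (\<lambda>xs. A k (us @ xs))"
        by (rule multilinear_form_append)
      then obtain \<psi> where "\<And>x. cblinfun_apply \<psi> x = AB_form (\<lambda>xs. A k (us @ x # xs)) (replicate (k - length us - 1) z)"
        "\<And>z'. AB_form (\<lambda>xs. A k (us @ xs)) (z' # replicate (k - length us - 1) z) = cblinfun_apply z' \<psi>"
        by (rule AB_form_head_functional) blast
      moreover have "replicate (k - length us) z = z # replicate (k - length us - 1) z"
        using len(1) by (cases "k - length us") auto
      ultimately show ?thesis by (intro exI[of _ \<psi>]) simp
    qed
    then obtain \<psi> where \<psi>: "\<And>k us x. (k, us) \<in> J \<Longrightarrow>
        cblinfun_apply (\<psi> k us) x = AB_form (\<lambda>xs. A k (us @ x # xs)) (replicate (k - length us - 1) z)"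
      "\<And>k us. (k, us) \<in> J \<Longrightarrow>
        AB_form (\<lambda>xs. A k (us @ xs)) (replicate (k - length us) z) = cblinfun_apply z (\<psi> k us)"
      by metis
    have "good z U x" if x: "\<And>\<phi>. \<phi> \<in> (\<lambda>(k, us). \<psi> k us) ` J \<Longrightarrow> cblinfun_apply \<phi> x = cblinfun_apply z \<phi>" for x
      unfolding good_def
    proof (intro allI impI)
      fix k us assume "k < n \<and> length us < k \<and> set us \<subseteq> U"
      then have j: "(k, us) \<in> J" by (simp add: J_def)
      then have "cblinfun_apply (\<psi> k us) x = cblinfun_apply z (\<psi> k us)"
        by (intro x) force
      then show "AB_form (\<lambda>xs. A k (us @ x # xs)) (replicate (k - length us - 1) z)
          = AB_form (\<lambda>xs. A k (us @ xs)) (replicate (k - length us) z)"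
        by (simp only: \<psi>(1)[OF j] \<psi>(2)[OF j])
    qed
    with J show ?thesis by (intro exI[of _ "(\<lambda>(k, us). \<psi> k us) ` J"]) auto
  qed
  define P where "P f m r \<longleftrightarrow> norm (fst r) < a \<and> norm (snd r) < b \<and> norm (fst r - snd r) < d \<and>
      good z ((\<lambda>i. fst (f i)) ` {..<m}) (fst r) \<and> good w ((\<lambda>i. snd (f i)) ` {..<m}) (snd r)"
    for f :: "nat \<Rightarrow> 'a \<times> 'a" and m and r :: "'a \<times> 'a"
  have "\<exists>f. \<forall>m. P f m (f m)"
  proof (rule dependent_wf_choice[OF wf_less])
    fix f g :: "nat \<Rightarrow> 'a \<times> 'a" and m r assume "\<And>i. (i, m) \<in> {(x, y). x < y} \<Longrightarrow> f i = g i"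
    then have "(\<lambda>i. fst (f i)) ` {..<m} = (\<lambda>i. fst (g i)) ` {..<m}"
      "(\<lambda>i. snd (f i)) ` {..<m} = (\<lambda>i. snd (g i)) ` {..<m}"
      by (auto intro!: image_cong)
    then show "P f m r = P g m r" by (simp only: P_def)
  next
    fix m and f :: "nat \<Rightarrow> 'a \<times> 'a"
    obtain \<Phi>1 where \<Phi>1: "finite \<Phi>1"
      "\<And>x. (\<forall>\<phi>\<in>\<Phi>1. cblinfun_apply \<phi> x = cblinfun_apply z \<phi>) \<Longrightarrow> good z ((\<lambda>i. fst (f i)) ` {..<m}) x"
      using functionals[of "(\<lambda>i. fst (f i)) ` {..<m}" z] by auto
    obtain \<Phi>2 where \<Phi>2: "finite \<Phi>2"
      "\<And>x. (\<forall>\<phi>\<in>\<Phi>2. cblinfun_apply \<phi> x = cblinfun_apply w \<phi>) \<Longrightarrow> good w ((\<lambda>i. snd (f i)) ` {..<m}) x"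
      using functionals[of "(\<lambda>i. snd (f i)) ` {..<m}" w] by auto
    obtain x y where xy: "\<And>\<phi>. \<phi> \<in> \<Phi>1 \<union> \<Phi>2 \<Longrightarrow> cblinfun_apply \<phi> x = cblinfun_apply z \<phi>"
      "\<And>\<phi>. \<phi> \<in> \<Phi>1 \<union> \<Phi>2 \<Longrightarrow> cblinfun_apply \<phi> y = cblinfun_apply w \<phi>"
      "norm x < a" "norm y < b" "norm (x - y) < d"
      using goldstine_pair[of "\<Phi>1 \<union> \<Phi>2" z a w b d] norms \<Phi>1(1) \<Phi>2(1) by auto
    then have "P f m (x, y)"
      unfolding P_def using \<Phi>1(2) \<Phi>2(2) by simp
    then show "\<exists>r. P f m r" by blast
  qed
  then obtain f where f: "\<And>m. P f m (f m)" by blast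
  have exact: "A k (map u js) = AB_form (A k) (replicate k v)"
    if good_u: "\<And>m. good v (u ` {..<m}) (u m)" and k: "k < n" and js: "length js = k" "sorted_wrt (<) js"
    for v and u :: "nat \<Rightarrow> 'a" and k js
  proof -
    have "AB_form (\<lambda>xs. A k (map u is @ xs)) (replicate (k - length is) v) = AB_form (A k) (replicate k v)"
      if "length is \<le> k" "sorted_wrt (<) is" for "is"
      using that
    proof (induction "is" rule: rev_induct)
      case (snoc m "is")
      have sub: "set (map u is) \<subseteq> u ` {..<m}"
        using snoc.prems(2) by (auto simp: sorted_wrt_append)
      have "AB_form (\<lambda>xs. A k (map u is @ u m # xs)) (replicate (k - length is - 1) v)
          = AB_form (\<lambda>xs. A k (map u is @ xs)) (replicate (k - length is) v)"
        using good_u[of m, unfolded good_def, rule_format, of k "map u is"] k snoc.prems(1) sub by simp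
      also have "\<dots> = AB_form (A k) (replicate k v)"
        using snoc.prems by (intro snoc.IH) (auto simp: sorted_wrt_append)
      finally show ?case by simp
    qed simp
    from this[of js] js show ?thesis by simp
  qed
  show thesis
  proof (rule that[of "\<lambda>i. fst (f i)" "\<lambda>i. snd (f i)"])
    show "A k (map (\<lambda>i. fst (f i)) js) = AB_form (A k) (replicate k z)"
      if "k < n" "length js = k" "sorted_wrt (<) js" for k js
      by (rule exact) (use f that in \<open>auto simp: P_def\<close>)
    show "A k (map (\<lambda>i. snd (f i)) js) = AB_form (A k) (replicate k w)"
      if "k < n" "length js = k" "sorted_wrt (<) js" for k js
      by (rule exact) (use f that in \<open>auto simp: P_def\<close>)
  qed (use f in \<open>auto simp: P_def\<close>)
qed

definition index_lists :: "nat \<Rightarrow> nat \<Rightarrow> nat list set"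
  where "index_lists m k = {js. set js \<subseteq> {..<m} \<and> length js = k}"

lemma finite_index_lists: "finite (index_lists m k)"
  and card_index_lists: "card (index_lists m k) = m ^ k"
  unfolding index_lists_def using finite_lists_length_eq[of "{..<m}" k] card_lists_length_eq[of "{..<m}" k] by auto

lemma index_lists_Suc: "index_lists m (Suc k) = (\<lambda>(j, js). j # js) ` ({..<m} \<times> index_lists m k)"
  by (auto simp: index_lists_def length_Suc_conv)

lemma multilinear_form_sum_diagonal:
  "multilinear_form k A \<Longrightarrow> A (replicate k (\<Sum>i<m. x i)) = (\<Sum>js\<in>index_lists m k. A (map x js))"
proof (induction k arbitrary: A)
  case 0
  have "index_lists m 0 = {[]}" by (auto simp: index_lists_def)
  then show ?case by simp
next
  case (Suc k)
  let ?s = "\<Sum>i<m. x i"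
  obtain \<psi> where \<psi>: "\<And>v. cblinfun_apply \<psi> v = A (v # replicate k ?s)"
    using multilinear_form_head_functional[OF Suc.prems, of "replicate k ?s"] by auto
  have "A (replicate (Suc k) ?s) = (\<Sum>i<m. A (x i # replicate k ?s))"
    by (simp flip: \<psi> add: cblinfun_sum)
  also have "\<dots> = (\<Sum>i<m. \<Sum>js\<in>index_lists m k. A (x i # map x js))"
    by (intro sum.cong refl Suc.IH multilinear_form_Cons Suc.prems)
  also have "\<dots> = (\<Sum>(i, js)\<in>{..<m} \<times> index_lists m k. A (map x (i # js)))"
    by (simp add: sum.cartesian_product)
  also have "\<dots> = (\<Sum>js\<in>index_lists m (Suc k). A (map x js))"
    unfolding index_lists_Suc by (subst sum.reindex) (auto simp: inj_on_def case_prod_unfold)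
  finally show ?case .
qed

text \<open>A list of length \<open>k + 1\<close> with a repetition either has one in its tail or has its head among
  the at most \<open>k\<close> entries of the tail.\<close>

lemma card_not_distinct: "card {js \<in> index_lists m k. \<not> distinct js} * m \<le> k\<^sup>2 * m ^ k"
proof (induction k)
  case 0
  have "{js \<in> index_lists m 0. \<not> distinct js} = {}" by (auto simp: index_lists_def)
  then show ?case by (simp only: card.empty)
next
  case (Suc k)
  let ?N = "\<lambda>k. {js \<in> index_lists m k. \<not> distinct js}"
  let ?R = "SIGMA js:index_lists m k. set js"
  have fin: "finite ({..<m} \<times> ?N k)" "finite ?R"
    using finite_index_lists by auto
  have "?N (Suc k) \<subseteq> (\<lambda>(j, js). j # js) ` ({..<m} \<times> ?N k) \<union> (\<lambda>(js, j). j # js) ` ?R"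
  proof
    fix l assume l: "l \<in> ?N (Suc k)"
    then obtain j js where js: "l = j # js" "j < m" "js \<in> index_lists m k"
      unfolding index_lists_Suc by auto
    then have "j \<in> set js \<or> \<not> distinct js"
      using l by auto
    then show "l \<in> (\<lambda>(j, js). j # js) ` ({..<m} \<times> ?N k) \<union> (\<lambda>(js, j). j # js) ` ?R"
    proof
      assume "j \<in> set js"
      then have "(js, j) \<in> ?R" using js by auto
      then show ?thesis using js(1) by force
    next
      assume "\<not> distinct js"
      then have "(j, js) \<in> {..<m} \<times> ?N k" using js by auto
      then show ?thesis using js(1) by force
    qed
  qed
  then have "card (?N (Suc k)) \<le> card ((\<lambda>(j, js). j # js) ` ({..<m} \<times> ?N k) \<union> (\<lambda>(js, j). j # js) ` ?R)"
    using fin by (intro card_mono) auto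
  also have "\<dots> \<le> card ({..<m} \<times> ?N k) + card ?R"
    by (rule order_trans[OF card_Un_le add_mono[OF card_image_le[OF fin(1)] card_image_le[OF fin(2)]]])
  also have "card ?R = (\<Sum>js\<in>index_lists m k. card (set js))"
    using finite_index_lists by (subst card_SigmaI) auto
  also have "\<dots> \<le> (\<Sum>js\<in>index_lists m k. k)"
    by (intro sum_mono) (auto simp: index_lists_def intro: order_trans[OF card_length])
  finally have "card (?N (Suc k)) \<le> m * card (?N k) + k * m ^ k"
    by (simp add: card_index_lists card_cartesian_product mult.commute)
  then have "card (?N (Suc k)) * m \<le> (m * card (?N k) + k * m ^ k) * m"
    by (rule mult_le_mono1)
  also have "\<dots> = m * (card (?N k) * m) + k * m ^ Suc k"
    by (simp add: algebra_simps)
  also have "\<dots> \<le> m * (k\<^sup>2 * m ^ k) + k * m ^ Suc k"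
    using Suc.IH by (intro add_mono mult_le_mono2) auto
  also have "\<dots> \<le> (Suc k)\<^sup>2 * m ^ Suc k"
    by (simp add: power2_eq_square algebra_simps)
  finally show ?case .
qed

text \<open>Averaging: among all tuples of indices below \<open>m\<close> the proportion of those with a repetition
  tends to 0, and on the others the symmetric form has the prescribed value.\<close>

lemma averages_tendsto:
  fixes A :: "'a::complex_normed_vector list \<Rightarrow> complex"
  assumes A: "symmetric_form k A" and x: "\<And>i. norm (x i) \<le> a"
    and T: "\<And>js. length js = k \<Longrightarrow> sorted_wrt (<) js \<Longrightarrow> A (map x js) = T"
  shows "(\<lambda>m. A (replicate k (complex_of_real (1 / Suc m) *\<^sub>C (\<Sum>i<Suc m. x i)))) \<longlonglongrightarrow> T"
proof -
  note mA = symmetric_form_multilinear[OF A]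
  obtain C where C: "C \<ge> 0" "\<And>xs. length xs = k \<Longrightarrow> cmod (A xs) \<le> C * prod_list (map norm xs)"
    using multilinear_form_bound[OF mA] by blast
  have a: "a \<ge> 0"
    using x[of 0] norm_ge_zero order_trans by blast
  define K where "K = C * a ^ k + cmod T"
  have K: "K \<ge> 0" using C(1) a by (simp add: K_def)
  have distinct_T: "A (map x js) = T" if "distinct js" "length js = k" for js
  proof -
    have "A (map x js) = A (map x (sort js))"
      using that by (intro symmetric_form_mset[OF A]) auto
    also have "\<dots> = T"
      using that by (intro T) (auto simp: strict_sorted_iff)
    finally show ?thesis .
  qed
  have prod_le: "prod_list (map norm (map x js)) \<le> a ^ length js" for js
  proof (induction js)
    case (Cons j js)
    have "norm (x j) * prod_list (map norm (map x js)) \<le> a * a ^ length js"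
      using x[of j] a by (intro mult_mono Cons.IH) (auto intro!: prod_list_nonneg)
    then show ?case by simp
  qed simp
  have diff: "cmod (A (map x js) - T) \<le> (if distinct js then 0 else K)" if "js \<in> index_lists m k" for js m
  proof (cases "distinct js")
    case False
    have len: "length js = k" using that by (simp add: index_lists_def)
    have "cmod (A (map x js)) \<le> C * a ^ k"
      using C(2)[of "map x js"] mult_left_mono[OF prod_le[of js] C(1)] len by simp
    then show ?thesis
      using False norm_triangle_ineq4[of "A (map x js)" T] by (simp add: K_def)
  qed (use distinct_T that in \<open>auto simp: index_lists_def\<close>)
  have bound: "cmod (A (replicate k (complex_of_real (1 / M) *\<^sub>C (\<Sum>i<M. x i))) - T) \<le> K * k\<^sup>2 / M" if M: "M > 0" for M :: nat
  proof -
    have "A (replicate k (complex_of_real (1 / M) *\<^sub>C (\<Sum>i<M. x i))) - T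
        = complex_of_real (1 / M) ^ k * (\<Sum>js\<in>index_lists M k. A (map x js) - T)"
      using M by (simp add: multilinear_form_replicate_scale[OF mA] multilinear_form_sum_diagonal[OF mA]
          sum_subtractf card_index_lists power_one_over field_simps)
    then have "cmod (A (replicate k (complex_of_real (1 / M) *\<^sub>C (\<Sum>i<M. x i))) - T)
        = (1 / M) ^ k * cmod (\<Sum>js\<in>index_lists M k. A (map x js) - T)"
      by (simp add: norm_mult norm_power norm_divide)
    also have "\<dots> \<le> (1 / M) ^ k * (\<Sum>js\<in>index_lists M k. if distinct js then 0 else K)"
      by (intro mult_left_mono sum_norm_le diff) auto
    also have "(\<Sum>js\<in>index_lists M k. if distinct js then 0 else K) = card {js \<in> index_lists M k. \<not> distinct js} * K"
      using finite_index_lists by (simp add: sum.If_cases Int_def)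
    also have "(1 / M) ^ k * (card {js \<in> index_lists M k. \<not> distinct js} * K)
        = (card {js \<in> index_lists M k. \<not> distinct js} * M) * ((1 / M) ^ k * K / M)"
      using M by simp
    also have "\<dots> \<le> (k\<^sup>2 * M ^ k) * ((1 / M) ^ k * K / M)"
      using card_not_distinct[of M k] K
      by (intro mult_right_mono) (auto simp flip: of_nat_mult of_nat_power simp del: of_nat_power_eq_of_nat_cancel_iff)
    also have "\<dots> = K * k\<^sup>2 / M"
      using M by (simp add: power_one_over)
    finally show ?thesis .
  qed
  show ?thesis
  proof (rule Lim_null[THEN iffD2, OF Lim_null_comparison])
    show "\<forall>\<^sub>F m in sequentially. norm (A (replicate k (complex_of_real (1 / Suc m) *\<^sub>C (\<Sum>i<Suc m. x i))) - T) \<le> K * k\<^sup>2 / real (Suc m)"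
      by (rule always_eventually) (use bound in blast)
    show "(\<lambda>m. K * k\<^sup>2 / real (Suc m)) \<longlonglongrightarrow> 0"
      by (rule LIMSEQ_Suc[OF lim_const_over_n])
  qed
qed

lemma average_norm_less:
  fixes x :: "nat \<Rightarrow> 'a::complex_normed_vector"
  assumes "\<And>i. norm (x i) < a"
  shows "norm (complex_of_real (1 / Suc m) *\<^sub>C (\<Sum>i<Suc m. x i)) < a"
proof -
  have "norm (\<Sum>i<Suc m. x i) \<le> (\<Sum>i<Suc m. norm (x i))"
    by (rule norm_sum)
  also have "\<dots> < (\<Sum>i<Suc m. a)"
    by (intro sum_strict_mono assms) auto
  finally have "norm (\<Sum>i<Suc m. x i) < real (Suc m) * a" by simp
  then show ?thesis
    by (simp add: norm_scaleC norm_divide pos_divide_less_eq mult.commute del: sum.lessThan_Suc of_nat_Suc)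
qed

text \<open>All forms of degree less than \<open>n\<close> and both points are treated with the same sequences. The
  estimates of the norms are strict and convex, so they are inherited by the averages.\<close>

theorem AB_form_approximation:
  fixes z w :: "'a::complex_normed_vector bidual" and A :: "nat \<Rightarrow> 'a list \<Rightarrow> complex"
  assumes A: "\<And>k. symmetric_form k (A k)"
    and norms: "norm z < a" "norm w < b" "norm (z - w) < d"
  obtains s t :: "nat \<Rightarrow> 'a" where "\<And>m. norm (s m) < a" "\<And>m. norm (t m) < b" "\<And>m. norm (s m - t m) < d"
    "\<And>k. k < n \<Longrightarrow> (\<lambda>m. A k (replicate k (s m))) \<longlonglongrightarrow> AB_form (A k) (replicate k z)"
    "\<And>k. k < n \<Longrightarrow> (\<lambda>m. A k (replicate k (t m))) \<longlonglongrightarrow> AB_form (A k) (replicate k w)"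
proof -
  obtain x y :: "nat \<Rightarrow> 'a" where norm: "\<And>i. norm (x i) < a" "\<And>i. norm (y i) < b" "\<And>i. norm (x i - y i) < d"
    and exact: "\<And>k js. k < n \<Longrightarrow> length js = k \<Longrightarrow> sorted_wrt (<) js \<Longrightarrow> A k (map x js) = AB_form (A k) (replicate k z)"
    "\<And>k js. k < n \<Longrightarrow> length js = k \<Longrightarrow> sorted_wrt (<) js \<Longrightarrow> A k (map y js) = AB_form (A k) (replicate k w)"
    by (rule exact_sequence[OF symmetric_form_multilinear[OF A] norms, of n]) blast
  define avg where "avg u m = complex_of_real (1 / Suc m) *\<^sub>C (\<Sum>i<Suc m. u i)" for u :: "nat \<Rightarrow> 'a" and m
  show thesis
  proof (rule that[of "avg x" "avg y"])
    fix m
    show "norm (avg x m) < a" "norm (avg y m) < b"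
      unfolding avg_def by (intro average_norm_less norm)+
    have "avg x m - avg y m = avg (\<lambda>i. x i - y i) m"
      by (simp only: avg_def sum_subtractf complex_vector.scale_right_diff_distrib)
    then show "norm (avg x m - avg y m) < d"
      using average_norm_less[of "\<lambda>i. x i - y i" d m] norm(3) by (simp only: avg_def)
  next
    fix k assume k: "k < n"
    show "(\<lambda>m. A k (replicate k (avg x m))) \<longlonglongrightarrow> AB_form (A k) (replicate k z)"
      unfolding avg_def by (rule averages_tendsto[OF A less_imp_le[OF norm(1)] exact(1)[OF k]])
    show "(\<lambda>m. A k (replicate k (avg y m))) \<longlonglongrightarrow> AB_form (A k) (replicate k w)"
      unfolding avg_def by (rule averages_tendsto[OF A less_imp_le[OF norm(2)] exact(2)[OF k]])
  qed
qed


section \<open>The extension operator on holomorphic Lipschitz functions\<close>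

text \<open>On the space this is Cauchy's estimate; the approximation theorem carries it over without
  the constants \<open>k\<^sup>k / k!\<close> that a passage through the norm of the symmetric form would cost, so the
  extended series converges on the whole ball.\<close>

lemma AB_form_diagonal_bound:
  fixes f :: "'a::complex_normed_vector \<Rightarrow> complex"
  assumes f: "holomorphic_ball f" and M: "\<And>z. z \<in> ball 0 1 \<Longrightarrow> cmod (f z) \<le> M"
  shows "cmod (AB_form (derivative_form f k) (replicate k z)) \<le> M * norm z ^ k"
proof -
  have M0: "0 \<le> M"
    using order_trans[OF norm_ge_zero M[of 0]] by simp
  have "cmod (AB_form (derivative_form f k) (replicate k z)) \<le> M * a ^ k" if a: "norm z < a" for a
  proof -
    have A: "symmetric_form k (derivative_form f k)" for k
      by (rule symmetric_form_derivative_form[OF f M])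
    obtain s :: "nat \<Rightarrow> 'a" where s: "\<And>m. norm (s m) < a"
      "\<And>j. j < Suc k \<Longrightarrow> (\<lambda>m. derivative_form f j (replicate j (s m))) \<longlonglongrightarrow> AB_form (derivative_form f j) (replicate j z)"
      by (rule AB_form_approximation[OF A a a, of 1 "Suc k"]) auto
    have "cmod (derivative_form f k (replicate k (s m))) \<le> M * a ^ k" for m
    proof -
      have "cmod (derivative_form f k (replicate k (s m))) \<le> M * norm (s m) ^ k"
        by (rule derivative_form_diagonal_bound[OF f M])
      also have "\<dots> \<le> M * a ^ k"
        using s(1)[of m] M0 by (intro mult_left_mono power_mono) auto
      finally show ?thesis .
    qed
    then show ?thesis
      by (intro Lim_norm_ubound[OF _ s(2)] always_eventually) auto
  qed
  then have "\<forall>\<^sub>F a in at_right (norm z). cmod (AB_form (derivative_form f k) (replicate k z)) \<le> M * a ^ k"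
    by (auto simp: eventually_at_filter)
  moreover have "((\<lambda>a. M * a ^ k) \<longlongrightarrow> M * norm z ^ k) (at_right (norm z))"
    by (intro tendsto_intros)
  ultimately show ?thesis
    by (intro tendsto_lowerbound[of "\<lambda>a. M * a ^ k"]) auto
qed

lemma AB_extension_sums:
  fixes f :: "'a::complex_normed_vector \<Rightarrow> complex"
  assumes f: "holomorphic_ball f" and M: "\<And>z. z \<in> ball 0 1 \<Longrightarrow> cmod (f z) \<le> M" and z: "norm z < 1"
  shows "(\<lambda>k. AB_form (derivative_form f k) (replicate k z)) sums AB_extension f z"
proof -
  have "summable (\<lambda>k. AB_form (derivative_form f k) (replicate k z))"
  proof (rule summable_comparison_test')
    show "summable (\<lambda>k. M * norm z ^ k)"
      using z by (intro summable_mult summable_geometric) simp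
    show "norm (AB_form (derivative_form f k) (replicate k z)) \<le> M * norm z ^ k" for k
      by (rule AB_form_diagonal_bound[OF f M])
  qed
  moreover have "taylor_form f = derivative_form f"
    by (intro taylor_form_eqI has_taylor_forms_derivative_form[OF f M])
  ultimately show ?thesis
    unfolding AB_extension_def by (simp only: summable_sums)
qed

lemma taylor_tail_bound:
  fixes f :: "'a::complex_normed_vector \<Rightarrow> complex"
  assumes f: "holomorphic_ball f" and M: "\<And>z. z \<in> ball 0 1 \<Longrightarrow> cmod (f z) \<le> M"
    and x: "norm x < a" and a: "a < 1"
  shows "cmod (f x - (\<Sum>k<n. derivative_form f k (replicate k x))) \<le> M * a ^ n / (1 - a)"
proof -
  have M0: "0 \<le> M"
    using order_trans[OF norm_ge_zero M[of 0]] by simp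
  have a0: "0 < a" using x norm_ge_zero[of x] by linarith
  have sums: "(\<lambda>k. derivative_form f k (replicate k x)) sums f x"
    using x a by (intro derivative_form_sums[OF f]) simp
  then have tail: "(\<lambda>k. derivative_form f (k + n) (replicate (k + n) x)) sums
      (f x - (\<Sum>k<n. derivative_form f k (replicate k x)))"
    using sums_iff_shift[of "\<lambda>k. derivative_form f k (replicate k x)" n] by simp
  have geo: "(\<lambda>k. M * a ^ n * a ^ k) sums (M * a ^ n * (1 / (1 - a)))"
    using a a0 by (intro sums_mult geometric_sums) simp
  have "cmod (derivative_form f (k + n) (replicate (k + n) x)) \<le> M * a ^ n * a ^ k" for k
  proof -
    have "cmod (derivative_form f (k + n) (replicate (k + n) x)) \<le> M * norm x ^ (k + n)"
      by (rule derivative_form_diagonal_bound[OF f M])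
    also have "\<dots> \<le> M * a ^ (k + n)"
      using x M0 by (intro mult_left_mono power_mono) auto
    finally show ?thesis by (simp add: power_add mult_ac)
  qed
  then have "cmod (\<Sum>k. derivative_form f (k + n) (replicate (k + n) x)) \<le> (\<Sum>k. M * a ^ n * a ^ k)"
    using sums_summable[OF geo] by (intro norm_suminf_le)
  then show ?thesis
    using tail geo by (simp add: sums_iff)
qed

text \<open>The partial sums of the Taylor series at \<open>z\<close> and \<open>w\<close> are limits of their values at points
  \<open>s m\<close>, \<open>t m\<close> of the space whose distance is less than any given \<open>d > \<parallel>z - w\<parallel>\<close>. There the partial
  sums differ from \<open>f\<close> by a remainder that is uniform on balls of radius less than 1.\<close>

lemma AB_extension_lipschitz:
  fixes f :: "'a::complex_normed_vector \<Rightarrow> complex"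
  assumes f: "holomorphic_ball f" and M: "\<And>z. z \<in> ball 0 1 \<Longrightarrow> cmod (f z) \<le> M"
    and L: "\<And>x y. x \<in> ball 0 1 \<Longrightarrow> y \<in> ball 0 1 \<Longrightarrow> cmod (f x - f y) \<le> L * norm (x - y)" and L0: "L \<ge> 0"
    and z: "norm z < 1" and w: "norm w < 1"
  shows "cmod (AB_extension f z - AB_extension f w) \<le> L * norm (z - w)"
proof -
  let ?A = "derivative_form f"
  have A: "symmetric_form k (?A k)" for k
    by (rule symmetric_form_derivative_form[OF f M])
  obtain a where a: "norm z < a" "norm w < a" "a < 1"
    using dense[of "max (norm z) (norm w)" 1] z w by auto
  have "cmod (AB_extension f z - AB_extension f w) \<le> L * d" if d: "norm (z - w) < d" for d
  proof -
    let ?S = "\<lambda>n z. \<Sum>k<n. AB_form (?A k) (replicate k z)"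
    have partial: "cmod (?S n z - ?S n w) \<le> L * d + 2 * (M * a ^ n / (1 - a))" for n
    proof -
      obtain s t :: "nat \<Rightarrow> 'a" where st: "\<And>m. norm (s m) < a" "\<And>m. norm (t m) < a" "\<And>m. norm (s m - t m) < d"
        and s_lim: "\<And>k. k < n \<Longrightarrow> (\<lambda>m. ?A k (replicate k (s m))) \<longlonglongrightarrow> AB_form (?A k) (replicate k z)"
        and t_lim: "\<And>k. k < n \<Longrightarrow> (\<lambda>m. ?A k (replicate k (t m))) \<longlonglongrightarrow> AB_form (?A k) (replicate k w)"
        by (rule AB_form_approximation[OF A a(1,2) d, of n]) blast
      let ?T = "\<lambda>x. \<Sum>k<n. ?A k (replicate k x)"
      have "(\<lambda>m. ?T (s m) - ?T (t m)) \<longlonglongrightarrow> ?S n z - ?S n w"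
        by (intro tendsto_diff tendsto_sum s_lim t_lim) auto
      moreover have "cmod (?T (s m) - ?T (t m)) \<le> L * d + 2 * (M * a ^ n / (1 - a))" for m
      proof -
        have "cmod (f (s m) - f (t m)) \<le> L * norm (s m - t m)"
          using st(1,2)[of m] a(3) by (intro L) auto
        also have "\<dots> \<le> L * d"
          using st(3)[of m] L0 by (intro mult_left_mono) auto
        finally have 1: "cmod (f (s m) - f (t m)) \<le> L * d" .
        have 2: "cmod (f (s m) - ?T (s m)) \<le> M * a ^ n / (1 - a)" "cmod (f (t m) - ?T (t m)) \<le> M * a ^ n / (1 - a)"
          by (rule taylor_tail_bound[OF f M st(1) a(3)] taylor_tail_bound[OF f M st(2) a(3)]; assumption)+
        have "?T (s m) - ?T (t m) = (f (s m) - f (t m)) - (f (s m) - ?T (s m)) + (f (t m) - ?T (t m))"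
          by simp
        then have "cmod (?T (s m) - ?T (t m)) \<le> cmod (f (s m) - f (t m)) + cmod (f (s m) - ?T (s m)) + cmod (f (t m) - ?T (t m))"
          using norm_triangle_ineq[of "(f (s m) - f (t m)) - (f (s m) - ?T (s m))" "f (t m) - ?T (t m)"]
            norm_triangle_ineq4[of "f (s m) - f (t m)" "f (s m) - ?T (s m)"]
          by (simp only: )
        with 1 2 show ?thesis by linarith
      qed
      ultimately show ?thesis
        by (intro Lim_norm_ubound[of sequentially "\<lambda>m. ?T (s m) - ?T (t m)"] always_eventually) auto
    qed
    have "(\<lambda>n. ?S n z - ?S n w) \<longlonglongrightarrow> AB_extension f z - AB_extension f w"
      using AB_extension_sums[OF f M z] AB_extension_sums[OF f M w] unfolding sums_def
      by (intro tendsto_diff) auto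
    then have "(\<lambda>n. cmod (?S n z - ?S n w)) \<longlonglongrightarrow> cmod (AB_extension f z - AB_extension f w)"
      by (rule tendsto_norm)
    moreover have "(\<lambda>n. L * d + 2 * (M * a ^ n / (1 - a))) \<longlonglongrightarrow> L * d + 2 * (M * 0 / (1 - a))"
      using a(3) order_le_less_trans[OF norm_ge_zero a(1)] by (intro tendsto_intros LIMSEQ_power_zero) auto
    ultimately have "cmod (AB_extension f z - AB_extension f w) \<le> L * d + 2 * (M * 0 / (1 - a))"
      using partial by (intro LIMSEQ_le) auto
    then show ?thesis by simp
  qed
  then have "\<forall>\<^sub>F d in at_right (norm (z - w)). cmod (AB_extension f z - AB_extension f w) \<le> L * d"
    by (auto simp: eventually_at_filter)
  moreover have "((\<lambda>d. L * d) \<longlongrightarrow> L * norm (z - w)) (at_right (norm (z - w)))"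
    by (intro tendsto_intros)
  ultimately show ?thesis
    by (intro tendsto_lowerbound[of "\<lambda>d. L * d"]) auto
qed

lemma complex_differentiable_diagonal:
  fixes B :: "'a::complex_normed_vector list \<Rightarrow> complex"
  assumes B: "multilinear_form k B"
  shows "complex_differentiable (\<lambda>z. B (replicate k z)) x"
proof -
  obtain C where C: "C \<ge> 0" "\<And>xs. length xs = k \<Longrightarrow> cmod (B xs) \<le> C * prod_list (map norm xs)"
    using multilinear_form_bound[OF B] by blast
  note deriv = has_field_derivative_diagonal[OF B]
  have dd: "directional_derivative h (\<lambda>z. B (replicate k z)) x = diagonal_derivative B k x h" for h
    unfolding directional_derivative_def using deriv[of x h 0] by (simp add: DERIV_imp_deriv)
  show ?thesis
  proof (rule gateaux_imp_complex_differentiable[OF zero_less_one])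
    fix y assume "y \<in> ball x 1"
    then have "norm y \<le> norm x + 1"
      using norm_triangle_sub[of y x] by (simp add: dist_norm norm_minus_commute)
    then have "C * norm y ^ k \<le> C * (norm x + 1) ^ k"
      using C(1) by (intro mult_left_mono power_mono) auto
    then show "cmod (B (replicate k y)) \<le> C * (norm x + 1) ^ k"
      using C(2)[of "replicate k y"] by simp
  next
    fix v :: 'a
    show "(\<lambda>t. B (replicate k (x + t *\<^sub>C v))) holomorphic_on ball 0 1"
      unfolding holomorphic_on_def
    proof
      fix t :: complex
      have "(\<lambda>t. B (replicate k (x + t *\<^sub>C v))) field_differentiable at t"
        unfolding field_differentiable_def using deriv[of x v t] by (rule exI)
      then show "(\<lambda>t. B (replicate k (x + t *\<^sub>C v))) field_differentiable at t within ball 0 1"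
        by (rule field_differentiable_at_within)
    qed
  qed (simp add: dd diagonal_derivative_add[OF B])
qed

lemma complex_differentiable_sum:
  fixes f :: "'i \<Rightarrow> 'a::complex_normed_vector \<Rightarrow> complex"
  assumes "\<And>i. i \<in> I \<Longrightarrow> complex_differentiable (f i) x"
  shows "complex_differentiable (\<lambda>z. \<Sum>i\<in>I. f i z) x"
  using assms
proof (induction I rule: infinite_finite_induct)
  case (insert i I)
  have "complex_differentiable (\<lambda>z. 1 * f i z + 1 * (\<Sum>i\<in>I. f i z)) x"
    using insert by (intro complex_differentiable_lincomb) auto
  with insert.hyps show ?case by simp
qed (auto simp: complex_differentiable_def zero_cblinfun.rep_eq intro!: exI[of _ 0])

text \<open>The extension is a locally uniform limit of polynomials on the bidual.\<close>

lemma complex_differentiable_AB_extension: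
  fixes f :: "'a::complex_normed_vector \<Rightarrow> complex"
  assumes f: "holomorphic_ball f" and M: "\<And>z. z \<in> ball 0 1 \<Longrightarrow> cmod (f z) \<le> M" and z: "norm z < 1"
  shows "complex_differentiable (AB_extension f) z"
proof -
  let ?A = "derivative_form f"
  define \<rho> where "\<rho> = (1 - norm z) / 2"
  define r where "r = (1 + norm z) / 2"
  have M0: "0 \<le> M"
    using order_trans[OF norm_ge_zero M[of 0]] by simp
  have \<rho>: "\<rho> > 0" and r: "0 \<le> r" "r < 1"
    using z norm_ge_zero[of z] by (simp_all add: \<rho>_def r_def add_nonneg_nonneg)
  have in_r: "norm y \<le> r" if "y \<in> ball z \<rho>" for y
    using that norm_triangle_sub[of y z] by (simp add: \<rho>_def r_def dist_norm norm_minus_commute field_simps)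
  have "uniform_limit (ball z \<rho>) (\<lambda>n y. \<Sum>k<n. AB_form (?A k) (replicate k y)) (\<lambda>y. \<Sum>k. AB_form (?A k) (replicate k y)) sequentially"
  proof (rule Weierstrass_m_test)
    fix k y assume y: "y \<in> ball z \<rho>"
    have "cmod (AB_form (?A k) (replicate k y)) \<le> M * norm y ^ k"
      by (rule AB_form_diagonal_bound[OF f M])
    also have "\<dots> \<le> M * r ^ k"
      using in_r[OF y] M0 by (intro mult_left_mono power_mono) auto
    finally show "cmod (AB_form (?A k) (replicate k y)) \<le> M * r ^ k" .
  qed (use r in \<open>intro summable_mult summable_geometric, simp\<close>)
  moreover have "(\<Sum>k. AB_form (?A k) (replicate k y)) = AB_extension f y" if "y \<in> ball z \<rho>" for y
  proof -
    have "norm y < 1" using in_r[OF that] r by linarith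
    then show ?thesis
      using AB_extension_sums[OF f M, of y] by (simp add: sums_iff)
  qed
  ultimately have lim: "uniform_limit (ball z \<rho>) (\<lambda>n y. \<Sum>k<n. AB_form (?A k) (replicate k y)) (AB_extension f) sequentially"
    by (subst (asm) uniform_limit_cong'[OF refl]) auto
  show ?thesis
    by (rule uniform_limit_complex_differentiable(1)[OF \<rho> _ lim])
      (intro complex_differentiable_sum complex_differentiable_diagonal multilinear_form_AB_form
        symmetric_form_multilinear symmetric_form_derivative_form[OF f M])
qed

lemma HL0_holomorphic: "holomorphic_ball (HL0_apply f)"
  using HL0_apply[of f] by auto

lemma HL0_lipschitz_norm:
  assumes "x \<in> ball 0 1" "y \<in> ball 0 1"
  shows "norm (HL0_apply f x - HL0_apply f y) \<le> norm f * norm (x - y)"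
  using lipschitz_onD[OF HL0_lipschitz assms] by (simp add: norm_HL0.rep_eq dist_norm)

lemma HL0_norm_le:
  assumes "C \<ge> 0" "\<And>x y. x \<in> ball 0 1 \<Longrightarrow> y \<in> ball 0 1 \<Longrightarrow> norm (HL0_apply f x - HL0_apply f y) \<le> C * norm (x - y)"
  shows "norm f \<le> C"
  unfolding norm_HL0.rep_eq using assms by (intro lipschitz_const_le lipschitz_onI) (auto simp: dist_norm)

lemma complex_differentiable_cong:
  assumes "open U" "x \<in> U" "\<And>y. y \<in> U \<Longrightarrow> f y = g y" "complex_differentiable f x"
  shows "complex_differentiable g x"
  using assms has_derivative_transform_within_open unfolding complex_differentiable_def by blast

lemma ex_HL0:
  fixes f :: "'a::complex_normed_vector \<Rightarrow> complex"
  assumes diff: "\<And>x. x \<in> ball 0 1 \<Longrightarrow> complex_differentiable f x" and C: "C \<ge> 0"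
    and lip: "\<And>x y. x \<in> ball 0 1 \<Longrightarrow> y \<in> ball 0 1 \<Longrightarrow> cmod (f x - f y) \<le> C * norm (x - y)"
    and zero: "f 0 = 0"
  obtains F where "\<And>x. x \<in> ball 0 1 \<Longrightarrow> HL0_apply F x = f x" "norm F \<le> C"
proof -
  define g where "g x = (if x \<in> ball 0 1 then f x else 0)" for x
  have g: "g x = f x" if "x \<in> ball 0 1" for x
    using that by (simp add: g_def)
  have "holomorphic_ball g"
    unfolding holomorphic_ball_iff
    using complex_differentiable_cong[OF open_ball _ g[symmetric] diff] by blast
  moreover have "C-lipschitz_on (ball 0 1) g"
    using lip C by (intro lipschitz_onI) (auto simp: g dist_norm)
  ultimately have F: "HL0_apply (Abs_HL0 g) = g"
    by (intro Abs_HL0_inverse) (auto simp: g_def zero)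
  show thesis
  proof (rule that[of "Abs_HL0 g"])
    show "norm (Abs_HL0 g) \<le> C"
      using lip C by (intro HL0_norm_le) (auto simp: F g)
  qed (simp add: F g)
qed

text \<open>The choice is unique, since elements of \<open>HL0\<close> vanish outside the ball.\<close>

definition HL0_extension :: "('a::complex_normed_vector, complex) HL0 \<Rightarrow> ('a bidual, complex) HL0"
  where "HL0_extension f = (SOME F. norm F \<le> norm f \<and> (\<forall>z\<in>ball 0 1. HL0_apply F z = AB_extension (HL0_apply f) z))"

lemma AB_extension_zero:
  fixes f :: "'a::complex_normed_vector \<Rightarrow> complex"
  assumes f: "holomorphic_ball f" and M: "\<And>z. z \<in> ball 0 1 \<Longrightarrow> cmod (f z) \<le> M"
  shows "AB_extension f 0 = f 0"
proof -
  have "AB_form (derivative_form f k) (replicate k 0) = (if k = 0 then f 0 else 0)" for k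
    using AB_form_diagonal_bound[OF f M, of k 0] by (cases k) (auto simp: derivative_form_def)
  then have "(\<lambda>k. if k = 0 then f 0 else 0) sums AB_extension f 0"
    using AB_extension_sums[OF f M, of 0] by simp
  moreover have "(\<lambda>k. if k = 0 then f 0 else 0) sums f 0"
    using sums_single[of 0 "\<lambda>k. f 0"] by simp
  ultimately show ?thesis
    by (rule sums_unique2)
qed

lemma HL0_extension:
  fixes f :: "('a::complex_normed_vector, complex) HL0"
  shows norm_HL0_extension: "norm (HL0_extension f) \<le> norm f"
    and HL0_extension_apply: "z \<in> ball 0 1 \<Longrightarrow> HL0_apply (HL0_extension f) z = AB_extension (HL0_apply f) z"
proof -
  note f = HL0_holomorphic[of f]
  obtain F where "\<And>z. z \<in> ball 0 1 \<Longrightarrow> HL0_apply F z = AB_extension (HL0_apply f) z" "norm F \<le> norm f"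
  proof (rule ex_HL0[of "AB_extension (HL0_apply f)" "norm f"])
    show "complex_differentiable (AB_extension (HL0_apply f)) z" if "z \<in> ball 0 1" for z
      using that by (intro complex_differentiable_AB_extension[OF f HL0_apply_bound]) simp
    show "cmod (AB_extension (HL0_apply f) z - AB_extension (HL0_apply f) w) \<le> norm f * norm (z - w)"
      if "z \<in> ball 0 1" "w \<in> ball 0 1" for z w
      using that by (intro AB_extension_lipschitz[OF f HL0_apply_bound HL0_lipschitz_norm]) auto
    show "AB_extension (HL0_apply f) 0 = 0"
      using AB_extension_zero[OF f HL0_apply_bound] by simp
  qed auto
  then have "\<exists>F. norm F \<le> norm f \<and> (\<forall>z\<in>ball 0 1. HL0_apply F z = AB_extension (HL0_apply f) z)"
    by blast
  from someI_ex[OF this] show "norm (HL0_extension f) \<le> norm f"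
    "z \<in> ball 0 1 \<Longrightarrow> HL0_apply (HL0_extension f) z = AB_extension (HL0_apply f) z"
    unfolding HL0_extension_def by blast+
qed

lemma has_taylor_forms_lincomb:
  fixes f g :: "'a::complex_normed_vector \<Rightarrow> complex"
  assumes "has_taylor_forms f A" "has_taylor_forms g B"
  shows "has_taylor_forms (\<lambda>x. f x + c * g x) (\<lambda>k xs. A k xs + c * B k xs)"
proof -
  obtain r where r: "r > 0" "uniform_limit (ball 0 r) (\<lambda>n x. \<Sum>k<n. A k (replicate k x)) f sequentially"
    using assms(1) by (auto simp: has_taylor_forms_def)
  obtain q where q: "q > 0" "uniform_limit (ball 0 q) (\<lambda>n x. \<Sum>k<n. B k (replicate k x)) g sequentially"
    using assms(2) by (auto simp: has_taylor_forms_def)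
  have "uniform_limit (ball 0 (min r q)) (\<lambda>n x. (\<Sum>k<n. A k (replicate k x)) + c * (\<Sum>k<n. B k (replicate k x)))
      (\<lambda>x. f x + c * g x) sequentially"
    by (intro uniform_limit_add bounded_linear.uniform_limit[OF bounded_linear_mult_right]
        uniform_limit_on_subset[OF r(2)] uniform_limit_on_subset[OF q(2)]) auto
  then show ?thesis
    using assms r(1) q(1) unfolding has_taylor_forms_def
    by (intro conjI allI exI[of _ "min r q"] symmetric_form_lincomb)
      (simp_all add: sum.distrib sum_distrib_left)
qed

lemma HL0_extension_lincomb:
  fixes f g :: "('a::complex_normed_vector, complex) HL0"
  shows "HL0_extension (f + c *\<^sub>C g) = HL0_extension f + c *\<^sub>C HL0_extension g"
proof (rule HL0_eqI)
  fix z :: "'a bidual"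
  show "HL0_apply (HL0_extension (f + c *\<^sub>C g)) z = HL0_apply (HL0_extension f + c *\<^sub>C HL0_extension g) z"
  proof (cases "z \<in> ball 0 1")
    case True
    have T: "has_taylor_forms (HL0_apply h) (derivative_form (HL0_apply h))" for h :: "('a, complex) HL0"
      by (rule has_taylor_forms_derivative_form[OF HL0_holomorphic HL0_apply_bound])
    have sums: "(\<lambda>k. AB_form (derivative_form (HL0_apply h) k) (replicate k z)) sums AB_extension (HL0_apply h) z"
      for h :: "('a, complex) HL0"
      using True by (intro AB_extension_sums[OF HL0_holomorphic HL0_apply_bound]) simp
    have ml: "multilinear_form (length (replicate k z)) (derivative_form (HL0_apply h) k)"
      for k and h :: "('a, complex) HL0"
      unfolding length_replicate
      by (intro symmetric_form_multilinear symmetric_form_derivative_form[OF HL0_holomorphic HL0_apply_bound])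
    have "has_taylor_forms (HL0_apply (f + c *\<^sub>C g))
        (\<lambda>k xs. derivative_form (HL0_apply f) k xs + c * derivative_form (HL0_apply g) k xs)"
      using has_taylor_forms_lincomb[OF T T, of f c g]
      by (simp add: plus_HL0.rep_eq scaleC_HL0.rep_eq)
    then have "derivative_form (HL0_apply (f + c *\<^sub>C g))
        = (\<lambda>k xs. derivative_form (HL0_apply f) k xs + c * derivative_form (HL0_apply g) k xs)"
      by (rule has_taylor_forms_unique[OF T])
    then have "(\<lambda>k. AB_form (derivative_form (HL0_apply f) k) (replicate k z)
        + c * AB_form (derivative_form (HL0_apply g) k) (replicate k z)) sums AB_extension (HL0_apply (f + c *\<^sub>C g)) z"
      using sums[of "f + c *\<^sub>C g"] by (simp add: AB_form_lincomb[OF ml ml])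
    moreover have "(\<lambda>k. AB_form (derivative_form (HL0_apply f) k) (replicate k z)
        + c * AB_form (derivative_form (HL0_apply g) k) (replicate k z))
        sums (AB_extension (HL0_apply f) z + c * AB_extension (HL0_apply g) z)"
      by (intro sums_add sums_mult sums)
    ultimately show ?thesis
      using True sums_unique2 by (simp add: HL0_extension_apply plus_HL0.rep_eq scaleC_HL0.rep_eq)
  qed (simp add: HL0_outside plus_HL0.rep_eq scaleC_HL0.rep_eq)
qed


section \<open>Composition with finite-rank operators\<close>

definition HL0_compose ::
  "('a::complex_normed_vector, 'b::complex_normed_vector) cblinfun \<Rightarrow> ('b, complex) HL0 \<Rightarrow> ('a, complex) HL0"
  where "HL0_compose S g = (SOME F. norm F \<le> norm g \<and> (\<forall>x\<in>ball 0 1. HL0_apply F x = HL0_apply g (cblinfun_apply S x)))"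

lemma contraction_in_ball:
  assumes "norm S \<le> 1" "x \<in> ball 0 1"
  shows "cblinfun_apply S x \<in> ball 0 1"
proof -
  have "norm (cblinfun_apply S x) \<le> 1 * norm x"
    using assms(1) by (intro order_trans[OF cblinfun_norm] mult_right_mono) auto
  with assms(2) show ?thesis by simp
qed

lemma HL0_compose:
  fixes S :: "('a::complex_normed_vector, 'b::complex_normed_vector) cblinfun"
  assumes S: "norm S \<le> 1"
  shows norm_HL0_compose: "norm (HL0_compose S g) \<le> norm g"
    and HL0_compose_apply: "x \<in> ball 0 1 \<Longrightarrow> HL0_apply (HL0_compose S g) x = HL0_apply g (cblinfun_apply S x)"
proof -
  obtain F where "\<And>x. x \<in> ball 0 1 \<Longrightarrow> HL0_apply F x = HL0_apply g (cblinfun_apply S x)" "norm F \<le> norm g"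
  proof (rule ex_HL0[of "\<lambda>x. HL0_apply g (cblinfun_apply S x)" "norm g"])
    fix x :: 'a assume x: "x \<in> ball 0 1"
    obtain D :: "'b dual" where D: "(HL0_apply g has_derivative cblinfun_apply D) (at (cblinfun_apply S x))"
      using HL0_holomorphic[of g] contraction_in_ball[OF S x] unfolding holomorphic_ball_def by blast
    have "(cblinfun_apply S has_derivative cblinfun_apply S) (at x)"
      by (rule bounded_linear_imp_has_derivative[OF cblinfun_bounded_linear])
    from has_derivative_compose[OF this D]
    have d: "((\<lambda>x. HL0_apply g (cblinfun_apply S x)) has_derivative (\<lambda>v. cblinfun_apply D (cblinfun_apply S v))) (at x)" .
    obtain E where "cblinfun_apply E = (\<lambda>v. cblinfun_apply D (cblinfun_apply S v))"
      by (rule ex_cblinfun_compose)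
    with d show "complex_differentiable (\<lambda>x. HL0_apply g (cblinfun_apply S x)) x"
      unfolding complex_differentiable_def by metis
  next
    fix x y :: 'a assume xy: "x \<in> ball 0 1" "y \<in> ball 0 1"
    have "norm (cblinfun_apply S x - cblinfun_apply S y) \<le> 1 * norm (x - y)"
      unfolding cblinfun_diff[symmetric] using S by (intro order_trans[OF cblinfun_norm] mult_right_mono) auto
    then have "norm g * norm (cblinfun_apply S x - cblinfun_apply S y) \<le> norm g * norm (x - y)"
      by (intro mult_left_mono) auto
    then show "cmod (HL0_apply g (cblinfun_apply S x) - HL0_apply g (cblinfun_apply S y)) \<le> norm g * norm (x - y)"
      using HL0_lipschitz_norm[of "cblinfun_apply S x" "cblinfun_apply S y" g] contraction_in_ball[OF S] xy
      by fastforce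
  qed auto
  then have "\<exists>F. norm F \<le> norm g \<and> (\<forall>x\<in>ball 0 1. HL0_apply F x = HL0_apply g (cblinfun_apply S x))"
    by blast
  from someI_ex[OF this] show "norm (HL0_compose S g) \<le> norm g"
    "x \<in> ball 0 1 \<Longrightarrow> HL0_apply (HL0_compose S g) x = HL0_apply g (cblinfun_apply S x)"
    unfolding HL0_compose_def by blast+
qed

lemma HL0_compose_lincomb:
  assumes S: "norm S \<le> 1"
  shows "HL0_compose S (f + c *\<^sub>C g) = HL0_compose S f + c *\<^sub>C HL0_compose S g"
proof (rule HL0_eqI)
  fix x
  show "HL0_apply (HL0_compose S (f + c *\<^sub>C g)) x = HL0_apply (HL0_compose S f + c *\<^sub>C HL0_compose S g) x"
    by (cases "x \<in> ball 0 1")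
      (simp_all add: HL0_compose_apply[OF S] plus_HL0.rep_eq scaleC_HL0.rep_eq HL0_outside del: mem_ball_0)
qed

lemma symmetric_form_compose:
  fixes S :: "('a::complex_normed_vector, 'b::complex_normed_vector) cblinfun"
  assumes B: "symmetric_form k B"
  shows "symmetric_form k (\<lambda>xs. B (map (cblinfun_apply S) xs))"
  unfolding symmetric_form_def
proof (intro conjI allI impI)
  note mB = symmetric_form_multilinear[OF B]
  fix us vs :: "'a list" and x y c assume l: "length us + 1 + length vs = k"
  show "B (map (cblinfun_apply S) (us @ (x + y) # vs)) = B (map (cblinfun_apply S) (us @ x # vs)) + B (map (cblinfun_apply S) (us @ y # vs))"
    using multilinear_form_add_at[OF mB, of "map (cblinfun_apply S) us" "map (cblinfun_apply S) vs"] l by simp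
  show "B (map (cblinfun_apply S) (us @ (c *\<^sub>C x) # vs)) = c * B (map (cblinfun_apply S) (us @ x # vs))"
    using multilinear_form_scale_at[OF mB, of "map (cblinfun_apply S) us" "map (cblinfun_apply S) vs"] l by simp
next
  obtain C where C: "C \<ge> 0" "\<And>xs. length xs = k \<Longrightarrow> cmod (B xs) \<le> C * prod_list (map norm xs)"
    using multilinear_form_bound[OF symmetric_form_multilinear[OF B]] by blast
  have prod: "prod_list (map norm (map (cblinfun_apply S) xs)) \<le> norm S ^ length xs * prod_list (map norm xs)" for xs
  proof (induction xs)
    case (Cons x xs)
    have "norm (cblinfun_apply S x) * prod_list (map norm (map (cblinfun_apply S) xs))
        \<le> (norm S * norm x) * (norm S ^ length xs * prod_list (map norm xs))"
      by (intro mult_mono Cons.IH cblinfun_norm) (auto intro!: prod_list_nonneg)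
    then show ?case by (simp add: mult_ac)
  qed simp
  have "cmod (B (map (cblinfun_apply S) xs)) \<le> C * norm S ^ k * prod_list (map norm xs)" if "length xs = k" for xs
    using C(2)[of "map (cblinfun_apply S) xs"] mult_left_mono[OF prod[of xs] C(1)] that by (simp add: mult.assoc)
  then show "\<exists>C. \<forall>xs. length xs = k \<longrightarrow> cmod (B (map (cblinfun_apply S) xs)) \<le> C * prod_list (map norm xs)"
    by blast
next
  fix xs ys :: "'a list" assume "length xs = k \<and> mset xs = mset ys"
  then show "B (map (cblinfun_apply S) xs) = B (map (cblinfun_apply S) ys)"
    by (intro symmetric_form_mset[OF B]) (auto simp: mset_map)
next
  fix xs :: "'a list" assume "length xs \<noteq> k"
  then show "B (map (cblinfun_apply S) xs) = 0"
    by (intro symmetric_form_outside[OF B]) simp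
qed

text \<open>By uniqueness, the Taylor forms of \<open>g \<circ> S\<close> are those of \<open>g\<close> with \<open>S\<close> applied to all
  arguments. Their extensions at \<open>z\<close> are the terms of the Taylor series of \<open>g\<close> at the image of
  \<open>z\<close>, which lies in the ball, where that series has the sum \<open>g\<close>.\<close>

lemma AB_extension_finite_rank:
  fixes S :: "('a::complex_normed_vector, 'b::complex_normed_vector) cblinfun"
  assumes S: "norm S \<le> 1" and S_eq: "\<And>x. cblinfun_apply S x = (\<Sum>i\<in>I. cblinfun_apply (\<phi> i) x *\<^sub>C m i)"
    and z: "norm (\<Sum>i\<in>I. cblinfun_apply z (\<phi> i) *\<^sub>C m i) < 1"
  shows "AB_extension (HL0_apply (HL0_compose S g)) z = HL0_apply g (\<Sum>i\<in>I. cblinfun_apply z (\<phi> i) *\<^sub>C m i)"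
proof -
  let ?D = "derivative_form (HL0_apply g)"
  let ?B = "\<lambda>k xs. ?D k (map (cblinfun_apply S) xs)"
  have D: "symmetric_form k (?D k)" for k
    by (rule symmetric_form_derivative_form[OF HL0_holomorphic HL0_apply_bound])
  obtain r where r: "r > 0" "uniform_limit (ball 0 r) (\<lambda>n y. \<Sum>k<n. ?D k (replicate k y)) (HL0_apply g) sequentially"
    using has_taylor_forms_derivative_form[OF HL0_holomorphic HL0_apply_bound, of g]
    unfolding has_taylor_forms_def by blast
  have "norm (cblinfun_apply S x) \<le> norm x" for x
    using order_trans[OF cblinfun_norm mult_right_mono[OF S norm_ge_zero]] by simp
  then have "cblinfun_apply S x \<in> ball 0 r" if "x \<in> ball 0 (min r 1)" for x
    using order_le_less_trans[of "norm (cblinfun_apply S x)" "norm x" r] that by simp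
  then have "uniform_limit (ball 0 (min r 1)) (\<lambda>n x. \<Sum>k<n. ?D k (replicate k (cblinfun_apply S x)))
      (\<lambda>x. HL0_apply g (cblinfun_apply S x)) sequentially"
    by (intro uniform_limit_compose'[OF r(2)] Pi_I)
  then have lim: "uniform_limit (ball 0 (min r 1)) (\<lambda>n x. \<Sum>k<n. ?B k (replicate k x))
      (HL0_apply (HL0_compose S g)) sequentially"
    by (subst (asm) uniform_limit_cong'[of _ _ "\<lambda>n x. \<Sum>k<n. ?B k (replicate k x)"])
      (auto simp: HL0_compose_apply[OF S])
  have "has_taylor_forms (HL0_apply (HL0_compose S g)) ?B"
    unfolding has_taylor_forms_def
  proof (intro conjI allI exI[of _ "min r 1"])
    show "symmetric_form k (?B k)" for k
      by (rule symmetric_form_compose[OF D])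
  qed (use r(1) lim in auto)
  then have T: "taylor_form (HL0_apply (HL0_compose S g)) = ?B"
    by (rule taylor_form_eqI)
  let ?z = "\<Sum>i\<in>I. cblinfun_apply z (\<phi> i) *\<^sub>C m i"
  have "AB_form (?B k) (replicate k z) = ?D k (replicate k ?z)" for k
  proof -
    have S_fun: "cblinfun_apply S = (\<lambda>x. \<Sum>i\<in>I. cblinfun_apply (\<phi> i) x *\<^sub>C m i)"
      using S_eq by blast
    show ?thesis
      unfolding S_fun using AB_form_finite_rank[where zs = "replicate k z" and B = "?D k" and I = I and \<phi> = \<phi> and m = m] symmetric_form_multilinear[OF D]
      by simp
  qed
  then have "AB_extension (HL0_apply (HL0_compose S g)) z = (\<Sum>k. ?D k (replicate k ?z))"
    by (simp add: AB_extension_def T)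
  also have "\<dots> = HL0_apply g ?z"
    using derivative_form_sums[OF HL0_holomorphic z] by (simp add: sums_iff)
  finally show ?thesis .
qed


section \<open>The predual\<close>

lemma minus_HL0_apply: "HL0_apply (f - g) x = HL0_apply f x - HL0_apply g x"
  for f g :: "('a::complex_normed_vector, complex) HL0"
  unfolding minus_HL0_def plus_HL0.rep_eq scaleC_HL0.rep_eq by simp

declare plus_HL0.rep_eq [simp] scaleC_HL0.rep_eq [simp] minus_HL0_apply [simp] zero_HL0.rep_eq [simp]
  plus_G0.rep_eq [simp] minus_G0.rep_eq [simp] scaleC_G0.rep_eq [simp] zero_G0.rep_eq [simp]
  HL0_eval.rep_eq [simp] delta.rep_eq [simp] HL0_pairing.rep_eq [simp]

lemma G0_functional_sum: "G0_functional (\<Sum>i\<in>I. f i) = (\<Sum>i\<in>I. G0_functional (f i))"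
  by (induction I rule: infinite_finite_induct) auto

lemma G0_eqI: "(\<And>f. cblinfun_apply (G0_functional \<phi>) f = cblinfun_apply (G0_functional \<psi>) f) \<Longrightarrow> \<phi> = \<psi>"
  unfolding G0_functional_inject[symmetric] by (rule cblinfun_eqI)

lemma G0_norm_le:
  assumes "C \<ge> 0" "\<And>f. cmod (cblinfun_apply (G0_functional \<phi>) f) \<le> C * norm f"
  shows "norm \<phi> \<le> C"
  unfolding norm_G0.rep_eq using assms by (intro cblinfun_norm_le) auto

lemma G0_functional_norm: "cmod (cblinfun_apply (G0_functional \<phi>) f) \<le> norm \<phi> * norm f"
  unfolding norm_G0.rep_eq by (rule cblinfun_norm)

text \<open>Since the unit ball of \<open>HL0\<close> is equi-Lipschitz, every neighbourhood in it for the
  compact-open topology is given by finitely many points.\<close>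

lemma tau0_finite_neighbourhood:
  fixes f0 :: "('a::complex_normed_vector, complex) HL0"
  assumes "openin tau0 U" "f0 \<in> U" and f0: "norm f0 \<le> 1"
  shows "\<exists>F \<eta>. finite F \<and> F \<subseteq> ball 0 1 \<and> 0 < \<eta> \<and>
    (\<forall>g. norm g \<le> 1 \<and> (\<forall>x\<in>F. dist (HL0_apply g x) (HL0_apply f0 x) < \<eta>) \<longrightarrow> g \<in> U)"
  using assms(1,2) unfolding tau0_def openin_topology_generated_by_iff
proof (induction rule: generate_topology_on.induct)
  case Empty
  then show ?case by simp
next
  case (Int U V)
  have "f0 \<in> U" "f0 \<in> V" using Int.prems by simp_all
  from Int.IH(1)[OF \<open>f0 \<in> U\<close>] obtain F \<eta> where F: "finite F" "F \<subseteq> ball 0 1" "0 < \<eta>"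
    "\<forall>g. norm g \<le> 1 \<and> (\<forall>x\<in>F. dist (HL0_apply g x) (HL0_apply f0 x) < \<eta>) \<longrightarrow> g \<in> U"
    by (elim exE conjE)
  from Int.IH(2)[OF \<open>f0 \<in> V\<close>] obtain F' \<eta>' where F': "finite F'" "F' \<subseteq> ball 0 1" "0 < \<eta>'"
    "\<forall>g. norm g \<le> 1 \<and> (\<forall>x\<in>F'. dist (HL0_apply g x) (HL0_apply f0 x) < \<eta>') \<longrightarrow> g \<in> V"
    by (elim exE conjE)
  show ?case
  proof (intro exI conjI allI impI)
    show "finite (F \<union> F')" "F \<union> F' \<subseteq> ball 0 1" "0 < min \<eta> \<eta>'"
      using F(1-3) F'(1-3) by simp_all
    fix g assume g: "norm g \<le> 1 \<and> (\<forall>x\<in>F \<union> F'. dist (HL0_apply g x) (HL0_apply f0 x) < min \<eta> \<eta>')"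
    then have "g \<in> U"
      by (intro F(4)[rule_format]) simp
    moreover have "g \<in> V"
      using g by (intro F'(4)[rule_format]) simp
    ultimately show "g \<in> U \<inter> V" by simp
  qed
next
  case (UN \<U>)
  then obtain U where U: "U \<in> \<U>" "f0 \<in> U" by blast
  from UN.IH[OF U] obtain F \<eta> where F: "finite F" "F \<subseteq> ball 0 1" "0 < \<eta>"
    "\<forall>g. norm g \<le> 1 \<and> (\<forall>x\<in>F. dist (HL0_apply g x) (HL0_apply f0 x) < \<eta>) \<longrightarrow> g \<in> U"
    by (elim exE conjE)
  show ?case
  proof (intro exI conjI allI impI)
    fix g assume "norm g \<le> 1 \<and> (\<forall>x\<in>F. dist (HL0_apply g x) (HL0_apply f0 x) < \<eta>)"
    then have "g \<in> U"
      using F(4) by blast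
    with U(1) show "g \<in> \<Union> \<U>" by blast
  qed (fact F)+
next
  case (Basis U)
  then obtain f K e where U: "U = {g. \<forall>x\<in>K. dist (HL0_apply g x) (HL0_apply f x) < e}"
    and K: "compact K" "K \<subseteq> ball 0 1" and e: "0 < e"
    by blast
  show ?case
  proof (cases "K = {}")
    case True
    then show ?thesis
      unfolding U by (intro exI[of _ "{}"] exI[of _ "1 :: real"]) simp
  next
    case False
    have "continuous_on K (\<lambda>x. dist (HL0_apply f0 x) (HL0_apply f x))"
      using lipschitz_on_continuous_on[OF HL0_lipschitz] continuous_on_subset[OF _ K(2)]
      by (intro continuous_on_dist) blast+
    then obtain x0 where x0: "x0 \<in> K"
      "\<And>x. x \<in> K \<Longrightarrow> dist (HL0_apply f0 x) (HL0_apply f x) \<le> dist (HL0_apply f0 x0) (HL0_apply f x0)"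
      using continuous_attains_sup[OF K(1) False] by blast
    define e' where "e' = dist (HL0_apply f0 x0) (HL0_apply f x0)"
    have e': "e' < e"
      using Basis.prems x0(1) unfolding U e'_def by blast
    \<comment> \<open>One part for the values on the finite net and two for the oscillation of \<open>g\<close> and \<open>f0\<close>;
      the fourth keeps the inequality strict.\<close>
    define \<delta> where "\<delta> = (e - e') / 4"
    have \<delta>: "\<delta> > 0" using e' by (simp add: \<delta>_def)
    obtain F where F: "F \<subseteq> K" "finite F" "K \<subseteq> (\<Union>x\<in>F. ball x \<delta>)"
      using K(1) \<delta> by (elim compactE_image[of K K "\<lambda>x. ball x \<delta>"]) auto
    have "g \<in> U" if g: "norm g \<le> 1" "\<And>x. x \<in> F \<Longrightarrow> dist (HL0_apply g x) (HL0_apply f0 x) < \<delta>" for g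
      unfolding U
    proof (intro CollectI ballI)
      fix x assume x: "x \<in> K"
      then obtain p where p: "p \<in> F" "dist p x < \<delta>"
        using F(3) by auto
      have lip: "dist (HL0_apply h x) (HL0_apply h p) \<le> \<delta>" if "norm h \<le> 1" for h :: "('a, complex) HL0"
      proof -
        have "dist (HL0_apply h x) (HL0_apply h p) \<le> norm h * norm (x - p)"
          unfolding dist_norm using x p(1) F(1) K(2) by (intro HL0_lipschitz_norm) auto
        also have "\<dots> \<le> 1 * \<delta>"
          using that p(2) by (intro mult_mono) (auto simp: dist_norm norm_minus_commute)
        finally show ?thesis by simp
      qed
      have "dist (HL0_apply g x) (HL0_apply f x) \<le> dist (HL0_apply g x) (HL0_apply g p)
          + dist (HL0_apply g p) (HL0_apply f0 p) + dist (HL0_apply f0 p) (HL0_apply f0 x)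
          + dist (HL0_apply f0 x) (HL0_apply f x)"
        using dist_triangle[of "HL0_apply g x" "HL0_apply f x" "HL0_apply g p"]
          dist_triangle[of "HL0_apply g p" "HL0_apply f x" "HL0_apply f0 p"]
          dist_triangle[of "HL0_apply f0 p" "HL0_apply f x" "HL0_apply f0 x"] by linarith
      also have "\<dots> < \<delta> + \<delta> + \<delta> + e'"
        using lip[OF g(1)] g(2)[OF p(1)] lip[OF f0] x0(2)[OF x] by (simp add: e'_def dist_commute)
      also have "\<dots> < e"
        using e' by (simp add: \<delta>_def field_simps)
      finally show "dist (HL0_apply g x) (HL0_apply f x) < e" .
    qed
    moreover have "F \<subseteq> ball 0 1"
      using F(1) K(2) by blast
    ultimately show ?thesis
      using F(2) \<delta> by (intro exI[of _ F] exI[of _ \<delta>]) blast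
  qed
qed

lemma G0_small_on_finite:
  fixes \<phi> :: "'a::complex_normed_vector G0"
  assumes \<epsilon>: "\<epsilon> > 0"
  obtains F \<eta> where "finite F" "F \<subseteq> ball 0 1" "\<eta> > 0"
    "\<And>g. norm g \<le> 1 \<Longrightarrow> (\<And>x. x \<in> F \<Longrightarrow> cmod (HL0_apply g x) < \<eta>) \<Longrightarrow> cmod (cblinfun_apply (G0_functional \<phi>) g) < \<epsilon>"
proof -
  let ?B = "{f :: ('a, complex) HL0. norm f \<le> 1}"
  have "continuous_map (subtopology tau0 ?B) euclidean (cblinfun_apply (G0_functional \<phi>))"
    using G0_functional by blast
  then have "openin (subtopology tau0 ?B) {f \<in> topspace (subtopology tau0 ?B). cblinfun_apply (G0_functional \<phi>) f \<in> ball 0 \<epsilon>}"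
    unfolding continuous_map_def by (elim conjE allE[of _ "ball 0 \<epsilon>"]) simp
  then obtain U where U: "openin tau0 U"
    "{f \<in> topspace (subtopology tau0 ?B). cblinfun_apply (G0_functional \<phi>) f \<in> ball 0 \<epsilon>} = U \<inter> ?B"
    unfolding openin_subtopology by blast
  have "openin tau0 (UNIV :: ('a, complex) HL0 set)"
    unfolding tau0_def by (rule topology_generated_by_Basis) (auto intro!: exI[of _ "{}"] exI[of _ 1])
  then have top: "topspace (tau0 :: ('a, complex) HL0 topology) = UNIV"
    using openin_subset by blast
  have eq: "f \<in> U \<longleftrightarrow> cmod (cblinfun_apply (G0_functional \<phi>) f) < \<epsilon>" if "norm f \<le> 1" for f
  proof -
    have "f \<in> U \<inter> ?B \<longleftrightarrow> cblinfun_apply (G0_functional \<phi>) f \<in> ball 0 \<epsilon>"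
      unfolding U(2)[symmetric] using that by (simp add: top)
    then show ?thesis using that by simp
  qed
  have "0 \<in> U"
    using eq[of 0] \<epsilon> by simp
  from tau0_finite_neighbourhood[OF U(1) this order_trans[OF eq_refl[OF norm_zero] zero_le_one]] obtain F \<eta> where F: "finite F" "F \<subseteq> ball 0 1" "0 < \<eta>"
    "\<forall>g. norm g \<le> 1 \<and> (\<forall>x\<in>F. dist (HL0_apply g x) (HL0_apply 0 x) < \<eta>) \<longrightarrow> g \<in> U"
    by (elim exE conjE)
  show thesis
  proof (rule that[OF F(1-3)])
    fix g :: "('a, complex) HL0" assume g: "norm g \<le> 1" "\<And>x. x \<in> F \<Longrightarrow> cmod (HL0_apply g x) < \<eta>"
    then have "g \<in> U"
      by (intro F(4)[rule_format]) simp
    then show "cmod (cblinfun_apply (G0_functional \<phi>) g) < \<epsilon>"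
      using eq[OF g(1)] by simp
  qed
qed

text \<open>If \<open>\<phi>\<close> is at most \<open>\<epsilon>\<close> on the unit ball of a subspace of finite codimension given by
  evaluations, then the norm-preserving extension of this restriction differs from \<open>\<phi>\<close> by a
  combination of evaluations.\<close>

theorem delta_span_dense:
  fixes \<phi> :: "'a::complex_normed_vector G0"
  assumes \<epsilon>: "\<epsilon> > 0"
  obtains F c where "finite F" "F \<subseteq> ball 0 1" "norm (\<phi> - (\<Sum>x\<in>F. c x *\<^sub>C delta x)) \<le> \<epsilon>"
proof -
  obtain F \<eta> where F: "finite F" "F \<subseteq> ball 0 1" "\<eta> > 0"
    "\<And>g. norm g \<le> 1 \<Longrightarrow> (\<And>x. x \<in> F \<Longrightarrow> cmod (HL0_apply g x) < \<eta>) \<Longrightarrow> cmod (cblinfun_apply (G0_functional \<phi>) g) < \<epsilon>"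
    by (rule G0_small_on_finite[OF \<epsilon>, of \<phi>]) blast
  define S where "S = {g :: ('a, complex) HL0. \<forall>x\<in>F. HL0_apply g x = 0}"
  have S: "complex_vector.subspace S"
    by (auto simp: complex_vector.subspace_def S_def)
  have le: "cmod (cblinfun_apply (G0_functional \<phi>) g) \<le> \<epsilon> * norm g" if g: "g \<in> S" for g
  proof (cases "g = 0")
    case False
    define g' where "g' = complex_of_real (inverse (norm g)) *\<^sub>C g"
    have "cmod (cblinfun_apply (G0_functional \<phi>) g') < \<epsilon>"
      using g False F(3) by (intro F(4)) (auto simp: g'_def S_def norm_scaleC norm_inverse)
    then show ?thesis
      using False by (simp add: g'_def norm_divide field_simps)
  qed simp
  obtain h where h: "\<And>g. g \<in> S \<Longrightarrow> cblinfun_apply h g = cblinfun_apply (G0_functional \<phi>) g" "norm h \<le> \<epsilon>"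
  proof (rule hahn_banach_dual[OF S _ le])
    show "clinear_on scaleC S (cblinfun_apply (G0_functional \<phi>))"
      by (simp add: clinear_on_def)
  qed (use \<epsilon> in auto)
  have "\<exists>c. \<forall>g. cblinfun_apply (G0_functional \<phi> - h) g = (\<Sum>x\<in>F. c x * HL0_apply g x)"
    by (rule functional_combination[OF complex_vector.vector_space_axioms F(1)])
      (auto simp: clinear_on_def h(1) S_def algebra_simps)
  then obtain c where c: "\<And>g. cblinfun_apply (G0_functional \<phi> - h) g = (\<Sum>x\<in>F. c x * HL0_apply g x)"
    by blast
  have "G0_functional (\<phi> - (\<Sum>x\<in>F. c x *\<^sub>C delta x)) = h"
  proof (rule cblinfun_eqI)
    fix g
    show "cblinfun_apply (G0_functional (\<phi> - (\<Sum>x\<in>F. c x *\<^sub>C delta x))) g = cblinfun_apply h g"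
      using c[of g] by (simp add: G0_functional_sum cblinfun_sum_apply algebra_simps)
  qed
  with h(2) have "norm (\<phi> - (\<Sum>x\<in>F. c x *\<^sub>C delta x)) \<le> \<epsilon>"
    by (simp only: norm_G0.rep_eq)
  with F(1,2) show thesis by (rule that)
qed

text \<open>By density, operators on the predual are determined by their values at evaluations.\<close>

lemma G0_operator_eqI:
  fixes S T :: "('a::complex_normed_vector G0, 'b::complex_normed_vector) cblinfun"
  assumes eq: "\<And>x. x \<in> ball 0 1 \<Longrightarrow> cblinfun_apply S (delta x) = cblinfun_apply T (delta x)"
  shows "S = T"
proof -
  have "cblinfun_apply (S - T) \<phi> = 0" for \<phi>
  proof -
    have "norm (cblinfun_apply (S - T) \<phi>) \<le> e" if e: "e > 0" for e
    proof -
      have "e / (norm (S - T) + 1) > 0"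
        using e by (simp add: add_nonneg_pos)
      then obtain F c where F: "finite F" "F \<subseteq> ball 0 1" "norm (\<phi> - (\<Sum>x\<in>F. c x *\<^sub>C delta x)) \<le> e / (norm (S - T) + 1)"
        by (rule delta_span_dense[of _ \<phi>]) blast
      have "cblinfun_apply (S - T) (\<Sum>x\<in>F. c x *\<^sub>C delta x) = (\<Sum>x\<in>F. c x *\<^sub>C cblinfun_apply (S - T) (delta x))"
        unfolding cblinfun_sum by (intro sum.cong refl cblinfun_scaleC)
      also have "\<dots> = 0"
        using F(2) eq by (intro sum.neutral) auto
      finally have "cblinfun_apply (S - T) \<phi> = cblinfun_apply (S - T) (\<phi> - (\<Sum>x\<in>F. c x *\<^sub>C delta x))"
        unfolding cblinfun_diff by simp
      also have "norm \<dots> \<le> norm (S - T) * norm (\<phi> - (\<Sum>x\<in>F. c x *\<^sub>C delta x))"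
        by (rule cblinfun_norm)
      also have "\<dots> \<le> (norm (S - T) + 1) * (e / (norm (S - T) + 1))"
        using F(3) by (intro mult_mono) auto
      also have "\<dots> = e"
        using norm_ge_zero[of "S - T"] by (simp add: add_nonneg_eq_0_iff)
      finally show ?thesis .
    qed
    then have "norm (cblinfun_apply (S - T) \<phi>) \<le> 0"
      by (rule field_le_epsilon) simp
    then show ?thesis by simp
  qed
  then show ?thesis
    by (intro cblinfun_eqI) simp
qed

text \<open>Continuity on the unit ball is tested on differences of two of its elements, hence the radius
  2.\<close>

lemma ex_G0:
  fixes \<Psi> :: "('a::complex_normed_vector, complex) HL0 dual"
  assumes small: "\<And>\<epsilon>. \<epsilon> > 0 \<Longrightarrow> \<exists>K \<eta>. compact K \<and> K \<subseteq> ball 0 1 \<and> \<eta> > 0 \<and>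
    (\<forall>g. norm g \<le> 2 \<and> (\<forall>x\<in>K. cmod (HL0_apply g x) < \<eta>) \<longrightarrow> cmod (cblinfun_apply \<Psi> g) < \<epsilon>)"
  obtains \<phi> where "G0_functional \<phi> = \<Psi>"
proof -
  let ?B = "{f :: ('a, complex) HL0. norm f \<le> 1}"
  have "continuous_map (subtopology tau0 ?B) euclidean (cblinfun_apply \<Psi>)"
    unfolding continuous_map_def
  proof (intro conjI allI impI)
    fix U :: "complex set" assume "openin euclidean U"
    then have U: "open U" by simp
    show "openin (subtopology tau0 ?B) {f \<in> topspace (subtopology tau0 ?B). cblinfun_apply \<Psi> f \<in> U}"
    proof (subst openin_subopen, clarify)
      fix f assume f: "f \<in> topspace (subtopology tau0 ?B)" "cblinfun_apply \<Psi> f \<in> U"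
      then obtain e where e: "e > 0" "ball (cblinfun_apply \<Psi> f) e \<subseteq> U"
        using U open_contains_ball by blast
      obtain K \<eta> where K: "compact K" "K \<subseteq> ball 0 1" "\<eta> > 0"
        "\<And>g. norm g \<le> 2 \<Longrightarrow> (\<forall>x\<in>K. cmod (HL0_apply g x) < \<eta>) \<Longrightarrow> cmod (cblinfun_apply \<Psi> g) < e"
        using small[OF e(1)] by blast
      let ?T = "{g. \<forall>x\<in>K. dist (HL0_apply g x) (HL0_apply f x) < \<eta>}"
      have T: "openin tau0 ?T"
        unfolding tau0_def using K(1-3) by (intro topology_generated_by_Basis) blast
      then have "openin (subtopology tau0 ?B) (?T \<inter> ?B)"
        by (rule openin_subtopology_Int)
      moreover have "f \<in> ?T \<inter> ?B"
        using f(1) K(3) by auto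
      moreover have "?T \<inter> ?B \<subseteq> {f \<in> topspace (subtopology tau0 ?B). cblinfun_apply \<Psi> f \<in> U}"
      proof
        fix g assume g: "g \<in> ?T \<inter> ?B"
        have "norm (g - f) \<le> 2"
          using f(1) g norm_triangle_ineq4[of g f] by simp
        then have "cmod (cblinfun_apply \<Psi> (g - f)) < e"
          using g by (intro K(4)) (simp_all add: dist_norm)
        then have "cblinfun_apply \<Psi> g \<in> ball (cblinfun_apply \<Psi> f) e"
          by (simp add: dist_norm norm_minus_commute)
        then show "g \<in> {f \<in> topspace (subtopology tau0 ?B). cblinfun_apply \<Psi> f \<in> U}"
          using subsetD[OF e(2)] g subsetD[OF openin_subset[OF T], of g] by simp
      qed
      ultimately show "\<exists>T. openin (subtopology tau0 ?B) T \<and> f \<in> T \<and>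
          T \<subseteq> {f \<in> topspace (subtopology tau0 ?B). cblinfun_apply \<Psi> f \<in> U}"
        by blast
    qed
  qed simp
  then show thesis
    by (intro that[of "Abs_G0 \<Psi>"] Abs_G0_inverse) simp
qed

text \<open>The predual is closed: a uniform limit of continuous functions on the unit ball is
  continuous.\<close>

lemma G0_closed:
  fixes \<Psi> :: "('a::complex_normed_vector, complex) HL0 dual"
  assumes approx: "\<And>\<epsilon>. \<epsilon> > 0 \<Longrightarrow> \<exists>\<phi>. norm (\<Psi> - G0_functional \<phi>) \<le> \<epsilon>"
  obtains \<phi> where "G0_functional \<phi> = \<Psi>"
proof (rule ex_G0[of \<Psi>])
  fix \<epsilon> :: real assume \<epsilon>: "\<epsilon> > 0"
  obtain \<phi> where \<phi>: "norm (\<Psi> - G0_functional \<phi>) \<le> \<epsilon> / 4"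
    using approx[of "\<epsilon> / 4"] \<epsilon> by auto
  have "\<epsilon> / 4 > 0" using \<epsilon> by simp
  then obtain F \<eta> where F: "finite F" "F \<subseteq> ball 0 1" "\<eta> > 0"
    "\<And>g. norm g \<le> 1 \<Longrightarrow> (\<And>x. x \<in> F \<Longrightarrow> cmod (HL0_apply g x) < \<eta>) \<Longrightarrow> cmod (cblinfun_apply (G0_functional \<phi>) g) < \<epsilon> / 4"
    by (rule G0_small_on_finite[of _ \<phi>]) blast
  have "cmod (cblinfun_apply \<Psi> g) < \<epsilon>" if g: "norm g \<le> 2" "\<And>x. x \<in> F \<Longrightarrow> cmod (HL0_apply g x) < \<eta>" for g
  proof -
    have "cmod (cblinfun_apply (G0_functional \<phi>) ((1/2) *\<^sub>C g)) < \<epsilon> / 4"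
      using g F(3) by (intro F(4)) (auto simp: norm_scaleC norm_divide dest!: g(2))
    then have "cmod (cblinfun_apply (G0_functional \<phi>) g) < \<epsilon> / 2"
      by (simp add: norm_divide)
    moreover have "cmod (cblinfun_apply (\<Psi> - G0_functional \<phi>) g) \<le> \<epsilon> / 4 * 2"
      using \<phi> g(1) \<epsilon> by (intro order_trans[OF cblinfun_norm] mult_mono) auto
    ultimately show ?thesis
      using norm_triangle_sub[of "cblinfun_apply \<Psi> g" "cblinfun_apply (G0_functional \<phi>) g"] by simp
  qed
  then show "\<exists>K \<eta>. compact K \<and> K \<subseteq> ball 0 1 \<and> \<eta> > 0 \<and>
    (\<forall>g. norm g \<le> 2 \<and> (\<forall>x\<in>K. cmod (HL0_apply g x) < \<eta>) \<longrightarrow> cmod (cblinfun_apply \<Psi> g) < \<epsilon>)"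
    using F(1-3) by (intro exI[of _ F] exI[of _ \<eta>]) (auto intro: finite_imp_compact)
qed (rule that)

lemma norm_delta_diff: "x \<in> ball 0 1 \<Longrightarrow> y \<in> ball 0 1 \<Longrightarrow> norm (delta x - delta y) \<le> norm (x - y)"
  by (rule G0_norm_le) (auto simp: mult.commute intro: order_trans[OF HL0_lipschitz_norm])

text \<open>The map \<open>x \<mapsto> \<delta> x\<close> is holomorphic: its derivative at \<open>x\<close> sends \<open>v\<close> to the functional
  \<open>f \<mapsto> f' x v\<close>, which belongs to the predual as a norm limit of difference quotients.\<close>

lemma delta_has_derivative:
  fixes x :: "'a::complex_normed_vector"
  assumes x: "x \<in> ball 0 1"
  obtains D :: "('a, 'a G0) cblinfun" where "(delta has_derivative cblinfun_apply D) (at x)"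
proof -
  define \<rho> where "\<rho> = 1 - norm x"
  have \<rho>: "\<rho> > 0" using x by (simp add: \<rho>_def)
  have sub: "y \<in> ball 0 1" if "y \<in> ball x \<rho>" for y
    using that norm_triangle_sub[of y x] by (simp add: \<rho>_def dist_norm norm_minus_commute)
  have diff: "complex_differentiable (HL0_apply f) y" if "y \<in> ball x \<rho>" for f :: "('a, complex) HL0" and y
    using HL0_holomorphic[of f] sub[OF that] unfolding holomorphic_ball_iff by blast
  have xx: "x \<in> ball x \<rho>" using \<rho> by simp
  have est: "cmod (directional_derivative w (HL0_apply f) x) \<le> norm w / \<rho> * norm f"
    "norm w \<le> \<rho> / 2 \<Longrightarrow> cmod (HL0_apply f (x + w) - HL0_apply f x - directional_derivative w (HL0_apply f) x)
      \<le> 32 / \<rho>\<^sup>2 * (norm w)\<^sup>2 * norm f" for f :: "('a, complex) HL0" and w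
    using directional_estimates(2,3)[OF \<rho> HL0_apply_bound[of f] complex_differentiable_holomorphic_line[OF diff]]
    by (simp_all add: mult_ac)
  have "\<exists>\<Psi>. \<forall>f. cblinfun_apply \<Psi> f = directional_derivative v (HL0_apply f) x" for v
  proof -
    obtain \<Psi> where "cblinfun_apply \<Psi> = (\<lambda>f. directional_derivative v (HL0_apply f) x)"
    proof (rule ex_cblinfun[of "\<lambda>f. directional_derivative v (HL0_apply f) x" "norm v / \<rho>"])
      show "directional_derivative v (HL0_apply (f + g)) x
        = directional_derivative v (HL0_apply f) x + directional_derivative v (HL0_apply g) x" for f g :: "('a, complex) HL0"
        using complex_differentiable_lincomb(2)[OF diff[OF xx] diff[OF xx], of v 1 f 1 g]
        by (simp add: plus_HL0.rep_eq)
      show "directional_derivative v (HL0_apply (c *\<^sub>C f)) x = c *\<^sub>C directional_derivative v (HL0_apply f) x" for c and f :: "('a, complex) HL0"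
        using complex_differentiable_lincomb(2)[OF diff[OF xx] diff[OF xx], of v c f 0 f]
        by (simp add: scaleC_HL0.rep_eq)
    qed (use est(1) in simp)
    then show ?thesis by metis
  qed
  then obtain \<Psi> where \<Psi>: "\<And>v f. cblinfun_apply (\<Psi> v) f = directional_derivative v (HL0_apply f) x" by metis
  have "\<exists>\<phi>. G0_functional \<phi> = \<Psi> v" for v
  proof (rule G0_closed[of "\<Psi> v"])
    fix \<epsilon> :: real assume \<epsilon>: "\<epsilon> > 0"
    define C where "C = 32 / \<rho>\<^sup>2 * (norm v)\<^sup>2 + 1"
    have C: "C > 0" by (simp add: C_def add_nonneg_pos)
    define h where "h = min (\<rho> / (2 * (norm v + 1))) (\<epsilon> / C)"
    have h: "h > 0" "h * norm v \<le> \<rho> / 2" "C * h \<le> \<epsilon>"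
    proof -
      show "h > 0"
        using \<rho> \<epsilon> C by (simp add: h_def add_nonneg_pos)
      have "h * norm v \<le> (\<rho> / (2 * (norm v + 1))) * (norm v + 1)"
        using \<rho> \<open>h > 0\<close> by (intro mult_mono) (auto simp: h_def)
      also have "\<dots> = \<rho> / 2"
        using norm_ge_zero[of v] by (simp add: add_nonneg_eq_0_iff field_simps)
      finally show "h * norm v \<le> \<rho> / 2" .
      have "C * h \<le> C * (\<epsilon> / C)"
        using C by (intro mult_left_mono) (auto simp: h_def)
      then show "C * h \<le> \<epsilon>"
        using C by simp
    qed
    let ?w = "complex_of_real h *\<^sub>C v"
    let ?\<phi> = "inverse (complex_of_real h) *\<^sub>C (delta (x + ?w) - delta x)"
    have "norm (\<Psi> v - G0_functional ?\<phi>) \<le> \<epsilon>"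
    proof (rule cblinfun_norm_le)
      fix f :: "('a, complex) HL0"
      have nw: "norm ?w = h * norm v"
        using h(1) by (simp add: norm_scaleC)
      have "directional_derivative ?w (HL0_apply f) x = h * directional_derivative v (HL0_apply f) x"
        by (rule directional_derivative_scale[OF diff[OF xx]])
      then have "cblinfun_apply (\<Psi> v - G0_functional ?\<phi>) f
          = - inverse (complex_of_real h) * (HL0_apply f (x + ?w) - HL0_apply f x - directional_derivative ?w (HL0_apply f) x)"
        using h(1) by (simp add: \<Psi> field_simps)
      then have "norm (cblinfun_apply (\<Psi> v - G0_functional ?\<phi>) f)
          = inverse h * cmod (HL0_apply f (x + ?w) - HL0_apply f x - directional_derivative ?w (HL0_apply f) x)"
        using h(1) by (simp add: norm_mult norm_inverse)
      also have "\<dots> \<le> inverse h * (32 / \<rho>\<^sup>2 * (norm ?w)\<^sup>2 * norm f)"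
        using h by (intro mult_left_mono est(2)) (simp_all add: nw)
      also have "\<dots> = (32 / \<rho>\<^sup>2 * (norm v)\<^sup>2 * h) * norm f"
        unfolding nw using h(1) by (simp add: power2_eq_square field_simps)
      also have "\<dots> \<le> (C * h) * norm f"
        using h(1) by (intro mult_right_mono) (auto simp: C_def)
      also have "\<dots> \<le> \<epsilon> * norm f"
        using h(3) by (intro mult_right_mono) auto
      finally show "norm (cblinfun_apply (\<Psi> v - G0_functional ?\<phi>) f) \<le> \<epsilon> * norm f" .
    qed (use \<epsilon> in simp)
    then show "\<exists>\<phi>. norm (\<Psi> v - G0_functional \<phi>) \<le> \<epsilon>" by blast
  qed blast
  then obtain d where d: "\<And>v. G0_functional (d v) = \<Psi> v" by metis
  obtain D where D: "cblinfun_apply D = d"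
  proof (rule ex_cblinfun[of d "1 / \<rho>"])
    show "d (v + w) = d v + d w" for v w
      by (rule G0_eqI) (simp add: d \<Psi> directional_derivative_add[OF diff[OF xx]])
    show "d (c *\<^sub>C v) = c *\<^sub>C d v" for c v
      by (rule G0_eqI) (simp add: d \<Psi> directional_derivative_scale[OF diff[OF xx]])
    show "norm (d v) \<le> 1 / \<rho> * norm v" for v
      using \<rho> est(1)[of v] by (intro G0_norm_le) (auto simp: d \<Psi>)
  qed blast
  have "(delta has_derivative cblinfun_apply D) (at x)"
  proof (rule has_derivativeI_sandwich[of "\<rho> / 2"])
    show "((\<lambda>y. 32 / \<rho>\<^sup>2 * norm (y - x)) \<longlongrightarrow> 0) (at x)"
      using \<rho> by (auto intro!: tendsto_eq_intros)
    fix y assume y: "y \<noteq> x" "dist y x < \<rho> / 2"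
    have "norm (delta y - delta x - cblinfun_apply D (y - x)) \<le> 32 / \<rho>\<^sup>2 * (norm (y - x))\<^sup>2"
    proof (rule G0_norm_le)
      fix f :: "('a, complex) HL0"
      have "norm (y - x) \<le> \<rho> / 2"
        using y(2) by (simp add: dist_norm)
      from est(2)[OF this, of f]
      show "cmod (cblinfun_apply (G0_functional (delta y - delta x - cblinfun_apply D (y - x))) f)
          \<le> 32 / \<rho>\<^sup>2 * (norm (y - x))\<^sup>2 * norm f"
        by (simp add: D d \<Psi>)
    qed simp
    then show "norm (delta y - delta x - cblinfun_apply D (y - x)) / norm (y - x) \<le> 32 / \<rho>\<^sup>2 * norm (y - x)"
      using y(1) by (simp add: pos_divide_le_eq power2_eq_square mult.assoc)
  qed (use \<rho> in \<open>auto simp: cblinfun_bounded_linear\<close>)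
  then show thesis by (rule that)
qed

text \<open>A functional \<open>\<psi>\<close> is represented by \<open>x \<mapsto> \<psi> (\<delta> x)\<close>: this is a holomorphic Lipschitz function,
  and the functional that it defines agrees with \<open>\<psi>\<close> at evaluations.\<close>

theorem HL0_pairing_surj:
  fixes \<psi> :: "'a::complex_normed_vector G0 dual"
  obtains F where "HL0_pairing F = \<psi>" "norm F \<le> norm \<psi>"
proof -
  have delta0: "delta 0 = (0 :: 'a G0)"
    by (rule G0_eqI) simp
  obtain F where F: "\<And>x. x \<in> ball 0 1 \<Longrightarrow> HL0_apply F x = cblinfun_apply \<psi> (delta x)" "norm F \<le> norm \<psi>"
  proof (rule ex_HL0[of "\<lambda>x. cblinfun_apply \<psi> (delta x)" "norm \<psi>"])
    fix x :: 'a assume "x \<in> ball 0 1"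
    then obtain D :: "('a, 'a G0) cblinfun" where D: "(delta has_derivative cblinfun_apply D) (at x)"
      by (rule delta_has_derivative) blast
    have d: "((\<lambda>x. cblinfun_apply \<psi> (delta x)) has_derivative (\<lambda>v. cblinfun_apply \<psi> (cblinfun_apply D v))) (at x)"
      by (rule bounded_linear.has_derivative[OF cblinfun_bounded_linear D])
    obtain E where "cblinfun_apply E = (\<lambda>v. cblinfun_apply \<psi> (cblinfun_apply D v))"
      by (rule ex_cblinfun_compose)
    with d show "complex_differentiable (\<lambda>x. cblinfun_apply \<psi> (delta x)) x"
      unfolding complex_differentiable_def by metis
  next
    fix x y :: 'a assume "x \<in> ball 0 1" "y \<in> ball 0 1"
    then have "norm \<psi> * norm (delta x - delta y) \<le> norm \<psi> * norm (x - y)"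
      by (intro mult_left_mono norm_delta_diff) auto
    then show "cmod (cblinfun_apply \<psi> (delta x) - cblinfun_apply \<psi> (delta y)) \<le> norm \<psi> * norm (x - y)"
      using cblinfun_norm[of \<psi> "delta x - delta y"] by simp
  qed (auto simp: delta0)
  have "HL0_pairing F = \<psi>"
    by (rule G0_operator_eqI) (simp add: F(1) del: mem_ball_0)
  with F(2) show thesis by (intro that)
qed

lemma HL0_pairing_lincomb: "HL0_pairing (f + c *\<^sub>C g) = HL0_pairing f + c *\<^sub>C HL0_pairing g"
  by (rule cblinfun_eqI) simp

lemma HL0_pairing_inject: "HL0_pairing f = HL0_pairing g \<Longrightarrow> f = g"
  by (rule HL0_eqI) (metis HL0_eval.rep_eq HL0_pairing.rep_eq delta.rep_eq)

lemma norm_HL0_pairing: "norm (HL0_pairing f) \<le> norm f"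
  by (rule cblinfun_norm_le) (simp_all add: G0_functional_norm mult.commute)

definition HL0_of_dual :: "'a::complex_normed_vector G0 dual \<Rightarrow> ('a, complex) HL0"
  where "HL0_of_dual \<psi> = (SOME F. HL0_pairing F = \<psi>)"

lemma HL0_pairing_of_dual: "HL0_pairing (HL0_of_dual \<psi>) = \<psi>"
  unfolding HL0_of_dual_def by (rule someI_ex) (metis HL0_pairing_surj)

lemma HL0_of_dual_pairing: "HL0_of_dual (HL0_pairing f) = f"
  by (rule HL0_pairing_inject) (rule HL0_pairing_of_dual)

lemma norm_HL0_of_dual: "norm (HL0_of_dual \<psi>) \<le> norm \<psi>"
  by (metis HL0_of_dual_pairing HL0_pairing_surj)

lemma HL0_of_dual_lincomb: "HL0_of_dual (\<psi> + c *\<^sub>C \<psi>') = HL0_of_dual \<psi> + c *\<^sub>C HL0_of_dual \<psi>'"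
  by (rule HL0_pairing_inject) (simp add: HL0_pairing_of_dual HL0_pairing_lincomb)


section \<open>The operator as the restricted adjoint of the extension operator\<close>

text \<open>The map \<open>\<phi> \<mapsto> (\<psi> \<mapsto> \<phi> (extension of the function representing \<psi>))\<close> is a bounded operator.
  Its values at evaluations characterize both \<open>Theta\<close>, because every functional is represented by
  a function, and the linearization, because evaluations span a dense subspace.\<close>

theorem T_Theta_eq:
  fixes \<phi> :: "'a::complex_normed_vector bidual G0"
  shows T_Theta_pairing: "cblinfun_apply (cblinfun_apply T_Theta \<phi>) (HL0_pairing f)
      = cblinfun_apply (G0_functional \<phi>) (HL0_extension f)"
    and T_Theta_norm: "norm (cblinfun_apply T_Theta \<phi>) \<le> norm \<phi>"
proof -
  have le: "cmod (cblinfun_apply (G0_functional \<phi>) (HL0_extension (HL0_of_dual \<psi>))) \<le> norm \<phi> * norm \<psi>"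
    for \<phi> :: "'a bidual G0" and \<psi>
  proof -
    have "norm (HL0_extension (HL0_of_dual \<psi>)) \<le> norm \<psi>"
      by (rule order_trans[OF norm_HL0_extension norm_HL0_of_dual])
    then show ?thesis
      by (intro order_trans[OF G0_functional_norm] mult_left_mono) auto
  qed
  have "\<exists>\<Psi>. \<forall>\<psi>. cblinfun_apply \<Psi> \<psi> = cblinfun_apply (G0_functional \<phi>) (HL0_extension (HL0_of_dual \<psi>))"
    for \<phi> :: "'a bidual G0"
  proof -
    have zero: "HL0_extension 0 = (0 :: ('a bidual, complex) HL0)" "HL0_of_dual 0 = (0 :: ('a, complex) HL0)"
      using HL0_extension_lincomb[of 0 "- 1" 0] HL0_of_dual_lincomb[of 0 "- 1" 0] by simp_all
    obtain \<Psi> where "cblinfun_apply \<Psi> = (\<lambda>\<psi>. cblinfun_apply (G0_functional \<phi>) (HL0_extension (HL0_of_dual \<psi>)))"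
    proof (rule ex_cblinfun[OF _ _ le[of \<phi>]])
      fix \<psi> \<psi>' :: "'a G0 dual" and c
      show "cblinfun_apply (G0_functional \<phi>) (HL0_extension (HL0_of_dual (\<psi> + \<psi>')))
        = cblinfun_apply (G0_functional \<phi>) (HL0_extension (HL0_of_dual \<psi>))
          + cblinfun_apply (G0_functional \<phi>) (HL0_extension (HL0_of_dual \<psi>'))"
        using HL0_of_dual_lincomb[of \<psi> 1 \<psi>'] HL0_extension_lincomb[of "HL0_of_dual \<psi>" 1 "HL0_of_dual \<psi>'"] by simp
      show "cblinfun_apply (G0_functional \<phi>) (HL0_extension (HL0_of_dual (c *\<^sub>C \<psi>)))
        = c *\<^sub>C cblinfun_apply (G0_functional \<phi>) (HL0_extension (HL0_of_dual \<psi>))"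
        using HL0_of_dual_lincomb[of 0 c \<psi>] HL0_extension_lincomb[of 0 c "HL0_of_dual \<psi>"] by (simp add: zero)
    qed blast
    then show ?thesis by metis
  qed
  then obtain \<Psi> where \<Psi>: "\<And>(\<phi> :: 'a bidual G0) \<psi>. cblinfun_apply (\<Psi> \<phi>) \<psi>
      = cblinfun_apply (G0_functional \<phi>) (HL0_extension (HL0_of_dual \<psi>))"
    by metis
  have \<Psi>_norm: "norm (\<Psi> \<phi>) \<le> norm \<phi>" for \<phi>
    by (rule cblinfun_norm_le) (simp_all add: \<Psi> le)
  obtain T where T: "cblinfun_apply T = \<Psi>"
  proof (rule ex_cblinfun[of \<Psi> 1])
    show "\<Psi> (\<phi> + \<phi>') = \<Psi> \<phi> + \<Psi> \<phi>'" for \<phi> \<phi>'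
      by (rule cblinfun_eqI) (simp add: \<Psi>)
    show "\<Psi> (c *\<^sub>C \<phi>) = c *\<^sub>C \<Psi> \<phi>" for c \<phi>
      by (rule cblinfun_eqI) (simp add: \<Psi>)
  qed (use \<Psi>_norm in auto)
  have "Theta z = \<Psi> (delta z)" if z: "z \<in> ball 0 1" for z :: "'a bidual"
    unfolding Theta_def
  proof (rule the_equality)
    show *: "\<forall>f. cblinfun_apply (\<Psi> (delta z)) (HL0_pairing f) = AB_extension (HL0_apply f) z"
      using z by (simp add: \<Psi> HL0_of_dual_pairing HL0_extension_apply del: mem_ball_0)
    fix \<Psi>' assume **: "\<forall>f. cblinfun_apply \<Psi>' (HL0_pairing f) = AB_extension (HL0_apply f) z"
    show "\<Psi>' = \<Psi> (delta z)"
    proof (rule cblinfun_eqI)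
      fix \<psi>
      show "cblinfun_apply \<Psi>' \<psi> = cblinfun_apply (\<Psi> (delta z)) \<psi>"
        using *[rule_format, of "HL0_of_dual \<psi>"] **[rule_format, of "HL0_of_dual \<psi>"]
        by (simp only: HL0_pairing_of_dual)
    qed
  qed
  then have T_eq: "T_Theta = T"
    unfolding T_Theta_def linearization_def
    by (intro the_equality) (auto simp: T intro!: G0_operator_eqI)
  show "cblinfun_apply (cblinfun_apply T_Theta \<phi>) (HL0_pairing f) = cblinfun_apply (G0_functional \<phi>) (HL0_extension f)"
    unfolding T_eq T \<Psi> HL0_of_dual_pairing ..
  show "norm (cblinfun_apply T_Theta \<phi>) \<le> norm \<phi>"
    unfolding T_eq T by (rule \<Psi>_norm)
qed


section \<open>Finite-rank approximations from the approximation property\<close>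

text \<open>The weak-star continuous extension to the bidual of the operator \<open>x \<mapsto> \<Sum>b\<in>B. \<phi> b x \<cdot> b\<close>. The
  vectors of the operator serve as their own indices.\<close>

definition weak_star_extension ::
  "'b::complex_normed_vector set \<Rightarrow> ('b \<Rightarrow> 'a::complex_normed_vector dual) \<Rightarrow> 'a bidual \<Rightarrow> 'b"
  where "weak_star_extension B \<phi> z = (\<Sum>b\<in>B. cblinfun_apply z (\<phi> b) *\<^sub>C b)"

definition finite_rank_contraction ::
  "('a::complex_normed_vector, 'b::complex_normed_vector) cblinfun \<Rightarrow> 'b set \<Rightarrow> ('b \<Rightarrow> 'a dual) \<Rightarrow> bool"
  where "finite_rank_contraction S B \<phi> \<longleftrightarrow> finite B \<and> norm S < 1 \<and>
    (\<forall>x. cblinfun_apply S x = (\<Sum>b\<in>B. cblinfun_apply (\<phi> b) x *\<^sub>C b)) \<and>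
    (\<forall>z. norm (weak_star_extension B \<phi> z) \<le> norm z)"

lemma metric_approximation_finite:
  fixes Z :: "'b::complex_normed_vector set"
  assumes map: "metric_approximation_property TYPE('b)" and Z: "finite Z" and \<epsilon>: "\<epsilon> > 0"
  obtains T :: "('b, 'b) cblinfun" where "finite_rank T" "norm T \<le> 1"
    "\<And>z. z \<in> Z \<Longrightarrow> norm (cblinfun_apply T z - z) < \<epsilon>"
proof -
  obtain F :: "('b, 'b) cblinfun filter" where F: "F \<noteq> bot" "\<forall>\<^sub>F T in F. finite_rank T \<and> norm T \<le> 1"
    "\<And>z. ((\<lambda>T. cblinfun_apply T z) \<longlongrightarrow> z) F"
    using map unfolding metric_approximation_property_def by blast
  have "\<forall>\<^sub>F T in F. \<forall>z\<in>Z. dist (cblinfun_apply T z) z < \<epsilon>"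
    using Z tendstoD[OF F(3) \<epsilon>] by (intro eventually_ball_finite) auto
  with F(2) have "\<forall>\<^sub>F T in F. (finite_rank T \<and> norm T \<le> 1) \<and> (\<forall>z\<in>Z. dist (cblinfun_apply T z) z < \<epsilon>)"
    by (rule eventually_conj)
  then obtain T where "(finite_rank T \<and> norm T \<le> 1) \<and> (\<forall>z\<in>Z. dist (cblinfun_apply T z) z < \<epsilon>)"
    using F(1) eventually_happens' by blast
  then show thesis
    by (intro that[of T]) (auto simp: dist_norm)
qed

text \<open>The functionals on the bidual that describe a finite-rank operator are replaced by elements
  of the dual by local reflexivity. The norm of the new operator is tested against finitely many
  functionals that almost norm its range.\<close>

lemma finite_rank_replacement:
  fixes T :: "('a::complex_normed_vector bidual, 'a bidual) cblinfun"
  assumes "finite_rank T" and T: "norm T \<le> 1" and Z: "finite Z" and q: "0 < q" "q < 1"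
  obtains S :: "('a, 'a bidual) cblinfun" and B \<phi> where "finite_rank_contraction S B \<phi>"
    "\<And>z. z \<in> Z \<Longrightarrow> weak_star_extension B \<phi> z = complex_of_real q *\<^sub>C cblinfun_apply T z"
proof -
  \<comment> \<open>Local reflexivity and the choice of almost norming functionals each cost a factor \<open>1 + e\<close>;
    shrinking the operator by \<open>q\<close> absorbs both.\<close>
  define e where "e = (1 - q) / 4"
  have e: "0 < e" "q * ((1 + e) * (1 + e)) < 1"
  proof -
    show "0 < e" using q by (simp add: e_def)
    have e1: "e \<le> 1" using q by (simp add: e_def)
    have "e * e \<le> e * 1"
      using e1 \<open>0 < e\<close> by (intro mult_left_mono) auto
    then have "(1 + e) * (1 + e) \<le> 1 + 3 * e"
      by (simp add: algebra_simps)
    then have "q * ((1 + e) * (1 + e)) \<le> q * (1 + 3 * e)"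
      using q by (intro mult_left_mono) auto
    also have "\<dots> = q + 3 * (q * e)"
      by (simp add: algebra_simps)
    also have "\<dots> < q + 3 * (1 * e)"
      using q \<open>0 < e\<close> by simp
    also have "\<dots> < 1"
      using q by (simp add: e_def field_simps)
    finally show "q * ((1 + e) * (1 + e)) < 1" .
  qed
  obtain B0 where B0: "finite B0" "range (cblinfun_apply T) \<subseteq> complex_vector.span B0"
    using assms(1) unfolding finite_rank_def by blast
  obtain B and h :: "'a bidual \<Rightarrow> 'a bidual dual" where B: "finite B" "B \<subseteq> B0"
    "complex_vector.span B = complex_vector.span B0"
    "\<And>x. x \<in> complex_vector.span B0 \<Longrightarrow> x = (\<Sum>b\<in>B. cblinfun_apply (h b) x *\<^sub>C b)"
    by (rule finite_span_coordinates[OF B0(1)]) blast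
  have "\<exists>\<Phi> :: 'a bidual dual. \<forall>z. cblinfun_apply \<Phi> z = cblinfun_apply (h b) (cblinfun_apply T z)" for b
  proof -
    obtain \<Phi> where "cblinfun_apply \<Phi> = (\<lambda>z. cblinfun_apply (h b) (cblinfun_apply T z))"
      by (rule ex_cblinfun_compose)
    then show ?thesis by metis
  qed
  then obtain \<Phi> :: "'a bidual \<Rightarrow> 'a bidual dual" where
    \<Phi>: "\<And>b z. cblinfun_apply (\<Phi> b) z = cblinfun_apply (h b) (cblinfun_apply T z)" by metis
  have T_eq: "cblinfun_apply T z = (\<Sum>b\<in>B. cblinfun_apply (\<Phi> b) z *\<^sub>C b)" for z
    unfolding \<Phi> by (rule B(4)) (use B0(2) in blast)
  obtain N :: "'a dual set" where N: "finite N" "\<And>\<eta>. \<eta> \<in> N \<Longrightarrow> norm \<eta> \<le> 1"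
    "\<And>m K. m \<in> complex_vector.span B \<Longrightarrow> (\<And>\<eta>. \<eta> \<in> N \<Longrightarrow> cmod (cblinfun_apply m \<eta>) \<le> K) \<Longrightarrow> norm m \<le> (1 + e) * K"
    by (rule finitely_many_norming_points[OF B(1) e(1)]) blast
  have \<Phi>_bound: "norm (\<Sum>b\<in>B. cblinfun_apply b \<eta> *\<^sub>C \<Phi> b) < 1 + e" if \<eta>: "\<eta> \<in> N" for \<eta>
  proof -
    have "norm (\<Sum>b\<in>B. cblinfun_apply b \<eta> *\<^sub>C \<Phi> b) \<le> 1"
    proof (rule cblinfun_norm_le)
      fix z
      have "cblinfun_apply (\<Sum>b\<in>B. cblinfun_apply b \<eta> *\<^sub>C \<Phi> b) z = cblinfun_apply (cblinfun_apply T z) \<eta>"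
        by (simp add: T_eq cblinfun_sum_apply mult.commute)
      also have "cmod \<dots> \<le> norm (cblinfun_apply T z) * norm \<eta>"
        by (rule cblinfun_norm)
      also have "\<dots> \<le> (norm T * norm z) * 1"
        using N(2)[OF \<eta>] by (intro mult_mono cblinfun_norm) auto
      also have "\<dots> \<le> 1 * norm z"
        using T by (simp add: mult_right_mono mult_left_le_one_le)
      finally show "norm (cblinfun_apply (\<Sum>b\<in>B. cblinfun_apply b \<eta> *\<^sub>C \<Phi> b) z) \<le> 1 * norm z" .
    qed simp
    with e(1) show ?thesis by linarith
  qed
  obtain \<phi>0 :: "'a bidual \<Rightarrow> 'a dual" where
    \<phi>0: "\<And>b z. b \<in> B \<Longrightarrow> z \<in> Z \<Longrightarrow> cblinfun_apply z (\<phi>0 b) = cblinfun_apply (\<Phi> b) z"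
      "\<And>\<eta>. \<eta> \<in> N \<Longrightarrow> norm (\<Sum>b\<in>B. cblinfun_apply b \<eta> *\<^sub>C \<phi>0 b) < 1 + e"
  proof (rule local_reflexivity[OF B(1) N(1) Z \<Phi>_bound])
    fix x :: "'a bidual \<Rightarrow> 'a dual"
    assume 1: "\<And>b z. b \<in> B \<Longrightarrow> z \<in> Z \<Longrightarrow> cblinfun_apply z (x b) = cblinfun_apply (\<Phi> b) z"
      and 2: "\<And>\<eta>. \<eta> \<in> N \<Longrightarrow> norm (\<Sum>b\<in>B. cblinfun_apply b \<eta> *\<^sub>C x b) < 1 + e"
    show thesis by (rule that[of x, OF 1 2])
  qed
  define \<phi> where "\<phi> b = complex_of_real q *\<^sub>C \<phi>0 b" for b
  have span: "(\<Sum>b\<in>B. c b *\<^sub>C b) \<in> complex_vector.span B" for c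
    by (rule complex_vector.span_sum) (intro complex_vector.span_scale complex_vector.span_base)
  have factor: "(\<Sum>b\<in>B. (complex_of_real q * c b) *\<^sub>C b) = complex_of_real q *\<^sub>C (\<Sum>b\<in>B. c b *\<^sub>C b)" for c :: "'a bidual \<Rightarrow> complex"
    by (simp add: complex_vector.scale_sum_right scaleC_scaleC)
  have est: "norm (complex_of_real q *\<^sub>C (\<Sum>b\<in>B. c b *\<^sub>C b)) \<le> q * ((1 + e) * (1 + e)) * r"
    if "\<And>\<eta>. \<eta> \<in> N \<Longrightarrow> cmod (\<Sum>b\<in>B. c b * cblinfun_apply b \<eta>) \<le> (1 + e) * r" for c r
  proof -
    have "norm (\<Sum>b\<in>B. c b *\<^sub>C b) \<le> (1 + e) * ((1 + e) * r)"
      using that by (intro N(3) span) (simp add: cblinfun_sum_apply)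
    then have "q * norm (\<Sum>b\<in>B. c b *\<^sub>C b) \<le> q * ((1 + e) * ((1 + e) * r))"
      using q by (intro mult_left_mono) auto
    then show ?thesis
      using q by (simp add: norm_scaleC mult.assoc)
  qed
  have S_le: "norm (\<Sum>b\<in>B. cblinfun_apply (\<phi> b) x *\<^sub>C b) \<le> q * ((1 + e) * (1 + e)) * norm x" for x
    unfolding \<phi>_def scaleC_cblinfun.rep_eq scaleC_complex factor
  proof (rule est)
    fix \<eta> assume \<eta>: "\<eta> \<in> N"
    have "(\<Sum>b\<in>B. cblinfun_apply (\<phi>0 b) x * cblinfun_apply b \<eta>)
        = cblinfun_apply (\<Sum>b\<in>B. cblinfun_apply b \<eta> *\<^sub>C \<phi>0 b) x"
      by (simp add: cblinfun_sum_apply mult.commute)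
    also have "cmod \<dots> \<le> (1 + e) * norm x"
      using \<phi>0(2)[OF \<eta>] by (intro order_trans[OF cblinfun_norm] mult_right_mono) auto
    finally show "cmod (\<Sum>b\<in>B. cblinfun_apply (\<phi>0 b) x * cblinfun_apply b \<eta>) \<le> (1 + e) * norm x" .
  qed
  have ext_eq: "weak_star_extension B \<phi> z = complex_of_real q *\<^sub>C (\<Sum>b\<in>B. cblinfun_apply z (\<phi>0 b) *\<^sub>C b)" for z
    unfolding weak_star_extension_def \<phi>_def cblinfun_scaleC scaleC_complex factor ..
  have ext_le: "norm (weak_star_extension B \<phi> z) \<le> q * ((1 + e) * (1 + e)) * norm z" for z
    unfolding ext_eq
  proof (rule est)
    fix \<eta> assume \<eta>: "\<eta> \<in> N"
    have "(\<Sum>b\<in>B. cblinfun_apply z (\<phi>0 b) * cblinfun_apply b \<eta>)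
        = cblinfun_apply z (\<Sum>b\<in>B. cblinfun_apply b \<eta> *\<^sub>C \<phi>0 b)"
      by (simp add: cblinfun_sum mult.commute)
    also have "cmod \<dots> \<le> norm z * (1 + e)"
      using \<phi>0(2)[OF \<eta>] by (intro order_trans[OF cblinfun_norm] mult_left_mono) auto
    finally show "cmod (\<Sum>b\<in>B. cblinfun_apply z (\<phi>0 b) * cblinfun_apply b \<eta>) \<le> (1 + e) * norm z"
      by (simp only: mult.commute)
  qed
  obtain S where S: "cblinfun_apply S = (\<lambda>x. \<Sum>b\<in>B. cblinfun_apply (\<phi> b) x *\<^sub>C b)"
    by (rule ex_cblinfun[OF _ _ S_le])
      (auto simp: scaleC_add_left sum.distrib complex_vector.scale_sum_right scaleC_scaleC)
  have nonneg: "0 \<le> q * ((1 + e) * (1 + e))"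
    using q e(1) by simp
  have "norm S \<le> q * ((1 + e) * (1 + e))"
    by (rule cblinfun_norm_le[OF nonneg]) (simp only: S S_le)
  moreover have "norm (weak_star_extension B \<phi> z) \<le> norm z" for z
    using ext_le[of z] mult_right_mono[OF less_imp_le[OF e(2)] norm_ge_zero[of z]] by simp
  ultimately have "finite_rank_contraction S B \<phi>"
    using B(1) e(2) by (auto simp: finite_rank_contraction_def S)
  moreover have "weak_star_extension B \<phi> z = complex_of_real q *\<^sub>C cblinfun_apply T z" if "z \<in> Z" for z
    unfolding ext_eq T_eq using \<phi>0(1) that by simp
  ultimately show thesis by (rule that)
qed

theorem finite_rank_contraction_approximation:
  fixes Z :: "'a::complex_normed_vector bidual set"
  assumes map: "metric_approximation_property TYPE('a bidual)" and Z: "finite Z" and \<epsilon>: "\<epsilon> > 0"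
  obtains S :: "('a, 'a bidual) cblinfun" and B \<phi> where "finite_rank_contraction S B \<phi>"
    "\<And>z. z \<in> Z \<Longrightarrow> norm (weak_star_extension B \<phi> z - z) < \<epsilon>"
proof -
  have "\<epsilon> / 2 > 0" using \<epsilon> by simp
  then obtain T :: "('a bidual, 'a bidual) cblinfun" where T: "finite_rank T" "norm T \<le> 1"
    "\<And>z. z \<in> Z \<Longrightarrow> norm (cblinfun_apply T z - z) < \<epsilon> / 2"
    by (rule metric_approximation_finite[OF map Z]) blast
  define C where "C = (\<Sum>z\<in>Z. norm z) + 1"
  have C: "C > 0"
    by (simp add: C_def add_nonneg_pos sum_nonneg)
  have C_le: "norm z \<le> C" if "z \<in> Z" for z
    using member_le_sum[of z Z norm] Z that by (simp add: C_def)
  \<comment> \<open>The scaling by \<open>q\<close> moves the points \<open>T z\<close> by at most half of \<open>\<epsilon>\<close>.\<close>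
  define q where "q = 1 - min (1/2) (\<epsilon> / (2 * C))"
  have q: "0 < q" "q < 1" "(1 - q) * C \<le> \<epsilon> / 2"
  proof -
    show "0 < q" "q < 1"
      using \<epsilon> C by (auto simp: q_def)
    have "(1 - q) * C \<le> (\<epsilon> / (2 * C)) * C"
      using C by (intro mult_right_mono) (auto simp: q_def)
    then show "(1 - q) * C \<le> \<epsilon> / 2"
      using C by simp
  qed
  obtain S :: "('a, 'a bidual) cblinfun" and B \<phi> where S: "finite_rank_contraction S B \<phi>"
    "\<And>z. z \<in> Z \<Longrightarrow> weak_star_extension B \<phi> z = complex_of_real q *\<^sub>C cblinfun_apply T z"
    by (rule finite_rank_replacement[OF T(1,2) Z q(1,2)]) blast
  have "norm (weak_star_extension B \<phi> z - z) < \<epsilon>" if z: "z \<in> Z" for z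
  proof -
    have "norm (cblinfun_apply T z) \<le> 1 * norm z"
      by (rule order_trans[OF cblinfun_norm mult_right_mono[OF T(2) norm_ge_zero]])
    then have "norm (cblinfun_apply T z) \<le> C"
      using C_le[OF z] by simp
    then have "norm (complex_of_real (1 - q) *\<^sub>C cblinfun_apply T z) \<le> (1 - q) * C"
      unfolding norm_scaleC norm_of_real using q by (simp add: mult_left_mono)
    moreover have "weak_star_extension B \<phi> z - z = (cblinfun_apply T z - z) - complex_of_real (1 - q) *\<^sub>C cblinfun_apply T z"
      unfolding S(2)[OF z] by (simp add: complex_vector.scale_left_diff_distrib)
    ultimately show ?thesis
      using T(3)[OF z] q(3) norm_triangle_ineq4[of "cblinfun_apply T z - z" "complex_of_real (1 - q) *\<^sub>C cblinfun_apply T z"]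
      by (simp only:)
  qed
  with S(1) show thesis by (rule that)
qed


section \<open>Back from the bidual to the predual\<close>

text \<open>Composition with a contraction of finite rank of norm less than 1 maps the ball into a
  compact subset of the ball, on which uniform smallness of \<open>g\<close> controls its Lipschitz constant by
  Cauchy's estimate.\<close>

lemma HL0_compose_small:
  fixes S :: "('a::complex_normed_vector, 'b::complex_normed_vector) cblinfun"
  assumes "finite B" "range (cblinfun_apply S) \<subseteq> complex_vector.span B" and S: "norm S < 1"
  obtains K r where "compact K" "K \<subseteq> ball 0 1" "r > 0"
    "\<And>g \<eta>. \<eta> \<ge> 0 \<Longrightarrow> (\<And>y. y \<in> K \<Longrightarrow> cmod (HL0_apply g y) \<le> \<eta>) \<Longrightarrow> norm (HL0_compose S g) \<le> \<eta> / r"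
proof -
  define r where "r = (1 - norm S) / 2"
  define K where "K = complex_vector.span B \<inter> cball 0 (norm S + r)"
  have r: "r > 0" "norm S + r < 1"
    using S by (simp_all add: r_def field_simps)
  have K: "compact K" "K \<subseteq> ball 0 1"
    using compact_finite_span_cball[OF assms(1)] r(2) by (auto simp: K_def)
  have "norm (HL0_compose S g) \<le> \<eta> / r"
    if \<eta>: "\<eta> \<ge> 0" and g: "\<And>y. y \<in> K \<Longrightarrow> cmod (HL0_apply g y) \<le> \<eta>" for g \<eta>
  proof (rule HL0_norm_le)
    fix x y :: 'a assume xy: "x \<in> ball 0 1" "y \<in> ball 0 1"
    define u where "u = cblinfun_apply S x"
    define v where "v = cblinfun_apply S y - cblinfun_apply S x"
    have uv: "u \<in> complex_vector.span B" "v \<in> complex_vector.span B"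
      using assms(2) by (auto simp: u_def v_def intro!: complex_vector.span_diff)
    have v_le: "norm v \<le> norm (x - y)"
    proof -
      have "norm v = norm (cblinfun_apply S (x - y))"
        unfolding v_def cblinfun_diff by (rule norm_minus_commute)
      also have "\<dots> \<le> 1 * norm (x - y)"
        using S by (intro order_trans[OF cblinfun_norm] mult_right_mono) auto
      finally show ?thesis by simp
    qed
    have seg: "norm (u + complex_of_real s *\<^sub>C v) \<le> norm S" if s: "0 \<le> s" "s \<le> 1" for s
    proof -
      have "u + complex_of_real s *\<^sub>C v = complex_of_real (1 - s) *\<^sub>C cblinfun_apply S x + complex_of_real s *\<^sub>C cblinfun_apply S y"
        by (simp add: u_def v_def complex_vector.scale_left_diff_distrib complex_vector.scale_right_diff_distrib)
      then have "u + complex_of_real s *\<^sub>C v = cblinfun_apply S (complex_of_real (1 - s) *\<^sub>C x + complex_of_real s *\<^sub>C y)"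
        by (simp only: cblinfun_add cblinfun_scaleC)
      also have "norm \<dots> \<le> norm S * norm (complex_of_real (1 - s) *\<^sub>C x + complex_of_real s *\<^sub>C y)"
        by (rule cblinfun_norm)
      also have "\<dots> \<le> norm S * 1"
      proof (intro mult_left_mono)
        have "norm (complex_of_real (1 - s) *\<^sub>C x + complex_of_real s *\<^sub>C y) \<le> (1 - s) * norm x + s * norm y"
          using s by (intro order_trans[OF norm_triangle_ineq]) (simp add: norm_scaleC del: of_real_diff)
        also have "\<dots> \<le> (1 - s) * 1 + s * 1"
          using s xy by (intro add_mono mult_left_mono) auto
        finally show "norm (complex_of_real (1 - s) *\<^sub>C x + complex_of_real s *\<^sub>C y) \<le> 1" by simp
      qed simp
      finally show ?thesis by simp
    qed
    have "cmod (HL0_apply g (u + 1 *\<^sub>C v) - HL0_apply g (u + 0 *\<^sub>C v)) \<le> \<eta> / r * norm v"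
    proof (cases "v = 0")
      case False
      let ?h = "\<lambda>t. HL0_apply g (u + t *\<^sub>C v)"
      have seg_re: "\<exists>s. t = complex_of_real s \<and> 0 \<le> s \<and> s \<le> 1" if "t \<in> closed_segment 0 1" for t :: complex
        using that unfolding in_segment by (auto simp: scaleR_conv_of_real)
      have in_K: "u + t *\<^sub>C v \<in> K" if t: "t \<in> ball (complex_of_real s) (r / norm v)" "0 \<le> s" "s \<le> 1" for t s
      proof -
        have "u + t *\<^sub>C v = (u + complex_of_real s *\<^sub>C v) + (t - complex_of_real s) *\<^sub>C v"
          by (simp add: complex_vector.scale_left_diff_distrib)
        also have "norm \<dots> \<le> norm S + cmod (t - complex_of_real s) * norm v"
          using seg[OF t(2,3)] norm_triangle_ineq[of "u + complex_of_real s *\<^sub>C v" "(t - complex_of_real s) *\<^sub>C v"]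
          unfolding norm_scaleC by linarith
        also have "cmod (t - complex_of_real s) * norm v \<le> r / norm v * norm v"
          using t(1) by (intro mult_right_mono) (auto simp: dist_norm norm_minus_commute)
        finally show ?thesis
          using False uv by (auto simp: K_def intro!: complex_vector.span_add complex_vector.span_scale)
      qed
      have field_deriv: "(?h has_field_derivative directional_derivative v (HL0_apply g) (u + t *\<^sub>C v)) (at t)"
        if "u + t *\<^sub>C v \<in> K" for t
        using HL0_holomorphic[of g] K(2) that unfolding holomorphic_ball_iff
        by (intro complex_differentiable_line) blast
      have "cmod (?h 1 - ?h 0) \<le> (\<eta> / r * norm v) * cmod (1 - 0)"
      proof (rule field_differentiable_bound[of "closed_segment 0 1" ?h])
        fix t :: complex assume "t \<in> closed_segment 0 1"
        then obtain s where s: "t = complex_of_real s" "0 \<le> s" "s \<le> 1"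
          using seg_re by blast
        have rv: "r / norm v > 0" using r False by simp
        have tK: "u + t *\<^sub>C v \<in> K"
          using s rv by (intro in_K[of t s]) auto
        show "(?h has_field_derivative directional_derivative v (HL0_apply g) (u + t *\<^sub>C v)) (at t within closed_segment 0 1)"
          by (rule has_field_derivative_at_within[OF field_deriv[OF tK]])
        have "cmod ((deriv ^^ 1) ?h t) \<le> fact 1 * \<eta> / (r / norm v) ^ 1"
        proof (rule Cauchy_estimate_ball[OF _ rv])
          show "?h holomorphic_on ball t (r / norm v)"
            unfolding holomorphic_on_def
          proof
            fix t' assume "t' \<in> ball t (r / norm v)"
            then have "u + t' *\<^sub>C v \<in> K"
              using s by (intro in_K[of t' s]) auto
            then show "?h field_differentiable at t' within ball t (r / norm v)"
              using has_field_derivative_at_within[OF field_deriv] unfolding field_differentiable_def by blast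
          qed
          show "cmod (?h t') \<le> \<eta>" if "t' \<in> ball t (r / norm v)" for t'
            using that s by (intro g in_K[of t' s]) auto
        qed
        moreover have "deriv ?h t = directional_derivative v (HL0_apply g) (u + t *\<^sub>C v)"
          by (rule DERIV_imp_deriv[OF field_deriv[OF tK]])
        ultimately show "cmod (directional_derivative v (HL0_apply g) (u + t *\<^sub>C v)) \<le> \<eta> / r * norm v"
          by simp
      qed auto
      then show ?thesis by simp
    qed simp
    also have "\<dots> \<le> \<eta> / r * norm (x - y)"
      using v_le \<eta> r(1) by (intro mult_left_mono) auto
    finally show "norm (HL0_apply (HL0_compose S g) x - HL0_apply (HL0_compose S g) y) \<le> \<eta> / r * norm (x - y)"
      using xy S by (simp add: HL0_compose_apply u_def v_def norm_minus_commute del: mem_ball_0)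
  qed (use \<eta> r in simp)
  with K r(1) show thesis by (rule that)
qed

definition predual_map ::
  "('a::complex_normed_vector, 'b::complex_normed_vector) cblinfun \<Rightarrow> ('a G0 bidual, 'b G0) cblinfun"
  where "predual_map S = (SOME R. \<forall>\<Psi> g. cblinfun_apply (G0_functional (cblinfun_apply R \<Psi>)) g
    = cblinfun_apply \<Psi> (HL0_pairing (HL0_compose S g)))"

lemma predual_map:
  fixes S :: "('a::complex_normed_vector, 'b::complex_normed_vector) cblinfun"
  assumes S: "finite_rank_contraction S B \<phi>"
  shows predual_map_apply: "cblinfun_apply (G0_functional (cblinfun_apply (predual_map S) \<Psi>)) g
      = cblinfun_apply \<Psi> (HL0_pairing (HL0_compose S g))"
    and predual_map_norm: "norm (cblinfun_apply (predual_map S) \<Psi>) \<le> norm \<Psi>"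
proof -
  have B: "finite B" and S1: "norm S < 1" and S_eq: "\<And>x. cblinfun_apply S x = (\<Sum>b\<in>B. cblinfun_apply (\<phi> b) x *\<^sub>C b)"
    using S by (auto simp: finite_rank_contraction_def)
  have "cblinfun_apply S x \<in> complex_vector.span B" for x
    unfolding S_eq by (rule complex_vector.span_sum) (intro complex_vector.span_scale complex_vector.span_base)
  then have "range (cblinfun_apply S) \<subseteq> complex_vector.span B"
    by blast
  then obtain K r where K: "compact K" "K \<subseteq> ball 0 1" "r > 0"
    "\<And>g \<eta>. \<eta> \<ge> 0 \<Longrightarrow> (\<And>y. y \<in> K \<Longrightarrow> cmod (HL0_apply g y) \<le> \<eta>) \<Longrightarrow> norm (HL0_compose S g) \<le> \<eta> / r"
    by (rule HL0_compose_small[OF B _ S1]) blast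
  have S_le: "norm S \<le> 1" using S1 by simp
  have le: "cmod (cblinfun_apply \<Psi> (HL0_pairing (HL0_compose S g))) \<le> norm \<Psi> * norm (HL0_compose S g)"
    for \<Psi> :: "'a G0 bidual" and g
    by (intro order_trans[OF cblinfun_norm] mult_left_mono norm_HL0_pairing) auto
  have "\<exists>\<theta>. \<forall>g. cblinfun_apply (G0_functional \<theta>) g = cblinfun_apply \<Psi> (HL0_pairing (HL0_compose S g))"
    for \<Psi> :: "'a G0 bidual"
  proof -
    obtain \<Lambda> where \<Lambda>: "cblinfun_apply \<Lambda> = (\<lambda>g. cblinfun_apply \<Psi> (HL0_pairing (HL0_compose S g)))"
    proof (rule ex_cblinfun[of "\<lambda>g. cblinfun_apply \<Psi> (HL0_pairing (HL0_compose S g))" "norm \<Psi>"])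
      have zero: "HL0_compose S 0 = 0" "HL0_pairing (0 :: ('a, complex) HL0) = 0"
        using HL0_compose_lincomb[OF S_le, of 0 "- 1" 0] HL0_pairing_lincomb[of 0 "- 1" "0 :: ('a, complex) HL0"] by simp_all
      show "cblinfun_apply \<Psi> (HL0_pairing (HL0_compose S (f + g)))
        = cblinfun_apply \<Psi> (HL0_pairing (HL0_compose S f)) + cblinfun_apply \<Psi> (HL0_pairing (HL0_compose S g))" for f g
        using HL0_compose_lincomb[OF S_le, of f 1 g] HL0_pairing_lincomb[of "HL0_compose S f" 1 "HL0_compose S g"] by simp
      show "cblinfun_apply \<Psi> (HL0_pairing (HL0_compose S (c *\<^sub>C g)))
        = c *\<^sub>C cblinfun_apply \<Psi> (HL0_pairing (HL0_compose S g))" for c g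
        using HL0_compose_lincomb[OF S_le, of 0 c g] HL0_pairing_lincomb[of 0 c "HL0_compose S g"] by (simp add: zero)
      show "norm (cblinfun_apply \<Psi> (HL0_pairing (HL0_compose S g))) \<le> norm \<Psi> * norm g" for g
        using le[of \<Psi> g] mult_left_mono[OF norm_HL0_compose[OF S_le, of g] norm_ge_zero[of \<Psi>]] by linarith
    qed blast
    obtain \<theta> where "G0_functional \<theta> = \<Lambda>"
    proof (rule ex_G0[of \<Lambda>])
      fix \<epsilon> :: real assume \<epsilon>: "\<epsilon> > 0"
      define c where "c = norm \<Psi> + 1"
      define \<eta> where "\<eta> = \<epsilon> * r / (2 * c)"
      have pos: "c > 0" by (simp add: c_def add_nonneg_pos)
      have \<eta>: "\<eta> > 0"
        using \<epsilon> K(3) pos by (simp add: \<eta>_def)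
      have "cmod (cblinfun_apply \<Lambda> g) < \<epsilon>" if g: "\<forall>x\<in>K. cmod (HL0_apply g x) < \<eta>" for g
      proof -
        have "norm (HL0_compose S g) \<le> \<eta> / r"
          using g \<eta> by (intro K(4)) (auto intro: less_imp_le)
        then have "norm \<Psi> * norm (HL0_compose S g) \<le> c * (\<eta> / r)"
          using pos by (intro mult_mono) (auto simp: c_def)
        also have "\<dots> = \<epsilon> / 2"
          using K(3) pos by (simp add: \<eta>_def)
        finally show ?thesis
          using le[of \<Psi> g] \<epsilon> by (simp add: \<Lambda>)
      qed
      with K(1,2) \<eta> show "\<exists>K \<eta>. compact K \<and> K \<subseteq> ball 0 1 \<and> \<eta> > 0 \<and>
          (\<forall>g. norm g \<le> 2 \<and> (\<forall>x\<in>K. cmod (HL0_apply g x) < \<eta>) \<longrightarrow> cmod (cblinfun_apply \<Lambda> g) < \<epsilon>)"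
        by blast
    qed blast
    then show ?thesis by (metis \<Lambda>)
  qed
  then obtain \<theta> where \<theta>: "\<And>\<Psi> g. cblinfun_apply (G0_functional (\<theta> \<Psi>)) g = cblinfun_apply \<Psi> (HL0_pairing (HL0_compose S g))"
    by metis
  have \<theta>_norm: "norm (\<theta> \<Psi>) \<le> norm \<Psi>" for \<Psi>
  proof (rule G0_norm_le)
    show "cmod (cblinfun_apply (G0_functional (\<theta> \<Psi>)) g) \<le> norm \<Psi> * norm g" for g
      using le[of \<Psi> g] mult_left_mono[OF norm_HL0_compose[OF S_le, of g] norm_ge_zero[of \<Psi>]] by (simp add: \<theta>)
  qed simp
  obtain R where R: "cblinfun_apply R = \<theta>"
  proof (rule ex_cblinfun[of \<theta> 1])
    show "\<theta> (\<Psi> + \<Psi>') = \<theta> \<Psi> + \<theta> \<Psi>'" for \<Psi> \<Psi>'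
      by (rule G0_eqI) (simp add: \<theta>)
    show "\<theta> (c *\<^sub>C \<Psi>) = c *\<^sub>C \<theta> \<Psi>" for c \<Psi>
      by (rule G0_eqI) (simp add: \<theta>)
  qed (use \<theta>_norm in auto)
  have "\<forall>\<Psi> g. cblinfun_apply (G0_functional (cblinfun_apply R \<Psi>)) g = cblinfun_apply \<Psi> (HL0_pairing (HL0_compose S g))"
    by (simp add: R \<theta>)
  from someI[of "\<lambda>R. \<forall>\<Psi> g. cblinfun_apply (G0_functional (cblinfun_apply R \<Psi>)) g = cblinfun_apply \<Psi> (HL0_pairing (HL0_compose S g))", OF this]
  have eq: "cblinfun_apply (G0_functional (cblinfun_apply (predual_map S) \<Psi>)) g
      = cblinfun_apply \<Psi> (HL0_pairing (HL0_compose S g))" for \<Psi> g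
    unfolding predual_map_def by blast
  then have eq_\<theta>: "cblinfun_apply (predual_map S) \<Psi> = \<theta> \<Psi>"
    by (intro G0_eqI) (simp add: \<theta>)
  show "cblinfun_apply (G0_functional (cblinfun_apply (predual_map S) \<Psi>)) g
      = cblinfun_apply \<Psi> (HL0_pairing (HL0_compose S g))"
    by (rule eq)
  show "norm (cblinfun_apply (predual_map S) \<Psi>) \<le> norm \<Psi>"
    unfolding eq_\<theta> by (rule \<theta>_norm)
qed


section \<open>Isometry and local complementation\<close>

text \<open>Applied to \<open>g\<close>, the difference is \<open>g (S z) - g z\<close> with the extended operator \<open>S\<close>, to which the
  Lipschitz estimate for \<open>g\<close> applies.\<close>

lemma predual_map_T_Theta_delta:
  fixes S :: "('a::complex_normed_vector, 'a bidual) cblinfun"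
  assumes S: "finite_rank_contraction S B \<phi>" and z: "z \<in> ball 0 1"
  shows "norm (cblinfun_apply (predual_map S) (cblinfun_apply T_Theta (delta z)) - delta z)
    \<le> norm (weak_star_extension B \<phi> z - z)"
proof (rule G0_norm_le)
  fix g :: "('a bidual, complex) HL0"
  have S1: "norm S \<le> 1" and S_eq: "\<And>x. cblinfun_apply S x = (\<Sum>b\<in>B. cblinfun_apply (\<phi> b) x *\<^sub>C b)"
    and ext_le: "norm (weak_star_extension B \<phi> z) \<le> norm z"
    using S by (auto simp: finite_rank_contraction_def)
  have ext: "norm (weak_star_extension B \<phi> z) < 1"
    using ext_le z by simp
  have "HL0_apply (HL0_extension (HL0_compose S g)) z = AB_extension (HL0_apply (HL0_compose S g)) z"
    by (rule HL0_extension_apply[OF z])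
  also have "\<dots> = HL0_apply g (weak_star_extension B \<phi> z)"
    unfolding weak_star_extension_def
    by (rule AB_extension_finite_rank[OF S1 S_eq ext[unfolded weak_star_extension_def]])
  finally have "cblinfun_apply (G0_functional (cblinfun_apply (predual_map S) (cblinfun_apply T_Theta (delta z)) - delta z)) g
      = HL0_apply g (weak_star_extension B \<phi> z) - HL0_apply g z"
    by (simp add: predual_map_apply[OF S] T_Theta_pairing)
  moreover have "cmod (HL0_apply g (weak_star_extension B \<phi> z) - HL0_apply g z) \<le> norm g * norm (weak_star_extension B \<phi> z - z)"
    using ext z by (intro HL0_lipschitz_norm) auto
  ultimately show "cmod (cblinfun_apply (G0_functional (cblinfun_apply (predual_map S) (cblinfun_apply T_Theta (delta z)) - delta z)) g)
      \<le> norm (weak_star_extension B \<phi> z - z) * norm g"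
    by (simp only: mult.commute)
qed simp

text \<open>On combinations of evaluations this is the previous estimate; the norm bounds of the two
  operators extend it to the closure.\<close>

lemma predual_map_T_Theta_approx:
  fixes \<theta> :: "'a::complex_normed_vector bidual G0"
  assumes \<epsilon>: "\<epsilon> > 0"
  obtains Z \<eta> where "finite Z" "\<eta> > 0"
    "\<And>(S :: ('a, 'a bidual) cblinfun) B \<phi>. finite_rank_contraction S B \<phi> \<Longrightarrow>
      (\<And>z. z \<in> Z \<Longrightarrow> norm (weak_star_extension B \<phi> z - z) < \<eta>) \<Longrightarrow>
      norm (cblinfun_apply (predual_map S) (cblinfun_apply T_Theta \<theta>) - \<theta>) \<le> \<epsilon>"
proof -
  have "\<epsilon> / 3 > 0" using \<epsilon> by simp
  then obtain F c where F: "finite F" "F \<subseteq> ball 0 1" "norm (\<theta> - (\<Sum>x\<in>F. c x *\<^sub>C delta x)) \<le> \<epsilon> / 3"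
    by (rule delta_span_dense[of _ \<theta>]) blast
  define \<theta>0 where "\<theta>0 = (\<Sum>x\<in>F. c x *\<^sub>C delta x)"
  define C where "C = (\<Sum>x\<in>F. cmod (c x)) + 1"
  have C: "C > 0" by (simp add: C_def add_nonneg_pos sum_nonneg)
  define \<eta> where "\<eta> = \<epsilon> / (3 * C)"
  have \<eta>: "\<eta> > 0" using \<epsilon> C by (simp add: \<eta>_def)
  have "norm (cblinfun_apply (predual_map S) (cblinfun_apply T_Theta \<theta>) - \<theta>) \<le> \<epsilon>"
    if S: "finite_rank_contraction S B \<phi>" and small: "\<And>z. z \<in> F \<Longrightarrow> norm (weak_star_extension B \<phi> z - z) < \<eta>"
    for S :: "('a, 'a bidual) cblinfun" and B \<phi>
  proof -
    define Q where "Q \<theta> = cblinfun_apply (predual_map S) (cblinfun_apply T_Theta \<theta>)" for \<theta> :: "'a bidual G0"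
    have Q_norm: "norm (Q \<theta>) \<le> norm \<theta>" for \<theta>
      unfolding Q_def by (rule order_trans[OF predual_map_norm[OF S] T_Theta_norm])
    have Q_diff: "Q (\<theta> - \<theta>') = Q \<theta> - Q \<theta>'" for \<theta> \<theta>'
      by (simp add: Q_def)
    have "Q \<theta>0 - \<theta>0 = (\<Sum>x\<in>F. c x *\<^sub>C (Q (delta x) - delta x))"
      by (simp add: Q_def \<theta>0_def cblinfun_sum sum_subtractf complex_vector.scale_right_diff_distrib)
    also have "norm \<dots> \<le> (\<Sum>x\<in>F. cmod (c x) * \<eta>)"
    proof (rule sum_norm_le)
      fix x assume x: "x \<in> F"
      have "norm (Q (delta x) - delta x) \<le> norm (weak_star_extension B \<phi> x - x)"
        unfolding Q_def using F(2) x by (intro predual_map_T_Theta_delta[OF S]) blast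
      then show "norm (c x *\<^sub>C (Q (delta x) - delta x)) \<le> cmod (c x) * \<eta>"
        unfolding norm_scaleC using small[OF x] by (intro mult_left_mono) auto
    qed
    also have "\<dots> = (\<Sum>x\<in>F. cmod (c x)) * \<eta>"
      by (simp add: sum_distrib_right)
    also have "\<dots> \<le> C * \<eta>"
      using \<eta> by (intro mult_right_mono) (auto simp: C_def)
    also have "\<dots> = \<epsilon> / 3"
      using C by (simp add: \<eta>_def)
    finally have 1: "norm (Q \<theta>0 - \<theta>0) \<le> \<epsilon> / 3" .
    have 2: "norm (\<theta> - \<theta>0) \<le> \<epsilon> / 3"
      using F(3) by (simp add: \<theta>0_def)
    have 3: "norm (Q (\<theta> - \<theta>0)) \<le> \<epsilon> / 3"
      using Q_norm[of "\<theta> - \<theta>0"] 2 by linarith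
    have "Q \<theta> - \<theta> = Q (\<theta> - \<theta>0) + (Q \<theta>0 - \<theta>0) - (\<theta> - \<theta>0)"
      by (simp add: Q_diff)
    then have "norm (Q \<theta> - \<theta>) \<le> norm (Q (\<theta> - \<theta>0)) + norm (Q \<theta>0 - \<theta>0) + norm (\<theta> - \<theta>0)"
      using norm_triangle_ineq4[of "Q (\<theta> - \<theta>0) + (Q \<theta>0 - \<theta>0)" "\<theta> - \<theta>0"]
        norm_triangle_ineq[of "Q (\<theta> - \<theta>0)" "Q \<theta>0 - \<theta>0"] by simp
    with 1 2 3 show ?thesis by (simp add: Q_def)
  qed
  with F(1) \<eta> show thesis by (rule that)
qed

text \<open>The finitely many approximation conditions for the elements of \<open>\<Theta>\<close> involve finitely many points
  in all, so one operator of finite rank satisfies all of them.\<close>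

lemma ex_predual_map:
  fixes \<Theta> :: "'a::complex_normed_vector bidual G0 set"
  assumes map: "metric_approximation_property TYPE('a bidual)" and \<Theta>: "finite \<Theta>" and \<epsilon>: "\<epsilon> > 0"
  obtains R :: "('a G0 bidual, 'a bidual G0) cblinfun" where "\<And>\<Psi>. norm (cblinfun_apply R \<Psi>) \<le> norm \<Psi>"
    "\<And>\<theta>. \<theta> \<in> \<Theta> \<Longrightarrow> norm (cblinfun_apply R (cblinfun_apply T_Theta \<theta>) - \<theta>) \<le> \<epsilon>"
proof -
  define good where "good \<theta> Z \<eta> \<longleftrightarrow> finite Z \<and> \<eta> > 0 \<and>
      (\<forall>(S :: ('a, 'a bidual) cblinfun) B \<phi>. finite_rank_contraction S B \<phi> \<longrightarrow>
        (\<forall>z\<in>Z. norm (weak_star_extension B \<phi> z - z) < \<eta>) \<longrightarrow>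
        norm (cblinfun_apply (predual_map S) (cblinfun_apply T_Theta \<theta>) - \<theta>) \<le> \<epsilon>)"
    for \<theta> :: "'a bidual G0" and Z :: "'a bidual set" and \<eta> :: real
  have "\<exists>Z \<eta>. good \<theta> Z \<eta>" for \<theta>
  proof (rule predual_map_T_Theta_approx[OF \<epsilon>, of \<theta>])
    fix Z :: "'a bidual set" and \<eta> :: real
    assume 1: "finite Z" "\<eta> > 0"
      and 2: "\<And>(S :: ('a, 'a bidual) cblinfun) B \<phi>. finite_rank_contraction S B \<phi> \<Longrightarrow>
        (\<And>z. z \<in> Z \<Longrightarrow> norm (weak_star_extension B \<phi> z - z) < \<eta>) \<Longrightarrow>
        norm (cblinfun_apply (predual_map S) (cblinfun_apply T_Theta \<theta>) - \<theta>) \<le> \<epsilon>"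
    have "good \<theta> Z \<eta>"
      unfolding good_def
    proof (intro conjI allI impI 1)
      fix S :: "('a, 'a bidual) cblinfun" and B \<phi>
      assume S: "finite_rank_contraction S B \<phi>" and small: "\<forall>z\<in>Z. norm (weak_star_extension B \<phi> z - z) < \<eta>"
      show "norm (cblinfun_apply (predual_map S) (cblinfun_apply T_Theta \<theta>) - \<theta>) \<le> \<epsilon>"
        by (rule 2[OF S]) (rule small[rule_format])
    qed
    then show ?thesis by blast
  qed
  then obtain Z \<eta> where good: "\<And>\<theta>. good \<theta> (Z \<theta>) (\<eta> \<theta>)" by metis
  have Z: "finite (Z \<theta>)" "\<eta> \<theta> > 0" for \<theta>
    using good[of \<theta>] by (simp_all only: good_def)
  define \<eta>0 where "\<eta>0 = Min (insert 1 (\<eta> ` \<Theta>))"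
  have \<eta>0: "\<eta>0 > 0" "\<And>\<theta>. \<theta> \<in> \<Theta> \<Longrightarrow> \<eta>0 \<le> \<eta> \<theta>"
    using \<Theta> Z(2) by (auto simp: \<eta>0_def)
  have "finite (\<Union>\<theta>\<in>\<Theta>. Z \<theta>)"
    using \<Theta> Z(1) by blast
  then obtain S :: "('a, 'a bidual) cblinfun" and B \<phi> where S: "finite_rank_contraction S B \<phi>"
    "\<And>z. z \<in> (\<Union>\<theta>\<in>\<Theta>. Z \<theta>) \<Longrightarrow> norm (weak_star_extension B \<phi> z - z) < \<eta>0"
    by (rule finite_rank_contraction_approximation[OF map _ \<eta>0(1)]) blast
  show thesis
  proof (rule that[of "predual_map S"])
    show "norm (cblinfun_apply (predual_map S) \<Psi>) \<le> norm \<Psi>" for \<Psi>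
      by (rule predual_map_norm[OF S(1)])
    fix \<theta> assume \<theta>: "\<theta> \<in> \<Theta>"
    have "norm (weak_star_extension B \<phi> z - z) < \<eta> \<theta>" if "z \<in> Z \<theta>" for z
      using S(2)[of z] \<eta>0(2)[OF \<theta>] that \<theta> by fastforce
    then show "norm (cblinfun_apply (predual_map S) (cblinfun_apply T_Theta \<theta>) - \<theta>) \<le> \<epsilon>"
      by (intro good[of \<theta>, unfolded good_def, THEN conjunct2, THEN conjunct2, rule_format, OF S(1)])
  qed
qed

lemma T_Theta_isometry:
  fixes \<theta> :: "'a::complex_normed_vector bidual G0"
  assumes "metric_approximation_property TYPE('a bidual)"
  shows "norm (cblinfun_apply (T_Theta :: ('a bidual G0, 'a G0 bidual) cblinfun) \<theta>) = norm \<theta>"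
proof (rule antisym)
  show "norm \<theta> \<le> norm (cblinfun_apply T_Theta \<theta>)"
  proof (rule field_le_epsilon)
    fix e :: real assume e: "e > 0"
    obtain R :: "('a G0 bidual, 'a bidual G0) cblinfun" where R: "\<And>\<Psi>. norm (cblinfun_apply R \<Psi>) \<le> norm \<Psi>"
      "\<And>\<theta>'. \<theta>' \<in> {\<theta>} \<Longrightarrow> norm (cblinfun_apply R (cblinfun_apply T_Theta \<theta>') - \<theta>') \<le> e"
      by (rule ex_predual_map[OF assms _ e, of "{\<theta>}"]) auto
    have "norm \<theta> \<le> norm (cblinfun_apply R (cblinfun_apply T_Theta \<theta>)) + norm (cblinfun_apply R (cblinfun_apply T_Theta \<theta>) - \<theta>)"
      using norm_triangle_sub[of \<theta> "cblinfun_apply R (cblinfun_apply T_Theta \<theta>)"] by (simp add: norm_minus_commute)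
    also have "\<dots> \<le> norm (cblinfun_apply T_Theta \<theta>) + e"
      using R(1) R(2)[of \<theta>] by (intro add_mono) auto
    finally show "norm \<theta> \<le> norm (cblinfun_apply T_Theta \<theta>) + e" .
  qed
qed (rule T_Theta_norm)

text \<open>The map \<open>x \<mapsto> \<Sum>b\<in>B'. h b x \<cdot> b\<close> is a bounded projection onto the intersection.\<close>

lemma finite_dimensional_projection:
  fixes G E :: "'a::complex_normed_vector set"
  assumes "finite B" "G = complex_vector.span B" "complex_vector.subspace E"
  obtains B' and h :: "'a \<Rightarrow> 'a dual" where "finite B'" "B' \<subseteq> E"
    "\<And>x. x \<in> G \<inter> E \<Longrightarrow> x = (\<Sum>b\<in>B'. cblinfun_apply (h b) x *\<^sub>C b)"
proof -
  have sub: "complex_vector.subspace (G \<inter> E)"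
    unfolding assms(2) by (intro complex_vector.subspace_inter complex_vector.subspace_span assms(3))
  obtain B1 where B1: "B1 \<subseteq> G \<inter> E" "complex_vector.independent B1" "G \<inter> E \<subseteq> complex_vector.span B1"
    by (rule complex_vector.maximal_independent_subset)
  have fin: "finite B1"
    using complex_vector.independent_span_bound[OF assms(1) B1(2)] B1(1) assms(2) by blast
  obtain B' and h :: "'a \<Rightarrow> 'a dual" where B': "finite B'" "B' \<subseteq> B1"
    "complex_vector.span B' = complex_vector.span B1"
    "\<And>x. x \<in> complex_vector.span B1 \<Longrightarrow> x = (\<Sum>b\<in>B'. cblinfun_apply (h b) x *\<^sub>C b)"
    by (rule finite_span_coordinates[OF fin]) blast
  show thesis
  proof (rule that[OF B'(1)])
    show "B' \<subseteq> E" using B'(2) B1(1) by blast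
    show "x = (\<Sum>b\<in>B'. cblinfun_apply (h b) x *\<^sub>C b)" if "x \<in> G \<inter> E" for x
      using that B1(3) by (intro B'(4)) blast
  qed
qed

text \<open>With \<open>Q = T\<^sub>\<Theta> R\<close> and the projection \<open>\<Sum>b. h b x \<cdot> b\<close> onto the intersection of \<open>G\<close> with the
  range of \<open>T\<^sub>\<Theta>\<close>, the map \<open>P x = Q x + \<Sum>b. h b x \<cdot> (b - Q b)\<close> takes values in the range and is the
  identity on the intersection. Its second part has norm at most \<open>\<epsilon>\<close> if \<open>R\<close> is chosen such that the
  errors \<open>b - Q b\<close> are at most \<open>\<epsilon>\<close> divided by the sum of the norms of the \<open>h b\<close>.\<close>

theorem theorem5p4:
  assumes "symmetrically_regular TYPE('a::complex_banach)"
    and "metric_approximation_property TYPE('a bidual)"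
  shows "one_locally_complemented
      (range (cblinfun_apply (T_Theta :: ('a bidual G0, 'a G0 bidual) cblinfun)))
    \<and> (\<forall>\<phi> :: 'a bidual G0. norm (cblinfun_apply (T_Theta :: ('a bidual G0, 'a G0 bidual) cblinfun) \<phi>) = norm \<phi>)"
proof (intro conjI allI)
  let ?T = "T_Theta :: ('a bidual G0, 'a G0 bidual) cblinfun"
  let ?E = "range (cblinfun_apply ?T)"
  show "norm (cblinfun_apply ?T \<phi>) = norm \<phi>" for \<phi>
    by (rule T_Theta_isometry[OF assms(2)])
  have E: "complex_vector.subspace ?E"
    unfolding complex_vector.subspace_def
  proof (intro conjI ballI allI)
    show "0 \<in> ?E"
      by (rule range_eqI[of _ _ 0]) simp
    fix x y c assume "x \<in> ?E" "y \<in> ?E"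
    then obtain \<phi> \<psi> where xy: "x = cblinfun_apply ?T \<phi>" "y = cblinfun_apply ?T \<psi>" by blast
    show "x + y \<in> ?E"
      by (rule range_eqI[of _ _ "\<phi> + \<psi>"]) (simp add: xy)
    show "c *\<^sub>C x \<in> ?E"
      by (rule range_eqI[of _ _ "c *\<^sub>C \<phi>"]) (simp add: xy)
  qed
  show "one_locally_complemented ?E"
    unfolding one_locally_complemented_def
  proof (intro conjI E allI impI)
    fix \<epsilon> :: real and G :: "'a G0 bidual set"
    assume \<epsilon>: "\<epsilon> > 0" and "\<exists>B. finite B \<and> G = complex_vector.span B"
    then obtain B where B: "finite B" "G = complex_vector.span B" by blast
    obtain B' and h :: "'a G0 bidual \<Rightarrow> 'a G0 bidual dual" where B': "finite B'" "B' \<subseteq> ?E"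
      and coord: "\<And>x. x \<in> G \<inter> ?E \<Longrightarrow> x = (\<Sum>b\<in>B'. cblinfun_apply (h b) x *\<^sub>C b)"
      by (rule finite_dimensional_projection[OF B E]) blast
    define C where "C = (\<Sum>b\<in>B'. norm (h b)) + 1"
    have C: "C > 0" by (simp add: C_def add_nonneg_pos sum_nonneg)
    have "\<exists>\<theta>. b = cblinfun_apply ?T \<theta>" if "b \<in> B'" for b
      using that B'(2) by blast
    then obtain \<theta> where \<theta>: "\<And>b. b \<in> B' \<Longrightarrow> b = cblinfun_apply ?T (\<theta> b)" by metis
    have "finite (\<theta> ` B')" "\<epsilon> / C > 0"
      using B'(1) \<epsilon> C by auto
    then obtain R :: "('a G0 bidual, 'a bidual G0) cblinfun" where R: "\<And>\<Psi>. norm (cblinfun_apply R \<Psi>) \<le> norm \<Psi>"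
      "\<And>\<phi>. \<phi> \<in> \<theta> ` B' \<Longrightarrow> norm (cblinfun_apply R (cblinfun_apply ?T \<phi>) - \<phi>) \<le> \<epsilon> / C"
      by (rule ex_predual_map[OF assms(2)]) blast
    define Q where "Q x = cblinfun_apply ?T (cblinfun_apply R x)" for x
    define P where "P x = Q x + (\<Sum>b\<in>B'. cblinfun_apply (h b) x *\<^sub>C (b - Q b))" for x
    have Q_add: "Q (x + y) = Q x + Q y" and Q_scale: "Q (c *\<^sub>C x) = c *\<^sub>C Q x" and Q_E: "Q x \<in> ?E" for x y c
      by (simp_all add: Q_def)
    have Q_norm: "norm (Q x) \<le> norm x" for x
      unfolding Q_def by (rule order_trans[OF T_Theta_norm R(1)])
    have Q_b: "norm (b - Q b) \<le> \<epsilon> / C" if b: "b \<in> B'" for b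
    proof -
      have "b - Q b = cblinfun_apply ?T (\<theta> b - cblinfun_apply R (cblinfun_apply ?T (\<theta> b)))"
        unfolding Q_def cblinfun_diff by (simp only: \<theta>[OF b, symmetric])
      also have "norm \<dots> \<le> norm (\<theta> b - cblinfun_apply R (cblinfun_apply ?T (\<theta> b)))"
        by (rule T_Theta_norm)
      also have "\<dots> \<le> \<epsilon> / C"
        using R(2)[of "\<theta> b"] b by (simp add: norm_minus_commute)
      finally show ?thesis .
    qed
    show "\<exists>P. P ` G \<subseteq> ?E \<and>
        (\<forall>x\<in>G. \<forall>y\<in>G. P (x + y) = P x + P y) \<and>
        (\<forall>c. \<forall>x\<in>G. P (c *\<^sub>C x) = c *\<^sub>C P x) \<and>
        (\<forall>x\<in>G. norm (P x) \<le> (1 + \<epsilon>) * norm x) \<and>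
        (\<forall>x\<in>G \<inter> ?E. P x = x)"
    proof (intro exI[of _ P] conjI ballI allI image_subsetI)
      fix x y c
      have "b - Q b \<in> ?E" if "b \<in> B'" for b
        using that B'(2) by (intro complex_vector.subspace_diff[OF E] Q_E) blast
      then have "(\<Sum>b\<in>B'. cblinfun_apply (h b) x *\<^sub>C (b - Q b)) \<in> ?E"
        by (intro complex_vector.subspace_sum[OF E] complex_vector.subspace_scale[OF E])
      then show "P x \<in> ?E"
        unfolding P_def by (rule complex_vector.subspace_add[OF E Q_E])
      show "P (x + y) = P x + P y"
        by (simp add: P_def Q_add scaleC_add_left sum.distrib)
      show "P (c *\<^sub>C x) = c *\<^sub>C P x"
        by (simp add: P_def Q_scale scaleC_add_right complex_vector.scale_sum_right scaleC_scaleC)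
      have "norm (\<Sum>b\<in>B'. cblinfun_apply (h b) x *\<^sub>C (b - Q b)) \<le> (\<Sum>b\<in>B'. norm (h b) * norm x * (\<epsilon> / C))"
      proof (rule sum_norm_le)
        fix b assume "b \<in> B'"
        then show "norm (cblinfun_apply (h b) x *\<^sub>C (b - Q b)) \<le> norm (h b) * norm x * (\<epsilon> / C)"
          unfolding norm_scaleC using Q_b by (intro mult_mono cblinfun_norm) auto
      qed
      also have "\<dots> = (\<Sum>b\<in>B'. norm (h b)) * (norm x * (\<epsilon> / C))"
        by (simp only: sum_distrib_right mult.assoc)
      also have "\<dots> \<le> C * (norm x * (\<epsilon> / C))"
        using \<epsilon> C by (intro mult_right_mono) (auto simp: C_def)
      also have "\<dots> = \<epsilon> * norm x"
        using C by simp
      finally have "norm (P x) \<le> norm x + \<epsilon> * norm x"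
        unfolding P_def using Q_norm[of x] by (intro order_trans[OF norm_triangle_ineq] add_mono) auto
      then show "norm (P x) \<le> (1 + \<epsilon>) * norm x"
        by (simp add: distrib_right)
    next
      fix x assume x: "x \<in> G \<inter> ?E"
      have Q_sum: "Q (\<Sum>b\<in>B'. c b *\<^sub>C b) = (\<Sum>b\<in>B'. c b *\<^sub>C Q b)" for c
        unfolding Q_def cblinfun_sum by simp
      have "Q x = Q (\<Sum>b\<in>B'. cblinfun_apply (h b) x *\<^sub>C b)"
        using coord[OF x] by (rule arg_cong)
      also have "\<dots> = (\<Sum>b\<in>B'. cblinfun_apply (h b) x *\<^sub>C Q b)"
        by (rule Q_sum)
      finally have "P x = (\<Sum>b\<in>B'. cblinfun_apply (h b) x *\<^sub>C b)"
        by (simp add: P_def complex_vector.scale_right_diff_distrib sum_subtractf)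
      also have "\<dots> = x"
        by (rule coord[OF x, symmetric])
      finally show "P x = x" .
    qed
  qed
qed

end
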